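(* Let $K$ be a field and $\mathcal G$ a discrete transitive groupoid with isotropy group $G_u$ at $u\in\mathcal G^0$. Then $K\mathcal G\cong M_{\mathcal G^0}(KG_u)$. Hence $K\mathcal G$ is CCR if and only if $KG_u$ is CCR, and $K\mathcal G$ is GCR if and only if $KG_u$ is GCR.
   Context: Here $\mathcal G$ is a groupoid with object set $\mathcal G^0$ and arrow set $\mathcal G^1$, both with the discrete topology. It is transitive if for any two objects $v,w$ there is an arrow $v\to w$ (i.e. it has a single orbit). $G_u$ is the group of arrows $u\to u$ and $KG_u$ its group algebra. For discrete $\mathcal G$ the Steinberg algebra $K\mathcal G$ is the $K$-algebra of finitely supported functions $\mathcal G^1\to K$ with convolution $(f\ast g)(\gamma)=\sum_{s(\alpha)=s(\gamma)}f(\gamma\alpha^{-1})g(\alpha)$, where $s(\gamma)$ is the source of $\gamma$. For a ring $R$ and index set $I$, $M_I(R)$ is the ring of all $I\times I$ matrices over $R$ with finitely many non-zero entries. Rings are not assumed unital; modules are left modules. A module $M$ over a ring $R$ is simple if $RM\neq 0$ and its only submodules are $0$ and $M$. A ring is primitive if it has a faithful simple module. A ring $R$ is simple if $R^2\neq 0$ and it has no proper non-zero two-sided ideals. A minimal left ideal is a simple submodule of the left regular module $R$. A ring is CCR if every primitive quotient ring of it is simple and has a minimal left ideal; it is GCR if every primitive quotient ring of it has a minimal left ideal. *)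

theory Defs
  imports "HOL-Algebra.QuotRing" "HOL-Algebra.Module"
begin

section \<open>Rings without unit, their ideals and their left modules\<close>

text \<open>Rings without unit are represented by the \<^type>\<open>ring_ext\<close> records of HOL-Algebra. The
  \<open>one\<close> field of such a record carries no meaning: none of the notions below refers to it.\<close>

locale rng = abelian_group R for R (structure) +
  assumes m_closed: "\<lbrakk>x \<in> carrier R; y \<in> carrier R\<rbrakk> \<Longrightarrow> x \<otimes> y \<in> carrier R"
    and m_assoc: "\<lbrakk>x \<in> carrier R; y \<in> carrier R; z \<in> carrier R\<rbrakk> \<Longrightarrow> (x \<otimes> y) \<otimes> z = x \<otimes> (y \<otimes> z)"
    and l_distr: "\<lbrakk>x \<in> carrier R; y \<in> carrier R; z \<in> carrier R\<rbrakk> \<Longrightarrow> (x \<oplus> y) \<otimes> z = x \<otimes> z \<oplus> y \<otimes> z"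
    and r_distr: "\<lbrakk>x \<in> carrier R; y \<in> carrier R; z \<in> carrier R\<rbrakk> \<Longrightarrow> z \<otimes> (x \<oplus> y) = z \<otimes> x \<oplus> z \<otimes> y"

locale rng_ideal = additive_subgroup I R + rng R for I and R (structure) +
  assumes I_l_closed: "\<lbrakk>a \<in> I; x \<in> carrier R\<rbrakk> \<Longrightarrow> x \<otimes> a \<in> I"
    and I_r_closed: "\<lbrakk>a \<in> I; x \<in> carrier R\<rbrakk> \<Longrightarrow> a \<otimes> x \<in> I"

locale rng_module = R?: rng R + M?: abelian_group M
  for R :: "('r, 'm) ring_scheme" (structure) and M :: "('r, 'b, 'n) module_scheme" (structure) +
  assumes smult_closed:
      "\<lbrakk>a \<in> carrier R; x \<in> carrier M\<rbrakk> \<Longrightarrow> a \<odot>\<^bsub>M\<^esub> x \<in> carrier M"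
    and smult_l_distr:
      "\<lbrakk>a \<in> carrier R; b \<in> carrier R; x \<in> carrier M\<rbrakk> \<Longrightarrow>
        (a \<oplus>\<^bsub>R\<^esub> b) \<odot>\<^bsub>M\<^esub> x = a \<odot>\<^bsub>M\<^esub> x \<oplus>\<^bsub>M\<^esub> b \<odot>\<^bsub>M\<^esub> x"
    and smult_r_distr:
      "\<lbrakk>a \<in> carrier R; x \<in> carrier M; y \<in> carrier M\<rbrakk> \<Longrightarrow>
        a \<odot>\<^bsub>M\<^esub> (x \<oplus>\<^bsub>M\<^esub> y) = a \<odot>\<^bsub>M\<^esub> x \<oplus>\<^bsub>M\<^esub> a \<odot>\<^bsub>M\<^esub> y"
    and smult_assoc:
      "\<lbrakk>a \<in> carrier R; b \<in> carrier R; x \<in> carrier M\<rbrakk> \<Longrightarrow>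
        (a \<otimes>\<^bsub>R\<^esub> b) \<odot>\<^bsub>M\<^esub> x = a \<odot>\<^bsub>M\<^esub> (b \<odot>\<^bsub>M\<^esub> x)"

definition simple_module :: "('r, 'm) ring_scheme \<Rightarrow> ('r, 'b, 'n) module_scheme \<Rightarrow> bool" where
  "simple_module R M \<longleftrightarrow> rng_module R M \<and>
     (\<exists>a\<in>carrier R. \<exists>x\<in>carrier M. a \<odot>\<^bsub>M\<^esub> x \<noteq> \<zero>\<^bsub>M\<^esub>) \<and>
     (\<forall>N. submodule N R M \<longrightarrow> N = {\<zero>\<^bsub>M\<^esub>} \<or> N = carrier M)"

definition faithful_module :: "('r, 'm) ring_scheme \<Rightarrow> ('r, 'b, 'n) module_scheme \<Rightarrow> bool" where
  "faithful_module R M \<longleftrightarrow> rng_module R M \<and>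
     (\<forall>a\<in>carrier R. (\<forall>x\<in>carrier M. a \<odot>\<^bsub>M\<^esub> x = \<zero>\<^bsub>M\<^esub>) \<longrightarrow> a = \<zero>\<^bsub>R\<^esub>)"

text \<open>HOL cannot quantify over the type of the elements of a module inside a definition. Since a
  simple module \<open>M\<close> is isomorphic to \<open>R / {a. a x = 0}\<close> for every nonzero \<open>x\<close> in \<open>M\<close>, it is no
  restriction to ask for a module whose elements are sets of ring elements; lemma
  \<open>primitive_rngI\<close> below confirms this.\<close>

definition primitive_rng :: "('r, 'm) ring_scheme \<Rightarrow> bool" where
  "primitive_rng R \<longleftrightarrow>
     (\<exists>M :: ('r, 'r set) module. simple_module R M \<and> faithful_module R M)"

definition simple_rng :: "('r, 'm) ring_scheme \<Rightarrow> bool" where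
  "simple_rng R \<longleftrightarrow> rng R \<and>
     (\<exists>x\<in>carrier R. \<exists>y\<in>carrier R. x \<otimes>\<^bsub>R\<^esub> y \<noteq> \<zero>\<^bsub>R\<^esub>) \<and>
     (\<forall>I. rng_ideal I R \<longrightarrow> I = {\<zero>\<^bsub>R\<^esub>} \<or> I = carrier R)"

definition regular_module :: "('r, 'm) ring_scheme \<Rightarrow> ('r, 'r) module" where
  "regular_module R = \<lparr>carrier = carrier R, mult = mult R, one = one R,
     zero = zero R, add = add R, smult = mult R\<rparr>"

definition minimal_left_ideal :: "'r set \<Rightarrow> ('r, 'm) ring_scheme \<Rightarrow> bool" where
  "minimal_left_ideal L R \<longleftrightarrow>
     submodule L R (regular_module R) \<and> simple_module R ((regular_module R)\<lparr>carrier := L\<rparr>)"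

text \<open>\<^const>\<open>FactRing\<close> forms cosets and their products; only the (meaningless) \<open>one\<close> field of
  its result depends on a unit of \<open>R\<close>.\<close>

definition CCR_rng :: "('r, 'm) ring_scheme \<Rightarrow> bool" where
  "CCR_rng R \<longleftrightarrow> rng R \<and>
     (\<forall>I. rng_ideal I R \<and> primitive_rng (R Quot I) \<longrightarrow>
        simple_rng (R Quot I) \<and> (\<exists>L. minimal_left_ideal L (R Quot I)))"

definition GCR_rng :: "('r, 'm) ring_scheme \<Rightarrow> bool" where
  "GCR_rng R \<longleftrightarrow> rng R \<and>
     (\<forall>I. rng_ideal I R \<and> primitive_rng (R Quot I) \<longrightarrow>
        (\<exists>L. minimal_left_ideal L (R Quot I)))"


lemma submodule_iff:
  assumes "rng_module R M"
  shows "submodule N R M \<longleftrightarrow> N \<subseteq> carrier M \<and> \<zero>\<^bsub>M\<^esub> \<in> N \<and>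
    (\<forall>x\<in>N. \<forall>y\<in>N. x \<oplus>\<^bsub>M\<^esub> y \<in> N) \<and> (\<forall>x\<in>N. \<ominus>\<^bsub>M\<^esub> x \<in> N) \<and>
    (\<forall>a\<in>carrier R. \<forall>x\<in>N. a \<odot>\<^bsub>M\<^esub> x \<in> N)"
  unfolding submodule_def submodule_axioms_def subgroup_def a_inv_def by auto

lemma (in rng_module) smult_r_zero: "a \<in> carrier R \<Longrightarrow> a \<odot>\<^bsub>M\<^esub> \<zero>\<^bsub>M\<^esub> = \<zero>\<^bsub>M\<^esub>"
  by (metis M.add.l_cancel_one M.zero_closed smult_closed smult_r_distr M.r_zero)

lemma (in rng_module) smult_r_minus:
  "\<lbrakk>a \<in> carrier R; x \<in> carrier M\<rbrakk> \<Longrightarrow> a \<odot>\<^bsub>M\<^esub> (\<ominus>\<^bsub>M\<^esub> x) = \<ominus>\<^bsub>M\<^esub> (a \<odot>\<^bsub>M\<^esub> x)"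
  by (metis M.a_inv_closed M.l_neg M.minus_equality smult_closed smult_r_distr smult_r_zero)

lemma (in rng_module) smult_l_zero: "x \<in> carrier M \<Longrightarrow> \<zero>\<^bsub>R\<^esub> \<odot>\<^bsub>M\<^esub> x = \<zero>\<^bsub>M\<^esub>"
  by (metis M.add.l_cancel_one R.zero_closed smult_closed smult_l_distr R.r_zero)

lemma (in rng_module) smult_l_minus:
  "\<lbrakk>a \<in> carrier R; x \<in> carrier M\<rbrakk> \<Longrightarrow> (\<ominus>\<^bsub>R\<^esub> a) \<odot>\<^bsub>M\<^esub> x = \<ominus>\<^bsub>M\<^esub> (a \<odot>\<^bsub>M\<^esub> x)"
  by (metis R.a_inv_closed R.l_neg M.minus_equality smult_closed smult_l_distr smult_l_zero)

lemma simple_module_cyclic: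
  fixes R :: "('r, 'm) ring_scheme" and M :: "('r, 'b, 'n) module_scheme"
  assumes "simple_module R M"
  obtains z where "z \<in> carrier M" "carrier M = (\<lambda>a. a \<odot>\<^bsub>M\<^esub> z) ` carrier R"
proof -
  obtain a z where az: "a \<in> carrier R" "z \<in> carrier M" "a \<odot>\<^bsub>M\<^esub> z \<noteq> \<zero>\<^bsub>M\<^esub>"
    using assms unfolding simple_module_def by auto
  interpret rng_module R M using assms unfolding simple_module_def by auto
  let ?N = "(\<lambda>a. a \<odot>\<^bsub>M\<^esub> z) ` carrier R"
  have "submodule ?N R M"
    unfolding submodule_iff[OF rng_module_axioms]
  proof (intro conjI ballI)
    show "?N \<subseteq> carrier M" using az smult_closed by auto
    show "\<zero>\<^bsub>M\<^esub> \<in> ?N" using smult_l_zero[OF az(2)] by (metis R.zero_closed image_eqI)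
    show "x \<oplus>\<^bsub>M\<^esub> y \<in> ?N" if "x \<in> ?N" "y \<in> ?N" for x y
      using that az(2) smult_l_distr by (auto simp: image_iff) (metis R.a_closed)
    show "\<ominus>\<^bsub>M\<^esub> x \<in> ?N" if "x \<in> ?N" for x
      using that az(2) smult_l_minus by (auto simp: image_iff) (metis R.a_inv_closed)
    show "b \<odot>\<^bsub>M\<^esub> x \<in> ?N" if "b \<in> carrier R" "x \<in> ?N" for b x
      using that az(2) smult_assoc by (auto simp: image_iff) (metis R.m_closed)
  qed
  moreover have "?N \<noteq> {\<zero>\<^bsub>M\<^esub>}" using az by auto
  ultimately have "?N = carrier M" using assms unfolding simple_module_def by auto
  then show ?thesis using that az(2) by blast
qed

lemma primitive_rngI:
  fixes R :: "('r, 'm) ring_scheme" and M :: "('r, 'b, 'n) module_scheme"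
  assumes simple: "simple_module R M" and faithful: "faithful_module R M"
  shows "primitive_rng R"
proof -
  obtain z where z: "z \<in> carrier M" "carrier M = (\<lambda>a. a \<odot>\<^bsub>M\<^esub> z) ` carrier R"
    using simple_module_cyclic[OF simple] .
  interpret rng_module R M using simple unfolding simple_module_def by auto
  define f where "f x = {a \<in> carrier R. a \<odot>\<^bsub>M\<^esub> z = x}" for x
  define g where "g = the_inv_into (carrier M) f"
  have inj: "inj_on f (carrier M)"
    unfolding inj_on_def f_def z(2) by auto
  have gf[simp]: "g (f x) = x" if "x \<in> carrier M" for x
    unfolding g_def using the_inv_into_f_f[OF inj that] .
  have f_eq: "f x = f y \<longleftrightarrow> x = y" if "x \<in> carrier M" "y \<in> carrier M" for x y
    using inj that by (auto simp: inj_on_def)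
  define M' :: "('r, 'r set) module" where
    "M' = \<lparr>carrier = f ` carrier M, mult = undefined, one = undefined, zero = f \<zero>\<^bsub>M\<^esub>,
       add = (\<lambda>A B. f (g A \<oplus>\<^bsub>M\<^esub> g B)), smult = (\<lambda>a A. f (a \<odot>\<^bsub>M\<^esub> g A))\<rparr>"
  have M'_simps: "carrier M' = f ` carrier M" "\<zero>\<^bsub>M'\<^esub> = f \<zero>\<^bsub>M\<^esub>"
    "\<And>x y. \<lbrakk>x \<in> carrier M; y \<in> carrier M\<rbrakk> \<Longrightarrow> f x \<oplus>\<^bsub>M'\<^esub> f y = f (x \<oplus>\<^bsub>M\<^esub> y)"
    "\<And>a x. \<lbrakk>a \<in> carrier R; x \<in> carrier M\<rbrakk> \<Longrightarrow> a \<odot>\<^bsub>M'\<^esub> f x = f (a \<odot>\<^bsub>M\<^esub> x)"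
    by (simp_all add: M'_def)
  have "abelian_group M'"
  proof (rule abelian_groupI)
    fix A B C assume "A \<in> carrier M'" "B \<in> carrier M'" "C \<in> carrier M'"
    then show "A \<oplus>\<^bsub>M'\<^esub> B \<oplus>\<^bsub>M'\<^esub> C = A \<oplus>\<^bsub>M'\<^esub> (B \<oplus>\<^bsub>M'\<^esub> C)"
      by (auto simp: M'_simps M.a_assoc)
  next
    fix A assume "A \<in> carrier M'"
    then obtain x where "x \<in> carrier M" "A = f x" by (auto simp: M'_simps)
    then show "\<exists>B\<in>carrier M'. B \<oplus>\<^bsub>M'\<^esub> A = \<zero>\<^bsub>M'\<^esub>"
      by (intro bexI[of _ "f (\<ominus>\<^bsub>M\<^esub> x)"]) (auto simp: M'_simps M.l_neg)
  qed (auto simp: M'_simps M.a_comm)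
  then have module': "rng_module R M'"
    unfolding rng_module_def rng_module_axioms_def using R.rng_axioms
    by (auto simp: M'_simps R.m_closed smult_closed smult_l_distr smult_r_distr smult_assoc)
  then interpret M': rng_module R M' .
  have preimage: "submodule {x \<in> carrier M. f x \<in> N} R M" if "submodule N R M'" for N
  proof -
    have N: "\<zero>\<^bsub>M'\<^esub> \<in> N" "\<And>A B. \<lbrakk>A \<in> N; B \<in> N\<rbrakk> \<Longrightarrow> A \<oplus>\<^bsub>M'\<^esub> B \<in> N"
      "\<And>A. A \<in> N \<Longrightarrow> \<ominus>\<^bsub>M'\<^esub> A \<in> N"
      "\<And>a A. \<lbrakk>a \<in> carrier R; A \<in> N\<rbrakk> \<Longrightarrow> a \<odot>\<^bsub>M'\<^esub> A \<in> N"
      using that unfolding submodule_iff[OF module'] by auto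
    have "f \<zero>\<^bsub>M\<^esub> \<in> N" using N(1) by (simp add: M'_simps)
    moreover have "f (x \<oplus>\<^bsub>M\<^esub> y) \<in> N"
      if "x \<in> carrier M" "y \<in> carrier M" "f x \<in> N" "f y \<in> N" for x y
      using N(2)[OF that(3,4)] that(1,2) by (simp add: M'_simps)
    moreover have "f (\<ominus>\<^bsub>M\<^esub> x) \<in> N" if "x \<in> carrier M" "f x \<in> N" for x
    proof -
      have "f (\<ominus>\<^bsub>M\<^esub> x) = \<ominus>\<^bsub>M'\<^esub> f x"
        using that by (intro M'.minus_equality[symmetric]) (auto simp: M'_simps M.l_neg)
      then show ?thesis using N(3)[OF that(2)] by simp
    qed
    moreover have "f (a \<odot>\<^bsub>M\<^esub> x) \<in> N"
      if "a \<in> carrier R" "x \<in> carrier M" "f x \<in> N" for a x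
      using N(4)[OF that(1,3)] that(1,2) by (simp add: M'_simps)
    ultimately show ?thesis
      unfolding submodule_iff[OF rng_module_axioms] by (auto simp: smult_closed)
  qed
  have "N = {\<zero>\<^bsub>M'\<^esub>} \<or> N = carrier M'" if N: "submodule N R M'" for N
  proof -
    define P where "P = {x \<in> carrier M. f x \<in> N}"
    have "P = {\<zero>\<^bsub>M\<^esub>} \<or> P = carrier M"
      using simple preimage[OF N] unfolding simple_module_def P_def by simp
    moreover have "N \<subseteq> f ` carrier M"
      using N unfolding submodule_iff[OF module'] M'_simps(1) by simp
    then have "N = f ` P" unfolding P_def by blast
    ultimately show ?thesis by (auto simp: M'_simps)
  qed
  moreover have "\<exists>a\<in>carrier R. \<exists>A\<in>carrier M'. a \<odot>\<^bsub>M'\<^esub> A \<noteq> \<zero>\<^bsub>M'\<^esub>"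
  proof -
    obtain a x where "a \<in> carrier R" "x \<in> carrier M" "a \<odot>\<^bsub>M\<^esub> x \<noteq> \<zero>\<^bsub>M\<^esub>"
      using simple unfolding simple_module_def by blast
    then show ?thesis
      by (intro bexI[of _ a] bexI[of _ "f x"]) (simp_all add: M'_simps f_eq smult_closed)
  qed
  moreover have "a = \<zero>\<^bsub>R\<^esub>"
    if "a \<in> carrier R" "\<forall>A\<in>carrier M'. a \<odot>\<^bsub>M'\<^esub> A = \<zero>\<^bsub>M'\<^esub>" for a
  proof -
    have "a \<odot>\<^bsub>M\<^esub> x = \<zero>\<^bsub>M\<^esub>" if "x \<in> carrier M" for x
      using \<open>\<forall>A\<in>carrier M'. _\<close> \<open>a \<in> carrier R\<close> that by (simp add: M'_simps f_eq smult_closed)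
    then show ?thesis using faithful that(1) unfolding faithful_module_def by simp
  qed
  ultimately show ?thesis
    using module' unfolding primitive_rng_def simple_module_def faithful_module_def by blast
qed


section \<open>Isomorphism of algebras\<close>

text \<open>A not necessarily unital \<open>K\<close>-algebra is given by a \<^type>\<open>module_ext\<close> record: its ring
  structure together with the scalar multiplication by \<open>K\<close>. (The record fields of the \<open>K\<close>-algebra
  \<open>A\<close> also make sense of \<open>A\<close> as a ring, by forgetting \<open>smult\<close>.)\<close>

definition algebra_iso ::
  "('k, 'l) ring_scheme \<Rightarrow> ('k, 'a, 'm) module_scheme \<Rightarrow> ('k, 'b, 'n) module_scheme \<Rightarrow> ('a \<Rightarrow> 'b) set"
  where "algebra_iso K A B = {h. bij_betw h (carrier A) (carrier B) \<and>
    (\<forall>x\<in>carrier A. \<forall>y\<in>carrier A. h (x \<oplus>\<^bsub>A\<^esub> y) = h x \<oplus>\<^bsub>B\<^esub> h y) \<and>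
    (\<forall>x\<in>carrier A. \<forall>y\<in>carrier A. h (x \<otimes>\<^bsub>A\<^esub> y) = h x \<otimes>\<^bsub>B\<^esub> h y) \<and>
    (\<forall>k\<in>carrier K. \<forall>x\<in>carrier A. h (k \<odot>\<^bsub>A\<^esub> x) = k \<odot>\<^bsub>B\<^esub> h x)}"

definition algebra_isomorphic ::
  "('k, 'l) ring_scheme \<Rightarrow> ('k, 'a, 'm) module_scheme \<Rightarrow> ('k, 'b, 'n) module_scheme \<Rightarrow> bool"
  where "algebra_isomorphic K A B \<longleftrightarrow> algebra_iso K A B \<noteq> {}"


section \<open>Finitely supported functions\<close>

text \<open>In accordance with \<^const>\<open>PiE\<close>, functions on \<open>X\<close> are \<open>undefined\<close> outside \<open>X\<close>.\<close>

definition fin_supp :: "'x set \<Rightarrow> ('r, 'm) ring_scheme \<Rightarrow> ('x \<Rightarrow> 'r) set" where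
  "fin_supp X R = {f \<in> X \<rightarrow>\<^sub>E carrier R. finite {x \<in> X. f x \<noteq> \<zero>\<^bsub>R\<^esub>}}"

text \<open>\<^const>\<open>finsum\<close> over an infinite set is zero by convention, so the sum of a finitely supported
  family over a possibly infinite index set has to be taken over its support.\<close>

definition supp_sum :: "('r, 'm) ring_scheme \<Rightarrow> ('x \<Rightarrow> 'r) \<Rightarrow> 'x set \<Rightarrow> 'r" where
  "supp_sum R f X = finsum R f {x \<in> X. f x \<noteq> \<zero>\<^bsub>R\<^esub>}"


section \<open>Discrete groupoids\<close>

text \<open>\<open>composite G a b\<close> is the product \<open>ab\<close>; it is defined when the source of \<open>a\<close> is the target
  of \<open>b\<close>. Since object and arrow sets are discrete, no topology is recorded.\<close>

record ('o, 'a) groupoid =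
  objects :: "'o set"
  arrows :: "'a set"
  source :: "'a \<Rightarrow> 'o"
  target :: "'a \<Rightarrow> 'o"
  composite :: "'a \<Rightarrow> 'a \<Rightarrow> 'a"
  ident :: "'o \<Rightarrow> 'a"
  inverse_arrow :: "'a \<Rightarrow> 'a"

locale groupoid =
  fixes G :: "('o, 'a, 'g) groupoid_scheme"
  assumes source_closed: "a \<in> arrows G \<Longrightarrow> source G a \<in> objects G"
    and target_closed: "a \<in> arrows G \<Longrightarrow> target G a \<in> objects G"
    and compose_closed:
      "\<lbrakk>a \<in> arrows G; b \<in> arrows G; source G a = target G b\<rbrakk> \<Longrightarrow> composite G a b \<in> arrows G"
    and source_compose:
      "\<lbrakk>a \<in> arrows G; b \<in> arrows G; source G a = target G b\<rbrakk> \<Longrightarrow>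
        source G (composite G a b) = source G b"
    and target_compose:
      "\<lbrakk>a \<in> arrows G; b \<in> arrows G; source G a = target G b\<rbrakk> \<Longrightarrow>
        target G (composite G a b) = target G a"
    and compose_assoc:
      "\<lbrakk>a \<in> arrows G; b \<in> arrows G; c \<in> arrows G;
        source G a = target G b; source G b = target G c\<rbrakk> \<Longrightarrow>
        composite G (composite G a b) c = composite G a (composite G b c)"
    and ident_closed: "v \<in> objects G \<Longrightarrow> ident G v \<in> arrows G"
    and source_ident: "v \<in> objects G \<Longrightarrow> source G (ident G v) = v"
    and target_ident: "v \<in> objects G \<Longrightarrow> target G (ident G v) = v"
    and compose_ident_left: "a \<in> arrows G \<Longrightarrow> composite G (ident G (target G a)) a = a"
    and compose_ident_right: "a \<in> arrows G \<Longrightarrow> composite G a (ident G (source G a)) = a"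
    and inverse_closed: "a \<in> arrows G \<Longrightarrow> inverse_arrow G a \<in> arrows G"
    and source_inverse: "a \<in> arrows G \<Longrightarrow> source G (inverse_arrow G a) = target G a"
    and target_inverse: "a \<in> arrows G \<Longrightarrow> target G (inverse_arrow G a) = source G a"
    and compose_inverse_left:
      "a \<in> arrows G \<Longrightarrow> composite G (inverse_arrow G a) a = ident G (source G a)"
    and compose_inverse_right:
      "a \<in> arrows G \<Longrightarrow> composite G a (inverse_arrow G a) = ident G (target G a)"

locale transitive_groupoid = groupoid G for G :: "('o, 'a, 'g) groupoid_scheme" +
  assumes transitive:
    "\<lbrakk>v \<in> objects G; w \<in> objects G\<rbrakk> \<Longrightarrow> \<exists>a\<in>arrows G. source G a = v \<and> target G a = w"

definition isotropy_group :: "('o, 'a, 'g) groupoid_scheme \<Rightarrow> 'o \<Rightarrow> 'a monoid" where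
  "isotropy_group G u = \<lparr>carrier = {a \<in> arrows G. source G a = u \<and> target G a = u},
     mult = composite G, one = ident G u\<rparr>"


section \<open>Steinberg algebras, group algebras and matrix rings\<close>

text \<open>The \<open>one\<close> fields of the Steinberg algebra and of the matrix algebra are the identities of
  these rings if \<open>objects G\<close> and \<open>I\<close>, respectively, are finite (and \<open>R\<close> is unital), and in
  general lie outside the carrier.\<close>

definition steinberg_algebra ::
  "('k, 'l) ring_scheme \<Rightarrow> ('o, 'a, 'g) groupoid_scheme \<Rightarrow> ('k, 'a \<Rightarrow> 'k) module" where
  "steinberg_algebra K G = \<lparr>carrier = fin_supp (arrows G) K,
     mult = (\<lambda>f g. \<lambda>c\<in>arrows G.
       supp_sum K (\<lambda>a. f (composite G c (inverse_arrow G a)) \<otimes>\<^bsub>K\<^esub> g a)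
         {a \<in> arrows G. source G a = source G c}),
     one = (\<lambda>c\<in>arrows G. if c \<in> ident G ` objects G then \<one>\<^bsub>K\<^esub> else \<zero>\<^bsub>K\<^esub>),
     zero = (\<lambda>c\<in>arrows G. \<zero>\<^bsub>K\<^esub>),
     add = (\<lambda>f g. \<lambda>c\<in>arrows G. f c \<oplus>\<^bsub>K\<^esub> g c),
     smult = (\<lambda>k f. \<lambda>c\<in>arrows G. k \<otimes>\<^bsub>K\<^esub> f c)\<rparr>"

definition group_algebra ::
  "('k, 'l) ring_scheme \<Rightarrow> ('a, 'g) monoid_scheme \<Rightarrow> ('k, 'a \<Rightarrow> 'k) module" where
  "group_algebra K H = \<lparr>carrier = fin_supp (carrier H) K,
     mult = (\<lambda>f g. \<lambda>x\<in>carrier H.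
       supp_sum K (\<lambda>y. f (x \<otimes>\<^bsub>H\<^esub> inv\<^bsub>H\<^esub> y) \<otimes>\<^bsub>K\<^esub> g y) (carrier H)),
     one = (\<lambda>x\<in>carrier H. if x = \<one>\<^bsub>H\<^esub> then \<one>\<^bsub>K\<^esub> else \<zero>\<^bsub>K\<^esub>),
     zero = (\<lambda>x\<in>carrier H. \<zero>\<^bsub>K\<^esub>),
     add = (\<lambda>f g. \<lambda>x\<in>carrier H. f x \<oplus>\<^bsub>K\<^esub> g x),
     smult = (\<lambda>k f. \<lambda>x\<in>carrier H. k \<otimes>\<^bsub>K\<^esub> f x)\<rparr>"

definition matrix_algebra ::
  "'i set \<Rightarrow> ('k, 'r, 'm) module_scheme \<Rightarrow> ('k, 'i \<times> 'i \<Rightarrow> 'r) module" where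
  "matrix_algebra I R = \<lparr>carrier = fin_supp (I \<times> I) R,
     mult = (\<lambda>A B. \<lambda>(i, j)\<in>I \<times> I. supp_sum R (\<lambda>k. A (i, k) \<otimes>\<^bsub>R\<^esub> B (k, j)) I),
     one = (\<lambda>(i, j)\<in>I \<times> I. if i = j then \<one>\<^bsub>R\<^esub> else \<zero>\<^bsub>R\<^esub>),
     zero = (\<lambda>p\<in>I \<times> I. \<zero>\<^bsub>R\<^esub>),
     add = (\<lambda>A B. \<lambda>p\<in>I \<times> I. A p \<oplus>\<^bsub>R\<^esub> B p),
     smult = (\<lambda>k A. \<lambda>p\<in>I \<times> I. k \<odot>\<^bsub>R\<^esub> A p)\<rparr>"

end

theory Submission
  imports Defs
begin

text \<open>Choosing an arrow \<open>p\<^sub>v\<close> from \<open>u\<close> to each object \<open>v\<close>, every arrow is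
  \<open>p\<^sub>v x p\<^sub>w\<inverse>\<close> for unique \<open>v\<close>, \<open>w\<close> and a unique loop \<open>x\<close> at \<open>u\<close>; this gives
  the isomorphism with the matrix ring. For the remaining claims, \<open>B = KG\<^sub>u\<close> is the corner
  \<open>eAe\<close> of \<open>A = K\<G>\<close> at the idempotent \<open>e\<close> supported on the identity of \<open>u\<close>, and by
  transitivity \<open>A\<close> is the only ideal that contains \<open>e\<close>. If \<open>I\<close> is an ideal of \<open>A\<close>, then
  \<open>A/I\<close> has the corner \<open>B/(B \<inter> I)\<close>, and every ideal \<open>J\<close> of \<open>B\<close> is
  \<open>B \<inter> I\<close> for \<open>I = {x. e A x A e \<subseteq> J}\<close>. Call a ring \<open>Q\<close> with a full idempotent
  \<open>e\<close> nondegenerate if \<open>e Q x Q e \<noteq> 0\<close> for all \<open>x \<noteq> 0\<close>. Primitive rings and the quotients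
  by the ideals just described are nondegenerate, and for nondegenerate \<open>Q\<close> primitivity, simplicity
  and the existence of minimal left ideals pass between \<open>Q\<close> and \<open>eQe\<close>.\<close>

section \<open>Left ideals and simple modules\<close>

text \<open>The obstacle is the missing unit. A full idempotent e forces every element of R to be a
  sum of products a e b, yet a nonzero x with R x R = 0 may survive, and no such x is visible in the
  corner. A primitive ring has none: if M is simple and faithful and x M is nonzero, then R x R M =
  R x M = M.

  Primitivity and minimal left ideals are first restated by elements of the ring: by a left ideal L
  standing for the module R/L, and by a single generator t. The passage between R and its corner
  then compares elements only, and no module has to be moved between rings with different element
  types.

  The equivalences for CCR and GCR rest on the corner of the Steinberg algebra itself; the matrix
  isomorphism is a separate computation with the same base object.\<close>

context rng
begin

lemma l_null: "x \<in> carrier R \<Longrightarrow> \<zero> \<otimes> x = \<zero>"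
  by (metis add.l_cancel_one zero_closed m_closed l_distr r_zero)

lemma r_null: "x \<in> carrier R \<Longrightarrow> x \<otimes> \<zero> = \<zero>"
  by (metis add.l_cancel_one zero_closed m_closed r_distr r_zero)

lemma l_minus: "\<lbrakk>x \<in> carrier R; y \<in> carrier R\<rbrakk> \<Longrightarrow> (\<ominus> x) \<otimes> y = \<ominus> (x \<otimes> y)"
  by (metis a_inv_closed l_neg minus_equality m_closed l_distr l_null)

lemma r_minus: "\<lbrakk>x \<in> carrier R; y \<in> carrier R\<rbrakk> \<Longrightarrow> x \<otimes> (\<ominus> y) = \<ominus> (x \<otimes> y)"
  by (metis a_inv_closed l_neg minus_equality m_closed r_distr r_null)

lemma l_diff_distr:
  "\<lbrakk>x \<in> carrier R; y \<in> carrier R; z \<in> carrier R\<rbrakk> \<Longrightarrow> (x \<ominus> y) \<otimes> z = x \<otimes> z \<ominus> y \<otimes> z"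
  by (simp add: a_minus_def l_distr l_minus)

lemma r_diff_distr:
  "\<lbrakk>x \<in> carrier R; y \<in> carrier R; z \<in> carrier R\<rbrakk> \<Longrightarrow> z \<otimes> (x \<ominus> y) = z \<otimes> x \<ominus> z \<otimes> y"
  by (simp add: a_minus_def r_distr r_minus)

end

definition left_ideal :: "'r set \<Rightarrow> ('r, 'm) ring_scheme \<Rightarrow> bool" where
  "left_ideal L R \<longleftrightarrow> additive_subgroup L R \<and> (\<forall>a\<in>carrier R. \<forall>x\<in>L. a \<otimes>\<^bsub>R\<^esub> x \<in> L)"

lemma (in abelian_group) additive_subgroup_iff:
  "additive_subgroup L G \<longleftrightarrow>
    L \<subseteq> carrier G \<and> \<zero> \<in> L \<and> (\<forall>x\<in>L. \<forall>y\<in>L. x \<oplus> y \<in> L) \<and> (\<forall>x\<in>L. \<ominus> x \<in> L)"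
  unfolding additive_subgroup_def subgroup_def a_inv_def by auto

lemma (in rng) left_ideal_iff:
  "left_ideal L R \<longleftrightarrow> L \<subseteq> carrier R \<and> \<zero> \<in> L \<and> (\<forall>x\<in>L. \<forall>y\<in>L. x \<oplus> y \<in> L) \<and>
    (\<forall>x\<in>L. \<ominus> x \<in> L) \<and> (\<forall>a\<in>carrier R. \<forall>x\<in>L. a \<otimes> x \<in> L)"
  unfolding left_ideal_def additive_subgroup_iff by blast

lemma (in rng) rng_ideal_iff:
  "rng_ideal L R \<longleftrightarrow> left_ideal L R \<and> (\<forall>a\<in>carrier R. \<forall>x\<in>L. x \<otimes> a \<in> L)"
  unfolding rng_ideal_def rng_ideal_axioms_def left_ideal_def using rng_axioms by blast

lemma (in rng) left_ideal_diff:
  assumes "left_ideal L R" "x \<in> L" "y \<in> L"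
  shows "x \<ominus> y \<in> L"
  using assms unfolding left_ideal_iff a_minus_def by auto

text \<open>A relation \<open>b \<otimes> a \<ominus> q \<in> L\<close> plays the role of an
  equation between vectors of R/L; this lemma lets one side replace the other.\<close>

lemma (in rng) left_ideal_diff_iff:
  assumes "left_ideal L R" "x \<in> carrier R" "y \<in> carrier R" "x \<ominus> y \<in> L"
  shows "x \<in> L \<longleftrightarrow> y \<in> L"
proof
  have L: "\<And>x. x \<in> L \<Longrightarrow> x \<in> carrier R" "\<And>x y. \<lbrakk>x \<in> L; y \<in> L\<rbrakk> \<Longrightarrow> x \<oplus> y \<in> L" "\<And>x. x \<in> L \<Longrightarrow> \<ominus> x \<in> L"
    using assms(1) unfolding left_ideal_iff by blast+
  show "x \<in> L" if "y \<in> L"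
    using L(2)[OF assms(4) that] assms(2,3) by (simp add: a_minus_def a_assoc l_neg)
  show "y \<in> L" if "x \<in> L"
  proof -
    have "x \<ominus> (x \<ominus> y) = y"
      using assms(2,3) by (simp add: a_minus_def minus_add a_assoc[symmetric] r_neg)
    then show ?thesis using left_ideal_diff[OF assms(1) that assms(4)] by simp
  qed
qed

text \<open>Without a unit, R z could be zero for a nonzero \<open>z\<close>. The elements killed by
  all of R form a submodule; as RM is nonzero, simplicity makes that submodule zero. Then R z is a
  nonzero submodule, hence everything. Conversely, z = a z for a nonzero \<open>z\<close> already
  shows that RM is nonzero.\<close>

lemma simple_module_iff:
  "simple_module R M \<longleftrightarrow> rng_module R M \<and> (\<exists>z\<in>carrier M. z \<noteq> \<zero>\<^bsub>M\<^esub>) \<and>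
    (\<forall>z\<in>carrier M. z \<noteq> \<zero>\<^bsub>M\<^esub> \<longrightarrow> (\<forall>y\<in>carrier M. \<exists>a\<in>carrier R. y = a \<odot>\<^bsub>M\<^esub> z))"
  (is "_ \<longleftrightarrow> _ \<and> ?nz \<and> ?gen")
proof (cases "rng_module R M")
  case True
  interpret rng_module R M by fact
  note sub = submodule_iff[OF True]
  show ?thesis
  proof
    assume simple: "simple_module R M"
    obtain a\<^sub>0 x\<^sub>0 where ax: "a\<^sub>0 \<in> carrier R" "x\<^sub>0 \<in> carrier M" "a\<^sub>0 \<odot>\<^bsub>M\<^esub> x\<^sub>0 \<noteq> \<zero>\<^bsub>M\<^esub>"
      using simple unfolding simple_module_def by blast
    let ?A = "{x \<in> carrier M. \<forall>a\<in>carrier R. a \<odot>\<^bsub>M\<^esub> x = \<zero>\<^bsub>M\<^esub>}"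
    have "submodule ?A R M"
      unfolding sub by (auto simp: smult_r_distr smult_r_zero smult_r_minus smult_closed
          smult_assoc[symmetric] R.m_closed)
    moreover have "?A \<noteq> carrier M" using ax by blast
    ultimately have A: "?A = {\<zero>\<^bsub>M\<^esub>}" using simple unfolding simple_module_def by blast
    have ?gen
    proof (intro ballI impI)
      fix z y assume z: "z \<in> carrier M" "z \<noteq> \<zero>\<^bsub>M\<^esub>" and y: "y \<in> carrier M"
      let ?N = "(\<lambda>a. a \<odot>\<^bsub>M\<^esub> z) ` carrier R"
      have "submodule ?N R M"
        unfolding sub
      proof (intro conjI ballI)
        show "?N \<subseteq> carrier M" using z smult_closed by auto
        show "\<zero>\<^bsub>M\<^esub> \<in> ?N" using smult_l_zero[OF z(1)] by (metis R.zero_closed image_eqI)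
        show "x \<oplus>\<^bsub>M\<^esub> y \<in> ?N" if "x \<in> ?N" "y \<in> ?N" for x y
          using that z smult_l_distr by (auto simp: image_iff) (metis R.a_closed)
        show "\<ominus>\<^bsub>M\<^esub> x \<in> ?N" if "x \<in> ?N" for x
          using that z smult_l_minus by (auto simp: image_iff) (metis R.a_inv_closed)
        show "b \<odot>\<^bsub>M\<^esub> x \<in> ?N" if "b \<in> carrier R" "x \<in> ?N" for b x
          using that z smult_assoc by (auto simp: image_iff) (metis R.m_closed)
      qed
      moreover have "z \<notin> ?A" using A z by blast
      then have "?N \<noteq> {\<zero>\<^bsub>M\<^esub>}" using z by auto
      ultimately have "?N = carrier M" using simple unfolding simple_module_def by blast
      then show "\<exists>a\<in>carrier R. y = a \<odot>\<^bsub>M\<^esub> z" using y by blast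
    qed
    moreover have ?nz using ax smult_closed by blast
    ultimately show "rng_module R M \<and> ?nz \<and> ?gen" using True by blast
  next
    assume "rng_module R M \<and> ?nz \<and> ?gen"
    then have nz: ?nz and gen: ?gen by auto
    obtain z where z: "z \<in> carrier M" "z \<noteq> \<zero>\<^bsub>M\<^esub>" using nz by blast
    then have "\<exists>a\<in>carrier R. \<exists>x\<in>carrier M. a \<odot>\<^bsub>M\<^esub> x \<noteq> \<zero>\<^bsub>M\<^esub>" using gen by metis
    moreover have "N = {\<zero>\<^bsub>M\<^esub>} \<or> N = carrier M" if "submodule N R M" for N
    proof (cases "N = {\<zero>\<^bsub>M\<^esub>}")
      case False
      have N: "N \<subseteq> carrier M" "\<zero>\<^bsub>M\<^esub> \<in> N" "\<forall>a\<in>carrier R. \<forall>x\<in>N. a \<odot>\<^bsub>M\<^esub> x \<in> N"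
        using that unfolding sub by auto
      obtain x where "x \<in> N" "x \<noteq> \<zero>\<^bsub>M\<^esub>" using False N(2) by blast
      have "y \<in> N" if y: "y \<in> carrier M" for y
      proof -
        obtain a where "a \<in> carrier R" "y = a \<odot>\<^bsub>M\<^esub> x"
          using gen[rule_format, OF subsetD[OF N(1) \<open>x \<in> N\<close>] \<open>x \<noteq> \<zero>\<^bsub>M\<^esub>\<close> y] by auto
        then show ?thesis using N(3) \<open>x \<in> N\<close> by blast
      qed
      then show ?thesis using N(1) by blast
    qed simp
    ultimately show "simple_module R M" using True unfolding simple_module_def by blast
  qed
qed (auto simp: simple_module_def)

lemma regular_module_simps:
  "carrier (regular_module R) = carrier R"
  "\<zero>\<^bsub>regular_module R\<^esub> = \<zero>\<^bsub>R\<^esub>"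
  "x \<oplus>\<^bsub>regular_module R\<^esub> y = x \<oplus>\<^bsub>R\<^esub> y"
  "x \<odot>\<^bsub>regular_module R\<^esub> y = x \<otimes>\<^bsub>R\<^esub> y"
  by (simp_all add: regular_module_def)

lemma (in rng) regular_module: "rng_module R (regular_module R)"
proof -
  have "abelian_group (regular_module R)"
  proof (rule abelian_groupI)
    fix x assume "x \<in> carrier (regular_module R)"
    then show "\<exists>y\<in>carrier (regular_module R). y \<oplus>\<^bsub>regular_module R\<^esub> x = \<zero>\<^bsub>regular_module R\<^esub>"
      by (intro bexI[of _ "\<ominus> x"]) (simp_all add: regular_module_simps l_neg)
  qed (auto simp: regular_module_simps a_ac)
  then show ?thesis
    unfolding rng_module_def rng_module_axioms_def using rng_axioms
    by (simp add: regular_module_simps m_closed m_assoc l_distr r_distr)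
qed

lemma rng_module_submodule:
  assumes "rng_module R M" "submodule N R M"
  shows "rng_module R (M\<lparr>carrier := N\<rparr>)"
proof -
  interpret rng_module R M by fact
  have N: "\<And>x. x \<in> N \<Longrightarrow> x \<in> carrier M" "\<zero>\<^bsub>M\<^esub> \<in> N" "\<And>x y. \<lbrakk>x \<in> N; y \<in> N\<rbrakk> \<Longrightarrow> x \<oplus>\<^bsub>M\<^esub> y \<in> N"
    "\<And>x. x \<in> N \<Longrightarrow> \<ominus>\<^bsub>M\<^esub> x \<in> N" "\<And>a x. \<lbrakk>a \<in> carrier R; x \<in> N\<rbrakk> \<Longrightarrow> a \<odot>\<^bsub>M\<^esub> x \<in> N"
    using assms unfolding submodule_iff[OF assms(1)] by auto
  have "abelian_group (M\<lparr>carrier := N\<rparr>)"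
  proof (rule abelian_groupI)
    fix x assume "x \<in> carrier (M\<lparr>carrier := N\<rparr>)"
    then show "\<exists>y\<in>carrier (M\<lparr>carrier := N\<rparr>). y \<oplus>\<^bsub>M\<lparr>carrier := N\<rparr>\<^esub> x = \<zero>\<^bsub>M\<lparr>carrier := N\<rparr>\<^esub>"
      by (intro bexI[of _ "\<ominus>\<^bsub>M\<^esub> x"]) (simp_all add: N M.l_neg)
  qed (auto simp: N M.a_ac)
  then show ?thesis
    unfolding rng_module_def rng_module_axioms_def using R.rng_axioms
    by (simp add: N smult_l_distr smult_r_distr smult_assoc)
qed

lemma (in rng) submodule_regular_iff: "submodule L R (regular_module R) \<longleftrightarrow> left_ideal L R"
proof -
  interpret M: rng_module R "regular_module R" by (rule regular_module)
  have neg: "\<ominus>\<^bsub>regular_module R\<^esub> x = \<ominus> x" if "x \<in> carrier R" for x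
    using that by (intro M.minus_equality) (auto simp: regular_module_simps l_neg)
  have "(\<forall>x\<in>L. \<ominus>\<^bsub>regular_module R\<^esub> x \<in> L) \<longleftrightarrow> (\<forall>x\<in>L. \<ominus> x \<in> L)" if "L \<subseteq> carrier R"
    using that by (intro ball_cong refl) (simp add: neg subset_iff)
  then show ?thesis
    unfolding submodule_iff[OF regular_module] left_ideal_iff regular_module_simps by argo
qed

lemma (in rng) minimal_left_ideal_iff:
  "minimal_left_ideal L R \<longleftrightarrow> left_ideal L R \<and> (\<exists>z\<in>L. z \<noteq> \<zero>) \<and>
    (\<forall>z\<in>L. z \<noteq> \<zero> \<longrightarrow> (\<forall>y\<in>L. \<exists>a\<in>carrier R. y = a \<otimes> z))"
  unfolding minimal_left_ideal_def simple_module_iff submodule_regular_iff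
  using rng_module_submodule[OF regular_module, of L] submodule_regular_iff
  by (auto simp: regular_module_simps)

lemma (in rng) left_ideal_principal:
  assumes "t \<in> carrier R"
  shows "left_ideal ((\<lambda>a. a \<otimes> t) ` carrier R) R"
  unfolding left_ideal_iff
proof (intro conjI ballI)
  let ?N = "(\<lambda>a. a \<otimes> t) ` carrier R"
  show "?N \<subseteq> carrier R" using assms m_closed by auto
  show "\<zero> \<in> ?N" using l_null[OF assms] by (metis zero_closed image_eqI)
  show "x \<oplus> y \<in> ?N" if "x \<in> ?N" "y \<in> ?N" for x y
    using that assms l_distr by (auto simp: image_iff) (metis a_closed)
  show "\<ominus> x \<in> ?N" if "x \<in> ?N" for x
    using that assms l_minus by (auto simp: image_iff) (metis a_inv_closed)
  show "b \<otimes> x \<in> ?N" if "b \<in> carrier R" "x \<in> ?N" for b x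
    using that assms m_assoc by (auto simp: image_iff) (metis m_closed)
qed

text \<open>A minimal left ideal is R t for each of its nonzero elements \<open>t\<close>, so one
  element certifies it. The clause \<open>t = c \<otimes> t\<close> stands in for a unit by placing
  \<open>t\<close> in R t.\<close>

lemma (in rng) ex_minimal_left_ideal_iff:
  "(\<exists>L. minimal_left_ideal L R) \<longleftrightarrow>
    (\<exists>t\<in>carrier R. t \<noteq> \<zero> \<and> (\<exists>c\<in>carrier R. t = c \<otimes> t) \<and>
      (\<forall>a\<in>carrier R. a \<otimes> t \<noteq> \<zero> \<longrightarrow> (\<exists>b\<in>carrier R. b \<otimes> (a \<otimes> t) = t)))"
  (is "_ \<longleftrightarrow> ?rhs")
proof
  assume "\<exists>L. minimal_left_ideal L R"
  then obtain L t where L: "left_ideal L R" and t: "t \<in> L" "t \<noteq> \<zero>"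
    and gen: "\<forall>z\<in>L. z \<noteq> \<zero> \<longrightarrow> (\<forall>y\<in>L. \<exists>a\<in>carrier R. y = a \<otimes> z)"
    unfolding minimal_left_ideal_iff by blast
  have "a \<otimes> t \<in> L" if "a \<in> carrier R" for a
    using L that t unfolding left_ideal_iff by blast
  moreover have "t \<in> carrier R" using L t unfolding left_ideal_iff by blast
  ultimately show ?rhs using gen t by metis
next
  assume ?rhs
  then obtain t c where t: "t \<in> carrier R" "t \<noteq> \<zero>" "c \<in> carrier R" "t = c \<otimes> t"
    and gen: "\<And>a. \<lbrakk>a \<in> carrier R; a \<otimes> t \<noteq> \<zero>\<rbrakk> \<Longrightarrow> \<exists>b\<in>carrier R. b \<otimes> (a \<otimes> t) = t"
    by blast
  let ?L = "(\<lambda>a. a \<otimes> t) ` carrier R"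
  have "\<exists>a\<in>carrier R. y = a \<otimes> z" if z: "z \<in> ?L" "z \<noteq> \<zero>" and y: "y \<in> ?L" for z y
  proof -
    obtain a a' where a: "a \<in> carrier R" "z = a \<otimes> t" "a' \<in> carrier R" "y = a' \<otimes> t"
      using z y by blast
    obtain b where b: "b \<in> carrier R" "b \<otimes> z = t" using gen a z by blast
    have "y = (a' \<otimes> b) \<otimes> z" using a b t m_assoc m_closed by metis
    then show ?thesis using a b m_closed by blast
  qed
  moreover have "t \<in> ?L" using t by blast
  ultimately have "minimal_left_ideal ?L R"
    unfolding minimal_left_ideal_iff using left_ideal_principal[OF t(1)] t(2) by blast
  then show "\<exists>L. minimal_left_ideal L R" by blast
qed

section \<open>Primitivity expressed by left ideals\<close>

text \<open>These are the annihilators of the nonzero elements of faithful simple modules, so that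
  primitivity becomes a statement about the elements of the ring.\<close>

definition maximal_faithful :: "'r set \<Rightarrow> ('r, 'm) ring_scheme \<Rightarrow> bool" where
  "maximal_faithful L R \<longleftrightarrow> left_ideal L R \<and> L \<noteq> carrier R \<and>
    (\<forall>a\<in>carrier R - L. \<forall>q\<in>carrier R. \<exists>b\<in>carrier R. b \<otimes>\<^bsub>R\<^esub> a \<ominus>\<^bsub>R\<^esub> q \<in> L) \<and>
    (\<forall>a\<in>carrier R. a \<noteq> \<zero>\<^bsub>R\<^esub> \<longrightarrow> (\<exists>b\<in>carrier R. a \<otimes>\<^bsub>R\<^esub> b \<notin> L))"

text \<open>With \<open>L\<close> the annihilator of \<open>z\<close>, the map a -> a z identifies
  R/L with the module. If \<open>a\<close> is outside \<open>L\<close>, then a z generates, so some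
  b a z equals q z. Since the module is R z, an element \<open>a\<close> kills it exactly when all
  products a b lie in \<open>L\<close>.\<close>

lemma (in rng) primitive_imp_maximal_faithful:
  assumes "primitive_rng R"
  obtains L where "maximal_faithful L R"
proof -
  obtain M :: "('a, 'a set) module" where simple: "simple_module R M" and faithful: "faithful_module R M"
    using assms unfolding primitive_rng_def by blast
  interpret rng_module R M using simple unfolding simple_module_def by blast
  obtain z where z: "z \<in> carrier M" "z \<noteq> \<zero>\<^bsub>M\<^esub>" using simple unfolding simple_module_iff by blast
  have gen: "\<exists>a\<in>carrier R. y = a \<odot>\<^bsub>M\<^esub> z'" if "z' \<in> carrier M" "z' \<noteq> \<zero>\<^bsub>M\<^esub>" "y \<in> carrier M" for y z'
    using simple that unfolding simple_module_iff by blast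
  let ?L = "{a \<in> carrier R. a \<odot>\<^bsub>M\<^esub> z = \<zero>\<^bsub>M\<^esub>}"
  have diff: "(a \<ominus> b) \<odot>\<^bsub>M\<^esub> z = a \<odot>\<^bsub>M\<^esub> z \<ominus>\<^bsub>M\<^esub> b \<odot>\<^bsub>M\<^esub> z" if "a \<in> carrier R" "b \<in> carrier R" for a b
    using that z by (simp add: a_minus_def smult_l_distr smult_l_minus)
  have "maximal_faithful ?L R"
    unfolding maximal_faithful_def left_ideal_iff
  proof (intro conjI ballI impI)
    show "?L \<noteq> carrier R" using gen[OF z z(1)] z by auto
    show "\<exists>b\<in>carrier R. b \<otimes> a \<ominus> q \<in> ?L" if a: "a \<in> carrier R - ?L" and q: "q \<in> carrier R" for a q
    proof -
      obtain b where "b \<in> carrier R" "q \<odot>\<^bsub>M\<^esub> z = b \<odot>\<^bsub>M\<^esub> (a \<odot>\<^bsub>M\<^esub> z)"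
        using gen[of "a \<odot>\<^bsub>M\<^esub> z" "q \<odot>\<^bsub>M\<^esub> z"] a q z smult_closed by auto
      then show ?thesis using a q z diff
        by (intro bexI[of _ b]) (auto simp: smult_assoc smult_closed m_closed a_minus_def M.r_neg)
    qed
    show "\<exists>b\<in>carrier R. a \<otimes> b \<notin> ?L" if a: "a \<in> carrier R" "a \<noteq> \<zero>" for a
    proof -
      obtain x where x: "x \<in> carrier M" "a \<odot>\<^bsub>M\<^esub> x \<noteq> \<zero>\<^bsub>M\<^esub>"
        using faithful a unfolding faithful_module_def by blast
      obtain b where "b \<in> carrier R" "x = b \<odot>\<^bsub>M\<^esub> z" using gen[OF z x(1)] by blast
      then show ?thesis using x a z by (intro bexI[of _ b]) (auto simp: smult_assoc)
    qed
  qed (use z in \<open>auto simp: smult_l_distr smult_l_zero smult_l_minus smult_assoc smult_r_zero m_closed\<close>)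
  then show ?thesis using that by blast
qed

lemma (in abelian_subgroup) r_coset_eq_iff:
  assumes "x \<in> carrier G" "y \<in> carrier G"
  shows "H +> x = H +> y \<longleftrightarrow> x \<ominus> y \<in> H"
proof -
  have "x \<in> H +> y \<longleftrightarrow> x \<ominus> y \<in> H"
    using a_rcos_module[OF assms(2,1)] by (simp add: a_minus_def)
  then show ?thesis
    using a_repr_independence'[OF _ assms(2), of x] a_rcos_self[OF assms(1)] by metis
qed

text \<open>The witness is R/L. Its elements are cosets, hence sets of ring elements, which is the
  element type in \<open>primitive_rng\<close>.\<close>

lemma (in rng) maximal_faithful_imp_primitive:
  assumes "maximal_faithful L R"
  shows "primitive_rng R"
proof -
  have L: "left_ideal L R" and ne: "L \<noteq> carrier R"
    and gen: "\<And>a q. \<lbrakk>a \<in> carrier R; a \<notin> L; q \<in> carrier R\<rbrakk> \<Longrightarrow> \<exists>b\<in>carrier R. b \<otimes> a \<ominus> q \<in> L"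
    and faithful: "\<And>a. \<lbrakk>a \<in> carrier R; a \<noteq> \<zero>\<rbrakk> \<Longrightarrow> \<exists>b\<in>carrier R. a \<otimes> b \<notin> L"
    using assms unfolding maximal_faithful_def by auto
  interpret L: abelian_subgroup L R
    using L abelian_group_axioms unfolding left_ideal_def by (blast intro: abelian_subgroupI3)
  \<comment> \<open>The action takes a union over all representatives of a coset; since
    \<open>L\<close> is a left ideal, they all contribute the same coset.\<close>
  define M :: "('a, 'a set) module" where
    "M = \<lparr>carrier = a_rcosets L, mult = undefined, one = undefined, zero = L,
       add = set_add R, smult = (\<lambda>a X. \<Union>x\<in>X. L +> (a \<otimes> x))\<rparr>"
  have carrier_M: "carrier M = (\<lambda>x. L +> x) ` carrier R"
    by (auto simp: M_def A_RCOSETS_def' )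
  have zero_M: "\<zero>\<^bsub>M\<^esub> = L +> \<zero>"
    using L.a_subset by (simp add: M_def)
  have add_M: "(L +> x) \<oplus>\<^bsub>M\<^esub> (L +> y) = L +> (x \<oplus> y)" if "x \<in> carrier R" "y \<in> carrier R" for x y
    using that L.a_rcos_sum by (simp add: M_def)
  have smult_M: "a \<odot>\<^bsub>M\<^esub> (L +> x) = L +> (a \<otimes> x)" if "a \<in> carrier R" "x \<in> carrier R" for a x
  proof -
    have const: "\<forall>y\<in>L +> x. L +> (a \<otimes> y) = L +> (a \<otimes> x)"
    proof
      fix y assume y: "y \<in> L +> x"
      have yc: "y \<in> carrier R" using L.a_elemrcos_carrier[OF \<open>x \<in> carrier R\<close> y] .
      have "y \<ominus> x \<in> L"
        using y yc \<open>x \<in> carrier R\<close> L.a_repr_independence' L.r_coset_eq_iff by metis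
      then have "a \<otimes> (y \<ominus> x) \<in> L" using L \<open>a \<in> carrier R\<close> unfolding left_ideal_iff by blast
      then show "L +> (a \<otimes> y) = L +> (a \<otimes> x)"
        using yc \<open>x \<in> carrier R\<close> \<open>a \<in> carrier R\<close> by (simp add: r_diff_distr L.r_coset_eq_iff m_closed)
    qed
    show ?thesis using UN_constant_eq[OF L.a_rcos_self[OF that(2)] const] by (simp add: M_def)
  qed
  have eq: "L +> x = \<zero>\<^bsub>M\<^esub> \<longleftrightarrow> x \<in> L" if "x \<in> carrier R" for x
  proof -
    have "\<ominus> \<zero> = \<zero>" by (intro minus_equality) simp_all
    then have "x \<ominus> \<zero> = x" using that by (metis a_minus_def r_zero)
    then show ?thesis
      using that by (simp add: zero_M L.r_coset_eq_iff del: a_coset_add_zero)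
  qed
  have "abelian_group M"
  proof (rule abelian_groupI)
    fix X assume "X \<in> carrier M"
    then obtain x where "x \<in> carrier R" "X = L +> x" by (auto simp: carrier_M)
    then show "\<exists>Y\<in>carrier M. Y \<oplus>\<^bsub>M\<^esub> X = \<zero>\<^bsub>M\<^esub>"
      by (intro bexI[of _ "L +> (\<ominus> x)"]) (auto simp: carrier_M zero_M add_M l_neg simp del: a_coset_add_zero)
  qed (auto simp: carrier_M add_M a_ac zero_M simp del: a_coset_add_zero)
  then have mod: "rng_module R M"
    unfolding rng_module_def rng_module_axioms_def using rng_axioms
    by (auto simp: carrier_M add_M smult_M m_closed m_assoc l_distr r_distr)
  have simple: "simple_module R M"
    unfolding simple_module_iff
  proof (intro conjI ballI impI mod)
    obtain a where "a \<in> carrier R" "a \<notin> L" using ne L.a_subset by blast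
    then show "\<exists>z\<in>carrier M. z \<noteq> \<zero>\<^bsub>M\<^esub>" by (auto simp: carrier_M eq)
    fix Z Y assume Z: "Z \<in> carrier M" "Z \<noteq> \<zero>\<^bsub>M\<^esub>" and Y: "Y \<in> carrier M"
    obtain z y where zy: "z \<in> carrier R" "Z = L +> z" "y \<in> carrier R" "Y = L +> y"
      using Z Y by (auto simp: carrier_M)
    then obtain b where "b \<in> carrier R" "b \<otimes> z \<ominus> y \<in> L" using gen[of z y] Z eq by blast
    then show "\<exists>a\<in>carrier R. Y = a \<odot>\<^bsub>M\<^esub> Z"
      using zy by (intro bexI[of _ b]) (simp_all add: smult_M L.r_coset_eq_iff[symmetric] m_closed)
  qed
  have "faithful_module R M"
    unfolding faithful_module_def using mod faithful
    by (auto simp: carrier_M smult_M eq m_closed)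
  then show ?thesis using simple unfolding primitive_rng_def by blast
qed

section \<open>Full corners\<close>

text \<open>\<open>C\<close> is a separate ring embedded by \<open>\<iota>\<close> instead of the
  subset e R e, because the group algebra consists of functions on loops only, and because the
  corner of a quotient of \<open>R\<close> is realised by cosets in \<open>C\<close>. The image of
  \<open>\<iota>\<close> is e R e: \<open>corner\<close> gives one inclusion, \<open>e_emb\<close>
  and \<open>emb_e\<close> the other. Fullness is phrased by ideals, a form that passes to quotients
  by taking preimages.\<close>

locale full_corner = rng R + C: rng C
  for R :: "('r, 'm) ring_scheme" (structure) and C :: "('c, 'n) ring_scheme" +
  fixes \<iota> :: "'c \<Rightarrow> 'r" and e :: 'r
  assumes e_closed [simp]: "e \<in> carrier R"
    and e_idem: "e \<otimes> e = e"
    and emb_closed [simp]: "c \<in> carrier C \<Longrightarrow> \<iota> c \<in> carrier R"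
    and emb_add: "\<lbrakk>c \<in> carrier C; d \<in> carrier C\<rbrakk> \<Longrightarrow> \<iota> (c \<oplus>\<^bsub>C\<^esub> d) = \<iota> c \<oplus> \<iota> d"
    and emb_mult: "\<lbrakk>c \<in> carrier C; d \<in> carrier C\<rbrakk> \<Longrightarrow> \<iota> (c \<otimes>\<^bsub>C\<^esub> d) = \<iota> c \<otimes> \<iota> d"
    and emb_inj: "inj_on \<iota> (carrier C)"
    and e_emb: "c \<in> carrier C \<Longrightarrow> e \<otimes> \<iota> c = \<iota> c"
    and emb_e: "c \<in> carrier C \<Longrightarrow> \<iota> c \<otimes> e = \<iota> c"
    and corner: "a \<in> carrier R \<Longrightarrow> \<exists>c\<in>carrier C. \<iota> c = e \<otimes> (a \<otimes> e)"
    and full: "\<lbrakk>rng_ideal I R; e \<in> I\<rbrakk> \<Longrightarrow> I = carrier R"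
begin

declare m_closed [simp] C.m_closed [simp] l_null [simp] r_null [simp] C.l_null [simp] C.r_null [simp]

lemma emb_eq_iff: "\<lbrakk>c \<in> carrier C; d \<in> carrier C\<rbrakk> \<Longrightarrow> \<iota> c = \<iota> d \<longleftrightarrow> c = d"
  using emb_inj by (auto simp: inj_on_def)

lemma emb_zero: "\<iota> \<zero>\<^bsub>C\<^esub> = \<zero>"
  by (metis emb_add C.zero_closed C.r_zero emb_closed add.l_cancel_one)

lemma emb_eq_zero_iff: "c \<in> carrier C \<Longrightarrow> \<iota> c = \<zero> \<longleftrightarrow> c = \<zero>\<^bsub>C\<^esub>"
  using emb_eq_iff[of c "\<zero>\<^bsub>C\<^esub>"] by (simp add: emb_zero)

lemma emb_minus: "c \<in> carrier C \<Longrightarrow> \<iota> (\<ominus>\<^bsub>C\<^esub> c) = \<ominus> \<iota> c"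
  by (metis C.a_inv_closed C.l_neg emb_add emb_closed emb_zero minus_equality)

lemma emb_diff: "\<lbrakk>c \<in> carrier C; d \<in> carrier C\<rbrakk> \<Longrightarrow> \<iota> (c \<ominus>\<^bsub>C\<^esub> d) = \<iota> c \<ominus> \<iota> d"
  by (simp add: a_minus_def emb_add emb_minus)

lemma e_e: "x \<in> carrier R \<Longrightarrow> e \<otimes> (e \<otimes> x) = e \<otimes> x"
  by (simp add: m_assoc[symmetric] e_idem)

lemma e_emb': "\<lbrakk>c \<in> carrier C; x \<in> carrier R\<rbrakk> \<Longrightarrow> e \<otimes> (\<iota> c \<otimes> x) = \<iota> c \<otimes> x"
  by (simp add: m_assoc[symmetric] e_emb)

lemma emb_e': "\<lbrakk>c \<in> carrier C; x \<in> carrier R\<rbrakk> \<Longrightarrow> \<iota> c \<otimes> (e \<otimes> x) = \<iota> c \<otimes> x"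
  by (simp add: m_assoc[symmetric] emb_e)

lemmas corner_simps = m_assoc e_idem e_e e_emb e_emb' emb_e emb_e'

lemma unit: obtains u where "u \<in> carrier C" "\<iota> u = e"
    "\<And>c. c \<in> carrier C \<Longrightarrow> u \<otimes>\<^bsub>C\<^esub> c = c" "\<And>c. c \<in> carrier C \<Longrightarrow> c \<otimes>\<^bsub>C\<^esub> u = c"
proof -
  obtain u where u: "u \<in> carrier C" "\<iota> u = e" using corner[OF e_closed] by (auto simp: e_idem)
  have "u \<otimes>\<^bsub>C\<^esub> c = c" "c \<otimes>\<^bsub>C\<^esub> u = c" if "c \<in> carrier C" for c
    using that u emb_eq_iff[of "u \<otimes>\<^bsub>C\<^esub> c" c] emb_eq_iff[of "c \<otimes>\<^bsub>C\<^esub> u" c] by (simp_all add: emb_mult e_emb emb_e)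
  then show ?thesis using that u by blast
qed

text \<open>If \<open>e\<close> were zero, the zero ideal would contain it, and fullness would
  collapse the ring.\<close>

lemma e_nonzero:
  assumes "x \<in> carrier R" "x \<noteq> \<zero>"
  shows "e \<noteq> \<zero>"
proof
  assume "e = \<zero>"
  have "\<ominus> \<zero> = \<zero>" by (intro minus_equality) simp_all
  then have "rng_ideal {\<zero>} R" unfolding rng_ideal_iff left_ideal_iff by simp
  then show False using full[of "{\<zero>}"] \<open>e = \<zero>\<close> assms by blast
qed

text \<open>As \<open>R\<close> is spanned by the products a e b, this amounts to R x R being
  nonzero for every nonzero \<open>x\<close>. The outer factors \<open>e\<close> put the nonzero
  product into the corner, where it can be used.\<close>

definition nondegenerate :: bool where
  "nondegenerate \<longleftrightarrow>
    (\<forall>x\<in>carrier R. x \<noteq> \<zero> \<longrightarrow> (\<exists>a\<in>carrier R. \<exists>b\<in>carrier R. e \<otimes> (a \<otimes> (x \<otimes> (b \<otimes> e))) \<noteq> \<zero>))"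

lemma nondegenerateE:
  assumes nondegenerate "x \<in> carrier R" "x \<noteq> \<zero>"
  obtains a b d where "a \<in> carrier R" "b \<in> carrier R" "d \<in> carrier C" "d \<noteq> \<zero>\<^bsub>C\<^esub>"
    "\<iota> d = e \<otimes> (a \<otimes> (x \<otimes> (b \<otimes> e)))"
proof -
  obtain a b where ab: "a \<in> carrier R" "b \<in> carrier R" "e \<otimes> (a \<otimes> (x \<otimes> (b \<otimes> e))) \<noteq> \<zero>"
    using assms unfolding nondegenerate_def by blast
  obtain d where "d \<in> carrier C" "\<iota> d = e \<otimes> (a \<otimes> (x \<otimes> (b \<otimes> e)))"
    using corner[of "a \<otimes> (x \<otimes> b)"] ab assms by (auto simp: m_assoc)
  then show ?thesis using that ab emb_zero by metis
qed

section \<open>From a faithful simple module M = R/L to the corner module e M\<close>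

context
  fixes L
  assumes L: "maximal_faithful L R"
begin

lemma left_ideal_L: "left_ideal L R"
  using L unfolding maximal_faithful_def by blast

lemma L_closed: "x \<in> L \<Longrightarrow> x \<in> carrier R" "\<zero> \<in> L"
    "\<lbrakk>x \<in> L; y \<in> L\<rbrakk> \<Longrightarrow> x \<oplus> y \<in> L" "x \<in> L \<Longrightarrow> \<ominus> x \<in> L"
    "\<lbrakk>a \<in> carrier R; x \<in> L\<rbrakk> \<Longrightarrow> a \<otimes> x \<in> L"
  using left_ideal_L unfolding left_ideal_iff by blast+

lemma L_maximal: "\<lbrakk>a \<in> carrier R; a \<notin> L; q \<in> carrier R\<rbrakk> \<Longrightarrow> \<exists>b\<in>carrier R. b \<otimes> a \<ominus> q \<in> L"
  using L unfolding maximal_faithful_def by blast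

lemma L_faithful: "\<lbrakk>a \<in> carrier R; a \<noteq> \<zero>\<rbrakk> \<Longrightarrow> \<exists>b\<in>carrier R. a \<otimes> b \<notin> L"
  using L unfolding maximal_faithful_def by blast

text \<open>In terms of M = R/L: \<open>e\<close> does not kill M, because M is faithful and
  \<open>e\<close> is nonzero. The class of \<open>e \<otimes> b\<close> is a nonzero vector of e
  M.\<close>

lemma e_notin_L: obtains b where "b \<in> carrier R" "e \<otimes> b \<notin> L"
proof -
  obtain x where "x \<in> carrier R" "x \<noteq> \<zero>"
    using L L_closed(1,2) unfolding maximal_faithful_def by blast
  then show ?thesis using L_faithful[OF e_closed] e_nonzero that by blast
qed

text \<open>The class of \<open>e \<otimes> b\<close> generates R/L, so a vector that
  \<open>x\<close> does not kill can be taken to be a multiple p e b.\<close>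

lemma L_faithful_e:
  assumes "b \<in> carrier R" "e \<otimes> b \<notin> L" "x \<in> carrier R" "x \<noteq> \<zero>"
  obtains p where "p \<in> carrier R" "x \<otimes> (p \<otimes> (e \<otimes> b)) \<notin> L"
proof -
  obtain q where q: "q \<in> carrier R" "x \<otimes> q \<notin> L" using L_faithful assms by blast
  obtain p where p: "p \<in> carrier R" "p \<otimes> (e \<otimes> b) \<ominus> q \<in> L"
    using L_maximal[of "e \<otimes> b" q] assms q by auto
  then have "x \<otimes> (p \<otimes> (e \<otimes> b) \<ominus> q) \<in> L" using L_closed(5) assms by blast
  then have "x \<otimes> (p \<otimes> (e \<otimes> b)) \<ominus> x \<otimes> q \<in> L" using p q assms by (simp add: r_diff_distr)
  then show ?thesis using left_ideal_diff_iff[OF left_ideal_L] p q assms that by (metis m_closed e_closed)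
qed

text \<open>Let v be the nonzero class of \<open>e \<otimes> b\<close>. Choose \<open>p\<close> with
  x p v nonzero and \<open>r\<close> carrying it back, so r x p v = v. Applying \<open>e\<close>
  shows that (e r x p e) b represents v as well, hence e r x p e is nonzero.\<close>

lemma maximal_faithful_nondegenerate: nondegenerate
  unfolding nondegenerate_def
proof (intro ballI impI)
  fix x assume x: "x \<in> carrier R" "x \<noteq> \<zero>"
  obtain b where b: "b \<in> carrier R" "e \<otimes> b \<notin> L" using e_notin_L .
  obtain p where p: "p \<in> carrier R" "x \<otimes> (p \<otimes> (e \<otimes> b)) \<notin> L" using L_faithful_e[OF b x] .
  obtain r where r: "r \<in> carrier R" "r \<otimes> (x \<otimes> (p \<otimes> (e \<otimes> b))) \<ominus> e \<otimes> b \<in> L"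
    using L_maximal[of "x \<otimes> (p \<otimes> (e \<otimes> b))" "e \<otimes> b"] p b x by auto
  have "e \<otimes> (r \<otimes> (x \<otimes> (p \<otimes> (e \<otimes> b))) \<ominus> e \<otimes> b) \<in> L" using L_closed(5) r e_closed by blast
  then have diff: "e \<otimes> (r \<otimes> (x \<otimes> (p \<otimes> (e \<otimes> b)))) \<ominus> e \<otimes> b \<in> L"
    using r p b x by (simp add: r_diff_distr e_e)
  have "e \<otimes> (r \<otimes> (x \<otimes> (p \<otimes> (e \<otimes> b)))) \<notin> L"
    using left_ideal_diff_iff[OF left_ideal_L _ _ diff] r p b x by simp
  then have "(e \<otimes> (r \<otimes> (x \<otimes> (p \<otimes> e)))) \<otimes> b \<notin> L"
    using r p b x by (simp add: m_assoc)
  then have "e \<otimes> (r \<otimes> (x \<otimes> (p \<otimes> e))) \<noteq> \<zero>" using L_closed(2) b by auto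
  then show "\<exists>a\<in>carrier R. \<exists>b\<in>carrier R. e \<otimes> (a \<otimes> (x \<otimes> (b \<otimes> e))) \<noteq> \<zero>" using r p by blast
qed

text \<open>This set is the annihilator in \<open>C\<close> of the vector
  \<open>e \<otimes> b\<close> of e M, since \<iota> d b = \<iota> d e b. The corner module e M
  inherits simplicity and faithfulness: a ring element \<open>r\<close> carrying one vector of e M
  to another may be replaced by e r e.\<close>

lemma maximal_faithful_corner:
  assumes b: "b \<in> carrier R" "e \<otimes> b \<notin> L"
  shows "maximal_faithful {d \<in> carrier C. \<iota> d \<otimes> b \<in> L} C"
  unfolding maximal_faithful_def C.left_ideal_iff
proof (intro conjI ballI impI)
  let ?L = "{d \<in> carrier C. \<iota> d \<otimes> b \<in> L}"
  show "?L \<noteq> carrier C"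
  proof -
    obtain u where "u \<in> carrier C" "\<iota> u = e" using unit by metis
    then show ?thesis using b by blast
  qed
  show "\<exists>p\<in>carrier C. p \<otimes>\<^bsub>C\<^esub> d \<ominus>\<^bsub>C\<^esub> q \<in> ?L" if d: "d \<in> carrier C - ?L" and q: "q \<in> carrier C" for d q
  proof -
    obtain r where r: "r \<in> carrier R" "r \<otimes> (\<iota> d \<otimes> b) \<ominus> \<iota> q \<otimes> b \<in> L"
      using L_maximal[of "\<iota> d \<otimes> b" "\<iota> q \<otimes> b"] d q b by auto
    obtain p where p: "p \<in> carrier C" "\<iota> p = e \<otimes> (r \<otimes> e)" using corner r by blast
    have "e \<otimes> (r \<otimes> (\<iota> d \<otimes> b) \<ominus> \<iota> q \<otimes> b) \<in> L" using L_closed(5) r e_closed by blast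
    moreover have "\<iota> (p \<otimes>\<^bsub>C\<^esub> d \<ominus>\<^bsub>C\<^esub> q) \<otimes> b = e \<otimes> (r \<otimes> (\<iota> d \<otimes> b) \<ominus> \<iota> q \<otimes> b)"
      using p r d q b by (simp add: emb_diff emb_mult l_diff_distr r_diff_distr corner_simps)
    ultimately show ?thesis using p d q by (intro bexI[of _ p]) (simp_all add: C.minus_closed)
  qed
  show "\<exists>p\<in>carrier C. d \<otimes>\<^bsub>C\<^esub> p \<notin> ?L" if d: "d \<in> carrier C" "d \<noteq> \<zero>\<^bsub>C\<^esub>" for d
  proof -
    obtain r where r: "r \<in> carrier R" "\<iota> d \<otimes> (r \<otimes> (e \<otimes> b)) \<notin> L"
      using L_faithful_e[OF b, of "\<iota> d"] d by (auto simp: emb_eq_zero_iff)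
    obtain p where p: "p \<in> carrier C" "\<iota> p = e \<otimes> (r \<otimes> e)" using corner r by blast
    have "\<iota> (d \<otimes>\<^bsub>C\<^esub> p) \<otimes> b = \<iota> d \<otimes> (r \<otimes> (e \<otimes> b))"
      using p r d b by (simp add: emb_mult corner_simps)
    then show ?thesis using p r by (intro bexI[of _ p]) auto
  qed
qed (use b L_closed in \<open>auto simp: emb_zero emb_add emb_minus emb_mult l_distr l_minus m_assoc\<close>)

end

lemma primitive_imp_nondegenerate: "primitive_rng R \<Longrightarrow> nondegenerate"
  using primitive_imp_maximal_faithful maximal_faithful_nondegenerate by blast

lemma primitive_corner: "primitive_rng R \<Longrightarrow> primitive_rng C"
  using primitive_imp_maximal_faithful e_notin_L maximal_faithful_corner
    C.maximal_faithful_imp_primitive by metis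

text \<open>The left ideal used here is the annihilator of the generator \<open>e \<otimes> 1\<close> of the quotient of the
  induced module \<open>Re \<otimes> C/L\<close> by its largest submodule killed by \<open>e\<close>.\<close>

lemma primitive_of_corner:
  assumes nondeg: nondegenerate and "primitive_rng C"
  shows "primitive_rng R"
proof -
  obtain L where L: "maximal_faithful L C" using C.primitive_imp_maximal_faithful assms(2) .
  have left: "left_ideal L C" using L unfolding maximal_faithful_def by blast
  have L_closed: "\<And>x. x \<in> L \<Longrightarrow> x \<in> carrier C" "\<zero>\<^bsub>C\<^esub> \<in> L"
    "\<And>x y. \<lbrakk>x \<in> L; y \<in> L\<rbrakk> \<Longrightarrow> x \<oplus>\<^bsub>C\<^esub> y \<in> L" "\<And>x. x \<in> L \<Longrightarrow> \<ominus>\<^bsub>C\<^esub> x \<in> L"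
    "\<And>a x. \<lbrakk>a \<in> carrier C; x \<in> L\<rbrakk> \<Longrightarrow> a \<otimes>\<^bsub>C\<^esub> x \<in> L"
    using left unfolding C.left_ideal_iff by blast+
  obtain u where u: "u \<in> carrier C" "\<iota> u = e" "\<And>c. c \<in> carrier C \<Longrightarrow> c \<otimes>\<^bsub>C\<^esub> u = c"
    using unit by metis
  \<comment> \<open>The generator times \<open>x\<close> vanishes in the quotient module exactly
    when e y x sends the generator to zero for all \<open>y\<close>. As the generator is fixed by
    \<open>e\<close>, this says that e y x e, pulled back to \<open>C\<close>, lies in
    \<open>L\<close>.\<close>
  define E where "E x y = (THE d. d \<in> carrier C \<and> \<iota> d = e \<otimes> (y \<otimes> (x \<otimes> e)))" for x y
  have E: "E x y \<in> carrier C" "\<iota> (E x y) = e \<otimes> (y \<otimes> (x \<otimes> e))" if "x \<in> carrier R" "y \<in> carrier R" for x y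
  proof -
    have "\<exists>!d. d \<in> carrier C \<and> \<iota> d = e \<otimes> (y \<otimes> (x \<otimes> e))"
      using corner[of "y \<otimes> x"] that emb_eq_iff by (auto simp: m_assoc) metis
    from theI'[OF this] show "E x y \<in> carrier C" "\<iota> (E x y) = e \<otimes> (y \<otimes> (x \<otimes> e))"
      unfolding E_def by auto
  qed
  have E_eqI: "E x y = d" if "x \<in> carrier R" "y \<in> carrier R" "d \<in> carrier C" "\<iota> d = e \<otimes> (y \<otimes> (x \<otimes> e))" for x y d
    using E that emb_eq_iff by metis
  define L' where "L' = {x \<in> carrier R. \<forall>y\<in>carrier R. E x y \<in> L}"
  have "maximal_faithful L' R"
    unfolding maximal_faithful_def left_ideal_iff
  proof (intro conjI ballI impI)
    show "L' \<subseteq> carrier R" unfolding L'_def by blast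
    have "E \<zero> y = \<zero>\<^bsub>C\<^esub>" if "y \<in> carrier R" for y
      using that by (intro E_eqI) (simp_all add: emb_zero)
    then show "\<zero> \<in> L'" unfolding L'_def using L_closed by simp
    have "E (x \<oplus> x') y = E x y \<oplus>\<^bsub>C\<^esub> E x' y" if "x \<in> carrier R" "x' \<in> carrier R" "y \<in> carrier R" for x x' y
      using that by (intro E_eqI) (simp_all add: E emb_add l_distr r_distr)
    then show "x \<oplus> x' \<in> L'" if "x \<in> L'" "x' \<in> L'" for x x'
      using that L_closed unfolding L'_def by simp
    have "E (\<ominus> x) y = \<ominus>\<^bsub>C\<^esub> E x y" if "x \<in> carrier R" "y \<in> carrier R" for x y
      using that by (intro E_eqI) (simp_all add: E emb_minus l_minus r_minus)
    then show "\<ominus> x \<in> L'" if "x \<in> L'" for x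
      using that L_closed unfolding L'_def by simp
    have "E (a \<otimes> x) y = E x (y \<otimes> a)" if "x \<in> carrier R" "y \<in> carrier R" "a \<in> carrier R" for x y a
      using that by (intro E_eqI) (simp_all add: E m_assoc)
    then show "a \<otimes> x \<in> L'" if "a \<in> carrier R" "x \<in> L'" for a x
      using that unfolding L'_def by simp
    have "u \<notin> L"
    proof
      assume "u \<in> L"
      then have "carrier C \<subseteq> L" using L_closed(5) u by (metis subsetI)
      then show False using L L_closed(1) unfolding maximal_faithful_def by blast
    qed
    moreover have "E e e = u" using u by (intro E_eqI) (simp_all add: e_idem)
    ultimately have "e \<notin> L'" unfolding L'_def by auto
    then show "L' \<noteq> carrier R" by auto
  next
    fix a q assume a: "a \<in> carrier R - L'" and q: "q \<in> carrier R"
    then obtain y where y: "y \<in> carrier R" "E a y \<notin> L" unfolding L'_def by blast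
    obtain b where b: "b \<in> carrier C" "b \<otimes>\<^bsub>C\<^esub> E a y \<ominus>\<^bsub>C\<^esub> u \<in> L"
      using L E(1)[of a y] a y u unfolding maximal_faithful_def by blast
    \<comment> \<open>By the choice of \<open>b\<close>, the element \<iota> b e y a acts on the
      generator like \<open>e\<close>, that is, it fixes it. The factor \<open>q\<close> in front
      turns this into the action of \<open>q\<close>.\<close>
    let ?p = "q \<otimes> (\<iota> b \<otimes> (e \<otimes> y))"
    have "E (?p \<otimes> a \<ominus> q) y' = E q y' \<otimes>\<^bsub>C\<^esub> (b \<otimes>\<^bsub>C\<^esub> E a y \<ominus>\<^bsub>C\<^esub> u)" if y': "y' \<in> carrier R" for y'
      using a q y b u y'
      by (intro E_eqI) (simp_all add: E emb_diff emb_mult l_diff_distr r_diff_distr corner_simps minus_closed C.minus_closed)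
    then have "E (?p \<otimes> a \<ominus> q) y' \<in> L" if "y' \<in> carrier R" for y'
      using that q b L_closed(5) E(1) by simp
    then have "?p \<otimes> a \<ominus> q \<in> L'" unfolding L'_def using a q y b by (simp add: minus_closed)
    moreover have "?p \<in> carrier R" using q y b by simp
    ultimately show "\<exists>b\<in>carrier R. b \<otimes> a \<ominus> q \<in> L'" by blast
  next
    fix a assume a: "a \<in> carrier R" "a \<noteq> \<zero>"
    \<comment> \<open>Nondegeneracy moves the nonzero \<open>a\<close> into the corner, where the
      faithfulness of \<open>L\<close> applies.\<close>
    obtain x y d where xyd: "x \<in> carrier R" "y \<in> carrier R" "d \<in> carrier C" "d \<noteq> \<zero>\<^bsub>C\<^esub>"
      "\<iota> d = e \<otimes> (x \<otimes> (a \<otimes> (y \<otimes> e)))"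
      using nondegenerateE[OF nondeg a] .
    obtain b where b: "b \<in> carrier C" "d \<otimes>\<^bsub>C\<^esub> b \<notin> L"
      using L xyd unfolding maximal_faithful_def by blast
    have "E (a \<otimes> (y \<otimes> \<iota> b)) x = d \<otimes>\<^bsub>C\<^esub> b"
      using a xyd b by (intro E_eqI) (simp_all add: emb_mult corner_simps)
    then have "a \<otimes> (y \<otimes> \<iota> b) \<notin> L'" unfolding L'_def using b(2) xyd(1) by (auto intro!: bexI[of _ x])
    then show "\<exists>b\<in>carrier R. a \<otimes> b \<notin> L'" using xyd b by (intro bexI[of _ "y \<otimes> \<iota> b"]) auto
  qed
  then show ?thesis by (rule maximal_faithful_imp_primitive)
qed

text \<open>Downwards, a generator \<open>t\<close> is compressed to a nonzero d = e a t b e.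
  Upwards, \<open>\<iota> t\<close> itself generates: if a \<iota> t is nonzero, nondegeneracy
  yields \<open>x\<close> with e x a \<iota> t nonzero, and this is \<iota> (c t) for c = e x a e,
  so minimality in \<open>C\<close> brings it back to \<open>t\<close>.\<close>

lemma ex_minimal_left_ideal_corner:
  assumes nondeg: nondegenerate
  shows "(\<exists>L. minimal_left_ideal L R) \<longleftrightarrow> (\<exists>L. minimal_left_ideal L C)"
proof
  assume "\<exists>L. minimal_left_ideal L R"
  then obtain t where t: "t \<in> carrier R" "t \<noteq> \<zero>"
    and gen: "\<And>a. \<lbrakk>a \<in> carrier R; a \<otimes> t \<noteq> \<zero>\<rbrakk> \<Longrightarrow> \<exists>b\<in>carrier R. b \<otimes> (a \<otimes> t) = t"
    unfolding ex_minimal_left_ideal_iff by blast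
  obtain a b d where abd: "a \<in> carrier R" "b \<in> carrier R" "d \<in> carrier C" "d \<noteq> \<zero>\<^bsub>C\<^esub>"
      "\<iota> d = e \<otimes> (a \<otimes> (t \<otimes> (b \<otimes> e)))"
    using nondegenerateE[OF nondeg t] .
  have "\<exists>c'\<in>carrier C. c' \<otimes>\<^bsub>C\<^esub> (c \<otimes>\<^bsub>C\<^esub> d) = d" if c: "c \<in> carrier C" "c \<otimes>\<^bsub>C\<^esub> d \<noteq> \<zero>\<^bsub>C\<^esub>" for c
  proof -
    have "\<iota> (c \<otimes>\<^bsub>C\<^esub> d) = ((\<iota> c \<otimes> a) \<otimes> t) \<otimes> (b \<otimes> e)"
      using abd c t by (simp add: emb_mult corner_simps)
    then have "(\<iota> c \<otimes> a) \<otimes> t \<noteq> \<zero>" using c abd emb_eq_zero_iff[of "c \<otimes>\<^bsub>C\<^esub> d"] by auto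
    then obtain q where q: "q \<in> carrier R" "q \<otimes> ((\<iota> c \<otimes> a) \<otimes> t) = t"
      using gen[of "\<iota> c \<otimes> a"] c abd by auto
    \<comment> \<open>Here c d is the image of (c a) t under right multiplication by b e. Since
      \<open>q\<close> recovers \<open>t\<close> from (c a) t, the factor a q, compressed to the
      corner, recovers d = e a t b e from c d.\<close>
    obtain c' where c': "c' \<in> carrier C" "\<iota> c' = e \<otimes> ((a \<otimes> q) \<otimes> e)" using corner[of "a \<otimes> q"] q abd by auto
    have "\<iota> (c' \<otimes>\<^bsub>C\<^esub> (c \<otimes>\<^bsub>C\<^esub> d)) = e \<otimes> (a \<otimes> ((q \<otimes> ((\<iota> c \<otimes> a) \<otimes> t)) \<otimes> (b \<otimes> e)))"
      using abd c c' q(1) t by (simp add: emb_mult corner_simps)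
    also have "\<dots> = \<iota> d" by (simp add: q abd)
    finally have "c' \<otimes>\<^bsub>C\<^esub> (c \<otimes>\<^bsub>C\<^esub> d) = d"
      using c'(1) c(1) abd(3) by (intro inj_onD[OF emb_inj]) simp_all
    then show ?thesis using c'(1) by blast
  qed
  moreover obtain u where "u \<in> carrier C" "u \<otimes>\<^bsub>C\<^esub> d = d" using unit abd by metis
  ultimately show "\<exists>L. minimal_left_ideal L C"
    unfolding C.ex_minimal_left_ideal_iff using abd by metis
next
  assume "\<exists>L. minimal_left_ideal L C"
  then obtain t where t: "t \<in> carrier C" "t \<noteq> \<zero>\<^bsub>C\<^esub>"
    and gen: "\<And>a. \<lbrakk>a \<in> carrier C; a \<otimes>\<^bsub>C\<^esub> t \<noteq> \<zero>\<^bsub>C\<^esub>\<rbrakk> \<Longrightarrow> \<exists>b\<in>carrier C. b \<otimes>\<^bsub>C\<^esub> (a \<otimes>\<^bsub>C\<^esub> t) = t"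
    unfolding C.ex_minimal_left_ideal_iff by blast
  have "\<exists>q\<in>carrier R. q \<otimes> (a \<otimes> \<iota> t) = \<iota> t" if a: "a \<in> carrier R" "a \<otimes> \<iota> t \<noteq> \<zero>" for a
  proof -
    obtain x y d where xyd: "x \<in> carrier R" "y \<in> carrier R" "d \<in> carrier C" "d \<noteq> \<zero>\<^bsub>C\<^esub>"
        "\<iota> d = e \<otimes> (x \<otimes> ((a \<otimes> \<iota> t) \<otimes> (y \<otimes> e)))"
      using nondegenerateE[OF nondeg _ a(2)] a t by auto
    obtain c where c: "c \<in> carrier C" "\<iota> c = e \<otimes> ((x \<otimes> a) \<otimes> e)" using corner[of "x \<otimes> a"] xyd a by auto
    have ct: "\<iota> (c \<otimes>\<^bsub>C\<^esub> t) = e \<otimes> (x \<otimes> (a \<otimes> \<iota> t))" using c a t xyd by (simp add: emb_mult corner_simps)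
    have "\<iota> d = \<iota> (c \<otimes>\<^bsub>C\<^esub> t) \<otimes> (y \<otimes> e)" unfolding ct using xyd a t by (simp add: m_assoc)
    then have "c \<otimes>\<^bsub>C\<^esub> t \<noteq> \<zero>\<^bsub>C\<^esub>" using xyd emb_zero emb_eq_zero_iff[of d] by auto
    then obtain b where b: "b \<in> carrier C" "b \<otimes>\<^bsub>C\<^esub> (c \<otimes>\<^bsub>C\<^esub> t) = t" using gen c by blast
    have "(\<iota> b \<otimes> (e \<otimes> x)) \<otimes> (a \<otimes> \<iota> t) = \<iota> b \<otimes> \<iota> (c \<otimes>\<^bsub>C\<^esub> t)"
      unfolding ct using b xyd a t by (simp add: m_assoc)
    also have "\<dots> = \<iota> t" using b c t emb_mult[of b "c \<otimes>\<^bsub>C\<^esub> t"] by simp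
    finally show ?thesis using b xyd by (intro bexI[of _ "\<iota> b \<otimes> (e \<otimes> x)"]) simp_all
  qed
  moreover have "\<iota> t \<noteq> \<zero>" using t emb_eq_zero_iff by blast
  ultimately show "\<exists>L. minimal_left_ideal L R"
    unfolding ex_minimal_left_ideal_iff using t e_emb
    by (intro bexI[of _ "\<iota> t"] conjI bexI[of _ e]) auto
qed

text \<open>The largest ideal of \<open>R\<close> whose part in the corner is \<open>J\<close>: if
  \<open>x\<close> lies in any such ideal, then e a x b e lies both in that ideal and in the corner.
  The ideal generated by the image of \<open>J\<close> has the same part in the corner, but its
  quotient may be degenerate.\<close>

definition ext_ideal :: "'c set \<Rightarrow> 'r set" where
  "ext_ideal J = {x \<in> carrier R. \<forall>a\<in>carrier R. \<forall>b\<in>carrier R. e \<otimes> (a \<otimes> (x \<otimes> (b \<otimes> e))) \<in> \<iota> ` J}"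

text \<open>For the second claim, a = b = e gives back c = e c e. Conversely e a c b e = (e a e) c
  (e b e), whose outer factors belong to the corner.\<close>

lemma rng_ideal_ext:
  assumes "rng_ideal J C"
  shows "rng_ideal (ext_ideal J) R" and "c \<in> carrier C \<Longrightarrow> \<iota> c \<in> ext_ideal J \<longleftrightarrow> c \<in> J"
proof -
  have J: "\<And>x. x \<in> J \<Longrightarrow> x \<in> carrier C" "\<zero>\<^bsub>C\<^esub> \<in> J"
    "\<And>x y. \<lbrakk>x \<in> J; y \<in> J\<rbrakk> \<Longrightarrow> x \<oplus>\<^bsub>C\<^esub> y \<in> J" "\<And>x. x \<in> J \<Longrightarrow> \<ominus>\<^bsub>C\<^esub> x \<in> J"
    "\<And>a x. \<lbrakk>a \<in> carrier C; x \<in> J\<rbrakk> \<Longrightarrow> a \<otimes>\<^bsub>C\<^esub> x \<in> J"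
    "\<And>a x. \<lbrakk>a \<in> carrier C; x \<in> J\<rbrakk> \<Longrightarrow> x \<otimes>\<^bsub>C\<^esub> a \<in> J"
    using assms unfolding C.rng_ideal_iff C.left_ideal_iff by blast+
  have img: "\<zero> \<in> \<iota> ` J" "\<And>x y. \<lbrakk>x \<in> \<iota> ` J; y \<in> \<iota> ` J\<rbrakk> \<Longrightarrow> x \<oplus> y \<in> \<iota> ` J"
    "\<And>x. x \<in> \<iota> ` J \<Longrightarrow> \<ominus> x \<in> \<iota> ` J"
    using J emb_zero by (force, auto simp: emb_add[symmetric] emb_minus[symmetric])
  show "rng_ideal (ext_ideal J) R"
    unfolding rng_ideal_iff left_ideal_iff
  proof (intro conjI ballI)
    show "ext_ideal J \<subseteq> carrier R" unfolding ext_ideal_def by blast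
    show "\<zero> \<in> ext_ideal J" using img(1) by (simp add: ext_ideal_def)
    show "x \<oplus> y \<in> ext_ideal J" if "x \<in> ext_ideal J" "y \<in> ext_ideal J" for x y
      using that img(2) by (simp add: ext_ideal_def l_distr r_distr)
    show "\<ominus> x \<in> ext_ideal J" if "x \<in> ext_ideal J" for x
      using that img(3) by (simp add: ext_ideal_def l_minus r_minus)
    fix c x assume c: "c \<in> carrier R" and x: "x \<in> ext_ideal J"
    have xc: "x \<in> carrier R" and mem: "\<And>a b. \<lbrakk>a \<in> carrier R; b \<in> carrier R\<rbrakk> \<Longrightarrow>
        e \<otimes> (a \<otimes> (x \<otimes> (b \<otimes> e))) \<in> \<iota> ` J"
      using x unfolding ext_ideal_def by auto
    have "e \<otimes> (a \<otimes> (c \<otimes> (x \<otimes> (b \<otimes> e)))) \<in> \<iota> ` J" if "a \<in> carrier R" "b \<in> carrier R" for a b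
      using that c xc mem[of "a \<otimes> c" b] by (simp add: m_assoc)
    then show "c \<otimes> x \<in> ext_ideal J" using c xc by (simp add: ext_ideal_def m_assoc)
    have "e \<otimes> (a \<otimes> (x \<otimes> (c \<otimes> (b \<otimes> e)))) \<in> \<iota> ` J" if "a \<in> carrier R" "b \<in> carrier R" for a b
      using that c xc mem[of a "c \<otimes> b"] by (simp add: m_assoc)
    then show "x \<otimes> c \<in> ext_ideal J" using c xc by (simp add: ext_ideal_def m_assoc)
  qed
  show "\<iota> c \<in> ext_ideal J \<longleftrightarrow> c \<in> J" if c: "c \<in> carrier C"
  proof
    assume "\<iota> c \<in> ext_ideal J"
    then have "\<forall>a\<in>carrier R. \<forall>b\<in>carrier R. e \<otimes> (a \<otimes> (\<iota> c \<otimes> (b \<otimes> e))) \<in> \<iota> ` J"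
      by (simp add: ext_ideal_def)
    from this[rule_format, OF e_closed e_closed]
    have "\<iota> c \<in> \<iota> ` J" using c by (simp add: corner_simps)
    then obtain d where "d \<in> J" "\<iota> c = \<iota> d" by blast
    then show "c \<in> J" using c J(1) emb_eq_iff by metis
  next
    assume cJ: "c \<in> J"
    have "e \<otimes> (a \<otimes> (\<iota> c \<otimes> (b \<otimes> e))) \<in> \<iota> ` J" if ab: "a \<in> carrier R" "b \<in> carrier R" for a b
    proof -
      obtain a' b' where ab': "a' \<in> carrier C" "\<iota> a' = e \<otimes> (a \<otimes> e)" "b' \<in> carrier C" "\<iota> b' = e \<otimes> (b \<otimes> e)"
        using corner ab by metis
      have "\<iota> (a' \<otimes>\<^bsub>C\<^esub> (c \<otimes>\<^bsub>C\<^esub> b')) = e \<otimes> (a \<otimes> (\<iota> c \<otimes> (b \<otimes> e)))"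
        using ab ab' c by (simp add: emb_mult corner_simps)
      moreover have "a' \<otimes>\<^bsub>C\<^esub> (c \<otimes>\<^bsub>C\<^esub> b') \<in> J" using J(5,6) ab' cJ by simp
      ultimately show ?thesis by (metis imageI)
    qed
    then show "\<iota> c \<in> ext_ideal J" unfolding ext_ideal_def using c by simp
  qed
qed

lemma rng_ideal_contract:
  assumes "rng_ideal I R"
  shows "rng_ideal {c \<in> carrier C. \<iota> c \<in> I} C"
  using assms unfolding rng_ideal_iff left_ideal_iff C.rng_ideal_iff C.left_ideal_iff
  by (auto simp: emb_zero emb_add emb_minus emb_mult)

text \<open>If \<open>R\<close> is simple, every ideal \<open>J\<close> of \<open>C\<close> is the
  corner part of \<open>ext_ideal J\<close>, which is zero or \<open>R\<close>. If \<open>C\<close>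
  is simple, nondegeneracy lets a nonzero ideal of \<open>R\<close> meet the corner in a nonzero
  ideal; it then contains the whole corner, thus \<open>e\<close>, and fullness finishes.\<close>

lemma simple_rng_corner:
  assumes nondeg: nondegenerate
  shows "simple_rng R \<longleftrightarrow> simple_rng C"
proof
  assume simple: "simple_rng R"
  obtain x where "x \<in> carrier R" "x \<noteq> \<zero>"
    using simple m_closed unfolding simple_rng_def by blast
  then have "e \<noteq> \<zero>" by (rule e_nonzero)
  obtain u where u: "u \<in> carrier C" "\<iota> u = e" "\<And>c. c \<in> carrier C \<Longrightarrow> c \<otimes>\<^bsub>C\<^esub> u = c"
    using unit by metis
  then have "u \<otimes>\<^bsub>C\<^esub> u \<noteq> \<zero>\<^bsub>C\<^esub>" using \<open>e \<noteq> \<zero>\<close> emb_zero by auto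
  moreover have "J = {\<zero>\<^bsub>C\<^esub>} \<or> J = carrier C" if J: "rng_ideal J C" for J
  proof -
    have "ext_ideal J = {\<zero>} \<or> ext_ideal J = carrier R"
      using simple rng_ideal_ext(1)[OF J] unfolding simple_rng_def by blast
    moreover have "J \<subseteq> carrier C" using J unfolding C.rng_ideal_iff C.left_ideal_iff by argo
    then have "J = {c \<in> carrier C. \<iota> c \<in> ext_ideal J}" using rng_ideal_ext(2)[OF J] by auto
    ultimately have "J = {c \<in> carrier C. \<iota> c \<in> {\<zero>}} \<or> J = {c \<in> carrier C. \<iota> c \<in> carrier R}" by metis
    then show ?thesis by (auto simp: emb_eq_zero_iff)
  qed
  ultimately show "simple_rng C"
    unfolding simple_rng_def using u(1) C.rng_axioms by blast
next
  assume simple: "simple_rng C"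
  obtain x y where xy: "x \<in> carrier C" "y \<in> carrier C" "x \<otimes>\<^bsub>C\<^esub> y \<noteq> \<zero>\<^bsub>C\<^esub>"
    using simple unfolding simple_rng_def by blast
  then have "\<iota> x \<otimes> \<iota> y \<noteq> \<zero>" using emb_eq_zero_iff[of "x \<otimes>\<^bsub>C\<^esub> y"] by (simp add: emb_mult)
  moreover have "I = {\<zero>} \<or> I = carrier R" if I: "rng_ideal I R" for I
  proof (cases "I = {\<zero>}")
    case False
    have Icl: "\<And>x. x \<in> I \<Longrightarrow> x \<in> carrier R" "\<zero> \<in> I" "\<And>a x. \<lbrakk>a \<in> carrier R; x \<in> I\<rbrakk> \<Longrightarrow> a \<otimes> x \<in> I"
      "\<And>a x. \<lbrakk>a \<in> carrier R; x \<in> I\<rbrakk> \<Longrightarrow> x \<otimes> a \<in> I"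
      using I unfolding rng_ideal_iff left_ideal_iff by blast+
    obtain x where x: "x \<in> I" "x \<noteq> \<zero>" using False Icl(2) by blast
    obtain a b d where "a \<in> carrier R" "b \<in> carrier R" "d \<in> carrier C" "d \<noteq> \<zero>\<^bsub>C\<^esub>"
        "\<iota> d = e \<otimes> (a \<otimes> (x \<otimes> (b \<otimes> e)))"
      using nondegenerateE[OF nondeg Icl(1)[OF x(1)] x(2)] .
    then have "d \<in> {c \<in> carrier C. \<iota> c \<in> I}" using Icl(3,4) x by simp
    then have "{c \<in> carrier C. \<iota> c \<in> I} = carrier C"
      using rng_ideal_contract[OF I] simple \<open>d \<noteq> _\<close> unfolding simple_rng_def by blast
    then have "e \<in> I" using unit by (metis (mono_tags, lifting) mem_Collect_eq)
    then show ?thesis using full[OF I] by blast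
  qed simp
  ultimately show "simple_rng R"
    unfolding simple_rng_def using rng_axioms xy by (meson emb_closed)
qed

end

section \<open>Quotients of rings without unit\<close>

context rng_ideal
begin

lemma abelian_subgroup: "abelian_subgroup I R"
  by (rule abelian_subgroupI3[OF additive_subgroup_axioms abelian_group_axioms])

lemma quot_carrier: "carrier (R Quot I) = (\<lambda>x. I +> x) ` carrier R"
  by (auto simp: FactRing_def A_RCOSETS_def')

lemma quot_zero: "\<zero>\<^bsub>R Quot I\<^esub> = I +> \<zero>"
  using a_subset by (simp add: FactRing_def)

lemma quot_add: "\<lbrakk>x \<in> carrier R; y \<in> carrier R\<rbrakk> \<Longrightarrow> (I +> x) \<oplus>\<^bsub>R Quot I\<^esub> (I +> y) = I +> (x \<oplus> y)"
  using abelian_subgroup.a_rcos_sum[OF abelian_subgroup] by (simp add: FactRing_def)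

lemma quot_eq_iff: "\<lbrakk>x \<in> carrier R; y \<in> carrier R\<rbrakk> \<Longrightarrow> I +> x = I +> y \<longleftrightarrow> x \<ominus> y \<in> I"
  by (rule abelian_subgroup.r_coset_eq_iff[OF abelian_subgroup])

lemma quot_eq_zero_iff: "x \<in> carrier R \<Longrightarrow> I +> x = \<zero>\<^bsub>R Quot I\<^esub> \<longleftrightarrow> x \<in> I"
proof -
  have "\<ominus> \<zero> = \<zero>" by (intro minus_equality) simp_all
  then show "x \<in> carrier R \<Longrightarrow> I +> x = \<zero>\<^bsub>R Quot I\<^esub> \<longleftrightarrow> x \<in> I"
    using quot_eq_iff[of x \<zero>] by (metis quot_zero a_minus_def r_zero zero_closed)
qed

lemma mem_coset:
  assumes "x \<in> carrier R" "y \<in> I +> x"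
  shows "y \<in> carrier R" "I +> y = I +> x"
  using abelian_subgroup.a_elemrcos_carrier[OF abelian_subgroup assms]
    abelian_subgroup.a_repr_independence'[OF abelian_subgroup assms(2,1)] by simp_all

lemma coset_self: "x \<in> carrier R \<Longrightarrow> x \<in> I +> x"
  by (rule abelian_subgroup.a_rcos_self[OF abelian_subgroup])

lemma quot_mult:
  assumes "x \<in> carrier R" "y \<in> carrier R"
  shows "(I +> x) \<otimes>\<^bsub>R Quot I\<^esub> (I +> y) = I +> (x \<otimes> y)"
proof -
  have "I +> (a \<otimes> b) = I +> (x \<otimes> y)" if a: "a \<in> I +> x" and b: "b \<in> I +> y" for a b
  proof -
    have ab: "a \<in> carrier R" "b \<in> carrier R" using mem_coset a b assms by blast+
    have "a \<ominus> x \<in> I" "b \<ominus> y \<in> I"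
      using mem_coset(2)[OF _ a] mem_coset(2)[OF _ b] ab assms by (simp_all add: quot_eq_iff)
    then have "(a \<ominus> x) \<otimes> b \<in> I" "x \<otimes> (b \<ominus> y) \<in> I" using I_l_closed I_r_closed ab assms by auto
    then have "I +> (a \<otimes> b) = I +> (x \<otimes> b)" "I +> (x \<otimes> b) = I +> (x \<otimes> y)"
      using ab assms by (simp_all add: quot_eq_iff m_closed l_diff_distr r_diff_distr)
    then show ?thesis by simp
  qed
  then have "(\<Union>a\<in>I +> x. \<Union>b\<in>I +> y. I +> (a \<otimes> b)) = I +> (x \<otimes> y)"
    by (intro UN_constant_eq[OF coset_self] ballI assms)
  then show ?thesis by (simp add: FactRing_def rcoset_mult_def)
qed

lemma quot_rng: "rng (R Quot I)"
proof -
  have "abelian_group (R Quot I)"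
  proof (rule abelian_groupI)
    fix X assume "X \<in> carrier (R Quot I)"
    then obtain x where "x \<in> carrier R" "X = I +> x" by (auto simp: quot_carrier)
    then show "\<exists>Y\<in>carrier (R Quot I). Y \<oplus>\<^bsub>R Quot I\<^esub> X = \<zero>\<^bsub>R Quot I\<^esub>"
      by (intro bexI[of _ "I +> (\<ominus> x)"]) (auto simp: quot_carrier quot_zero quot_add l_neg simp del: a_coset_add_zero)
  qed (auto simp: quot_carrier quot_add a_ac quot_zero simp del: a_coset_add_zero)
  then show ?thesis
    unfolding rng_def rng_axioms_def
    by (auto simp: quot_carrier quot_add quot_mult m_closed m_assoc l_distr r_distr)
qed

end

text \<open>The ideal of \<open>C\<close> is the exact preimage of \<open>I\<close>, so two elements
  of \<open>C\<close> are congruent if and only if their images are: one direction makes the induced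
  map well defined, the other injective. The union over a coset joins equal sets and so returns
  their common value without a choice of representative.\<close>

lemma (in full_corner) full_corner_quot:
  assumes "rng_ideal I R"
  shows "full_corner (R Quot I) (C Quot {c \<in> carrier C. \<iota> c \<in> I}) (\<lambda>X. \<Union>c\<in>X. I +> \<iota> c) (I +> e)"
proof -
  interpret I: rng_ideal I R by fact
  define J where "J = {c \<in> carrier C. \<iota> c \<in> I}"
  interpret J: rng_ideal J C unfolding J_def using assms by (rule rng_ideal_contract)
  interpret RI: rng "R Quot I" by (rule I.quot_rng)
  interpret CJ: rng "C Quot J" by (rule J.quot_rng)
  define \<kappa> where "\<kappa> = (\<lambda>X. \<Union>c\<in>X. I +> \<iota> c)"
  have \<kappa>: "\<kappa> (J +>\<^bsub>C\<^esub> c) = I +> \<iota> c" if c: "c \<in> carrier C" for c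
    unfolding \<kappa>_def
  proof (rule UN_constant_eq[OF J.coset_self[OF c]], rule ballI)
    fix d assume d: "d \<in> J +>\<^bsub>C\<^esub> c"
    then have "d \<in> carrier C" "d \<ominus>\<^bsub>C\<^esub> c \<in> J"
      using J.mem_coset[OF c d] J.quot_eq_iff[of d c] c by auto
    moreover from this have "\<iota> (d \<ominus>\<^bsub>C\<^esub> c) \<in> I" unfolding J_def by blast
    ultimately show "I +> \<iota> d = I +> \<iota> c"
      using c I.quot_eq_iff[of "\<iota> d" "\<iota> c"] emb_diff[of d c] by simp
  qed
  have "full_corner (R Quot I) (C Quot J) \<kappa> (I +> e)"
  proof (intro full_corner.intro RI.rng_axioms CJ.rng_axioms full_corner_axioms.intro)
    show "inj_on \<kappa> (carrier (C Quot J))"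
    proof (rule inj_onI)
      fix X Y assume XY: "X \<in> carrier (C Quot J)" "Y \<in> carrier (C Quot J)" and eq: "\<kappa> X = \<kappa> Y"
      obtain c d where "c \<in> carrier C" "X = J +>\<^bsub>C\<^esub> c" "d \<in> carrier C" "Y = J +>\<^bsub>C\<^esub> d"
        using XY by (auto simp: J.quot_carrier)
      moreover from this have "\<iota> (c \<ominus>\<^bsub>C\<^esub> d) \<in> I"
        using eq \<kappa> I.quot_eq_iff[of "\<iota> c" "\<iota> d"] emb_diff[of c d] by simp
      then have "c \<ominus>\<^bsub>C\<^esub> d \<in> J" using calculation C.minus_closed unfolding J_def by blast
      ultimately show "X = Y" using J.quot_eq_iff[of c d] by simp
    qed
    show "\<exists>c\<in>carrier (C Quot J). \<kappa> c = (I +> e) \<otimes>\<^bsub>R Quot I\<^esub> (X \<otimes>\<^bsub>R Quot I\<^esub> (I +> e))"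
      if X: "X \<in> carrier (R Quot I)" for X
    proof -
      obtain a where a: "a \<in> carrier R" "X = I +> a" using X by (auto simp: I.quot_carrier)
      obtain c where "c \<in> carrier C" "\<iota> c = e \<otimes> (a \<otimes> e)" using corner a by blast
      then show ?thesis using a
        by (intro bexI[of _ "J +>\<^bsub>C\<^esub> c"]) (simp_all add: \<kappa> I.quot_mult J.quot_carrier)
    qed
    show "P = carrier (R Quot I)" if P: "rng_ideal P (R Quot I)" "I +> e \<in> P" for P
    proof -
      \<comment> \<open>Fullness of the class of \<open>e\<close> is tested on the preimage of
        \<open>P\<close> in \<open>R\<close>, an ideal containing \<open>e\<close>.\<close>
      let ?P = "{a \<in> carrier R. I +> a \<in> P}"
      have Pcl: "P \<subseteq> carrier (R Quot I)" "\<zero>\<^bsub>R Quot I\<^esub> \<in> P"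
        "\<And>x y. \<lbrakk>x \<in> P; y \<in> P\<rbrakk> \<Longrightarrow> x \<oplus>\<^bsub>R Quot I\<^esub> y \<in> P" "\<And>x. x \<in> P \<Longrightarrow> \<ominus>\<^bsub>R Quot I\<^esub> x \<in> P"
        "\<And>a x. \<lbrakk>a \<in> carrier (R Quot I); x \<in> P\<rbrakk> \<Longrightarrow> a \<otimes>\<^bsub>R Quot I\<^esub> x \<in> P"
        "\<And>a x. \<lbrakk>a \<in> carrier (R Quot I); x \<in> P\<rbrakk> \<Longrightarrow> x \<otimes>\<^bsub>R Quot I\<^esub> a \<in> P"
        using P(1) unfolding RI.rng_ideal_iff RI.left_ideal_iff by blast+
      have neg: "I +> (\<ominus> a) = \<ominus>\<^bsub>R Quot I\<^esub> (I +> a)" if "a \<in> carrier R" for a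
        using that by (intro RI.minus_equality[symmetric])
          (auto simp: I.quot_carrier I.quot_zero I.quot_add l_neg simp del: a_coset_add_zero)
      have "rng_ideal ?P R"
        unfolding rng_ideal_iff left_ideal_iff
        using Pcl(2-4) Pcl(5,6)[of "I +> _"]
        by (auto simp: I.quot_zero I.quot_carrier I.quot_add[symmetric] I.quot_mult[symmetric] neg
            simp del: a_coset_add_zero)
      then have "?P = carrier R" by (rule full) (simp add: P(2))
      then show ?thesis using Pcl(1) by (auto simp: I.quot_carrier)
    qed
  next
    show "I +> e \<in> carrier (R Quot I)" by (simp add: I.quot_carrier)
    show "(I +> e) \<otimes>\<^bsub>R Quot I\<^esub> (I +> e) = I +> e" by (simp add: I.quot_mult e_idem)
    fix X assume X: "X \<in> carrier (C Quot J)"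
    then obtain c where c: "c \<in> carrier C" "X = J +>\<^bsub>C\<^esub> c" by (auto simp: J.quot_carrier)
    show "\<kappa> X \<in> carrier (R Quot I)" using c by (simp add: \<kappa> I.quot_carrier)
    show "(I +> e) \<otimes>\<^bsub>R Quot I\<^esub> \<kappa> X = \<kappa> X" using c by (simp add: \<kappa> I.quot_mult e_emb)
    show "\<kappa> X \<otimes>\<^bsub>R Quot I\<^esub> (I +> e) = \<kappa> X" using c by (simp add: \<kappa> I.quot_mult emb_e)
    fix Y assume "Y \<in> carrier (C Quot J)"
    then obtain d where d: "d \<in> carrier C" "Y = J +>\<^bsub>C\<^esub> d" by (auto simp: J.quot_carrier)
    show "\<kappa> (X \<oplus>\<^bsub>C Quot J\<^esub> Y) = \<kappa> X \<oplus>\<^bsub>R Quot I\<^esub> \<kappa> Y"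
      using c d by (simp add: \<kappa> I.quot_add J.quot_add emb_add)
    show "\<kappa> (X \<otimes>\<^bsub>C Quot J\<^esub> Y) = \<kappa> X \<otimes>\<^bsub>R Quot I\<^esub> \<kappa> Y"
      using c d by (simp add: \<kappa> I.quot_mult J.quot_mult emb_mult)
  qed
  then show ?thesis unfolding J_def \<kappa>_def .
qed

text \<open>If \<open>x\<close> is outside \<open>ext_ideal J\<close>, some e a x b e is outside the
  image of \<open>J\<close>. Being an element of the corner, it is then outside
  \<open>ext_ideal J\<close> too, so it stays nonzero in the quotient.\<close>

lemma (in full_corner) nondegenerate_quot_ext:
  assumes J: "rng_ideal J C"
  shows "full_corner.nondegenerate (R Quot ext_ideal J) (ext_ideal J +> e)"
proof -
  let ?I = "ext_ideal J"
  interpret I: rng_ideal ?I R by (rule rng_ideal_ext(1)[OF J])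
  have "\<exists>a\<in>carrier R. \<exists>b\<in>carrier R. e \<otimes> (a \<otimes> (x \<otimes> (b \<otimes> e))) \<notin> ?I" if x: "x \<in> carrier R" "x \<notin> ?I" for x
  proof -
    obtain a b where ab: "a \<in> carrier R" "b \<in> carrier R" "e \<otimes> (a \<otimes> (x \<otimes> (b \<otimes> e))) \<notin> \<iota> ` J"
      using x unfolding ext_ideal_def by blast
    obtain c where c: "c \<in> carrier C" "\<iota> c = e \<otimes> ((a \<otimes> (x \<otimes> b)) \<otimes> e)"
      using corner[of "a \<otimes> (x \<otimes> b)"] ab x by auto
    then have "\<iota> c = e \<otimes> (a \<otimes> (x \<otimes> (b \<otimes> e)))" using ab x by (simp add: m_assoc)
    then show ?thesis using ab rng_ideal_ext(2)[OF J c(1)] by (metis imageI)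
  qed
  then show ?thesis
    unfolding full_corner.nondegenerate_def[OF full_corner_quot[OF I.rng_ideal_axioms]]
    by (auto simp: I.quot_carrier I.quot_mult I.quot_eq_zero_iff)
qed

lemma (in full_corner) quot_contract_ext:
  assumes J: "rng_ideal J C"
  shows "{c \<in> carrier C. \<iota> c \<in> ext_ideal J} = J"
  using rng_ideal_ext(2)[OF J] J unfolding C.rng_ideal_iff C.left_ideal_iff by blast

lemma (in full_corner) full_corner_quot_ext:
  assumes J: "rng_ideal J C"
  shows "full_corner (R Quot ext_ideal J) (C Quot J) (\<lambda>X. \<Union>c\<in>X. ext_ideal J +> \<iota> c) (ext_ideal J +> e)"
  using full_corner_quot[OF rng_ideal_ext(1)[OF J]] unfolding quot_contract_ext[OF J] .

section \<open>Transfer of CCR and GCR through a full corner\<close>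

context full_corner
begin

text \<open>The two directions obtain nondegeneracy from different sources. Starting with an ideal
  \<open>J\<close> of \<open>C\<close>, it comes from the choice of \<open>ext_ideal J\<close>, and
  primitivity of the larger quotient is deduced from it. Starting with an ideal \<open>I\<close> of
  \<open>R\<close>, it comes from the assumed primitivity of R/I.\<close>

lemma CCR_corner_iff: "CCR_rng R \<longleftrightarrow> CCR_rng C"
proof
  assume ccr: "CCR_rng R"
  have "simple_rng (C Quot J) \<and> (\<exists>L. minimal_left_ideal L (C Quot J))"
    if J: "rng_ideal J C" and prim: "primitive_rng (C Quot J)" for J
  proof -
    note Q = full_corner_quot_ext[OF J]
    note nd = nondegenerate_quot_ext[OF J]
    have "primitive_rng (R Quot ext_ideal J)" using full_corner.primitive_of_corner[OF Q nd prim] .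
    then have "simple_rng (R Quot ext_ideal J)" "\<exists>L. minimal_left_ideal L (R Quot ext_ideal J)"
      using ccr rng_ideal_ext(1)[OF J] unfolding CCR_rng_def by blast+
    then show ?thesis using full_corner.simple_rng_corner[OF Q nd] full_corner.ex_minimal_left_ideal_corner[OF Q nd] by simp
  qed
  then show "CCR_rng C" unfolding CCR_rng_def using C.rng_axioms by blast
next
  assume ccr: "CCR_rng C"
  have "simple_rng (R Quot I) \<and> (\<exists>L. minimal_left_ideal L (R Quot I))"
    if I: "rng_ideal I R" and prim: "primitive_rng (R Quot I)" for I
  proof -
    note Q = full_corner_quot[OF I]
    note nd = full_corner.primitive_imp_nondegenerate[OF Q prim]
    show ?thesis
      using ccr rng_ideal_contract[OF I] full_corner.primitive_corner[OF Q prim] full_corner.simple_rng_corner[OF Q nd]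
        full_corner.ex_minimal_left_ideal_corner[OF Q nd]
      unfolding CCR_rng_def by simp
  qed
  then show "CCR_rng R" unfolding CCR_rng_def using rng_axioms by blast
qed

lemma GCR_corner_iff: "GCR_rng R \<longleftrightarrow> GCR_rng C"
proof
  assume gcr: "GCR_rng R"
  have "\<exists>L. minimal_left_ideal L (C Quot J)"
    if J: "rng_ideal J C" and prim: "primitive_rng (C Quot J)" for J
  proof -
    note Q = full_corner_quot_ext[OF J]
    note nd = nondegenerate_quot_ext[OF J]
    have "primitive_rng (R Quot ext_ideal J)" using full_corner.primitive_of_corner[OF Q nd prim] .
    then have "\<exists>L. minimal_left_ideal L (R Quot ext_ideal J)"
      using gcr rng_ideal_ext(1)[OF J] unfolding GCR_rng_def by blast
    then show ?thesis using full_corner.ex_minimal_left_ideal_corner[OF Q nd] by simp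
  qed
  then show "GCR_rng C" unfolding GCR_rng_def using C.rng_axioms by blast
next
  assume gcr: "GCR_rng C"
  have "\<exists>L. minimal_left_ideal L (R Quot I)"
    if I: "rng_ideal I R" and prim: "primitive_rng (R Quot I)" for I
  proof -
    note Q = full_corner_quot[OF I]
    show ?thesis
      using gcr rng_ideal_contract[OF I] full_corner.primitive_corner[OF Q prim]
        full_corner.ex_minimal_left_ideal_corner[OF Q full_corner.primitive_imp_nondegenerate[OF Q prim]]
      unfolding GCR_rng_def by simp
  qed
  then show "GCR_rng R" unfolding GCR_rng_def using rng_axioms by blast
qed

end

section \<open>Sums of finitely supported families\<close>

context abelian_monoid
begin

text \<open>Families compared in one equation usually have different supports; this evaluates all
  their sums over one common finite set.\<close>

lemma supp_sum_eq_finsum: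
  assumes "finite S" "S \<subseteq> X" "f \<in> X \<rightarrow> carrier G" "\<And>x. x \<in> X - S \<Longrightarrow> f x = \<zero>"
  shows "supp_sum G f X = finsum G f S"
  unfolding supp_sum_def using assms
  by (intro add.finprod_mono_neutral_cong_left) auto

lemma supp_sum_closed [simp]: "f \<in> X \<rightarrow> carrier G \<Longrightarrow> supp_sum G f X \<in> carrier G"
  unfolding supp_sum_def by (intro finsum_closed) auto

lemma supp_sum_cong:
  assumes "X = Y" "\<And>x. x \<in> Y \<Longrightarrow> f x = g x" "g \<in> Y \<rightarrow> carrier G"
  shows "supp_sum G f X = supp_sum G g Y"
  unfolding supp_sum_def using assms by (intro finsum_cong') auto

lemma supp_sum_zero: "(\<And>x. x \<in> X \<Longrightarrow> f x = \<zero>) \<Longrightarrow> supp_sum G f X = \<zero>"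
  using supp_sum_eq_finsum[of "{}" X f] by auto

lemma supp_sum_nonzero: "supp_sum G f X \<noteq> \<zero> \<Longrightarrow> \<exists>x\<in>X. f x \<noteq> \<zero>"
  using supp_sum_zero[of X f] by auto

lemma supp_sum_single:
  assumes "a \<in> X" "f \<in> X \<rightarrow> carrier G" "\<And>x. x \<in> X \<Longrightarrow> x \<noteq> a \<Longrightarrow> f x = \<zero>"
  shows "supp_sum G f X = f a"
  using supp_sum_eq_finsum[of "{a}" X f] assms by (auto simp: Pi_iff)

lemma supp_sum_superset:
  assumes "X \<subseteq> Y" "\<And>x. x \<in> Y - X \<Longrightarrow> f x = \<zero>"
  shows "supp_sum G f Y = supp_sum G f X"
  unfolding supp_sum_def using assms by (intro arg_cong[where f = "finsum G f"]) auto

lemma supp_sum_reindex: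
  assumes "inj_on h X" "f \<in> h ` X \<rightarrow> carrier G"
  shows "supp_sum G f (h ` X) = supp_sum G (\<lambda>x. f (h x)) X"
proof -
  have "{y \<in> h ` X. f y \<noteq> \<zero>} = h ` {x \<in> X. f (h x) \<noteq> \<zero>}" by auto
  moreover have "inj_on h {x \<in> X. f (h x) \<noteq> \<zero>}" using assms(1) by (auto simp: inj_on_def)
  ultimately show ?thesis
    unfolding supp_sum_def using finsum_reindex[of f h "{x \<in> X. f (h x) \<noteq> \<zero>}"] assms(2) by auto
qed

lemma supp_sum_addf:
  assumes "f \<in> X \<rightarrow> carrier G" "g \<in> X \<rightarrow> carrier G"
    and "finite {x \<in> X. f x \<noteq> \<zero>}" "finite {x \<in> X. g x \<noteq> \<zero>}"
  shows "supp_sum G (\<lambda>x. f x \<oplus> g x) X = supp_sum G f X \<oplus> supp_sum G g X"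
proof -
  \<comment> \<open>Cancellation can shrink the support of the sum, so all three sums are taken over
    the union of the two supports.\<close>
  let ?S = "{x \<in> X. f x \<noteq> \<zero>} \<union> {x \<in> X. g x \<noteq> \<zero>}"
  have "supp_sum G f X = finsum G f ?S" "supp_sum G g X = finsum G g ?S"
    "supp_sum G (\<lambda>x. f x \<oplus> g x) X = finsum G (\<lambda>x. f x \<oplus> g x) ?S"
    using assms by (intro supp_sum_eq_finsum; auto)+
  moreover have "f \<in> ?S \<rightarrow> carrier G" "g \<in> ?S \<rightarrow> carrier G" using assms by auto
  ultimately show ?thesis using finsum_addf[of f ?S g] by simp
qed

lemma finsum_swap:
  assumes "finite A" "finite B" "\<And>x y. \<lbrakk>x \<in> A; y \<in> B\<rbrakk> \<Longrightarrow> f x y \<in> carrier G"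
  shows "finsum G (\<lambda>x. finsum G (f x) B) A = finsum G (\<lambda>y. finsum G (\<lambda>x. f x y) A) B"
  using assms(1,3)
proof (induction A rule: finite_induct)
  case empty
  then show ?case by (simp add: finsum_zero)
next
  case (insert a A)
  have "finsum G (\<lambda>y. finsum G (\<lambda>x. f x y) (insert a A)) B = finsum G (\<lambda>y. f a y \<oplus> finsum G (\<lambda>x. f x y) A) B"
    using insert by (intro finsum_cong') (auto intro!: finsum_insert finsum_closed)
  also have "\<dots> = finsum G (f a) B \<oplus> finsum G (\<lambda>y. finsum G (\<lambda>x. f x y) A) B"
    using insert by (intro finsum_addf) (auto intro!: finsum_closed)
  also have "\<dots> = finsum G (f a) B \<oplus> finsum G (\<lambda>x. finsum G (f x) B) A"
    using insert by simp
  also have "\<dots> = finsum G (\<lambda>x. finsum G (f x) B) (insert a A)"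
    using insert by (intro finsum_insert[symmetric]) (auto intro!: finsum_closed)
  finally show ?case by simp
qed

lemma finsum_Times:
  assumes "finite A" "finite B" "\<And>x y. \<lbrakk>x \<in> A; y \<in> B\<rbrakk> \<Longrightarrow> f x y \<in> carrier G"
  shows "finsum G (\<lambda>(x, y). f x y) (A \<times> B) = finsum G (\<lambda>x. finsum G (f x) B) A"
  using assms(1,3)
proof (induction A rule: finite_induct)
  case empty
  then show ?case by simp
next
  case (insert a A)
  have closed: "(\<lambda>(x, y). f x y) \<in> Pair a ` B \<rightarrow> carrier G" "(\<lambda>(x, y). f x y) \<in> A \<times> B \<rightarrow> carrier G"
    using insert.prems by auto
  have "finsum G (\<lambda>(x, y). f x y) (Pair a ` B) = finsum G (f a) B"
    using finsum_reindex[OF closed(1)] by (simp add: inj_on_def)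
  moreover have "insert a A \<times> B = Pair a ` B \<union> A \<times> B" by auto
  then have "finsum G (\<lambda>(x, y). f x y) (insert a A \<times> B)
      = finsum G (\<lambda>(x, y). f x y) (Pair a ` B) \<oplus> finsum G (\<lambda>(x, y). f x y) (A \<times> B)"
    using insert.hyps assms(2) finsum_Un_disjoint[OF _ _ _ closed] by auto
  moreover have "finsum G (\<lambda>x. finsum G (f x) B) (insert a A)
      = finsum G (f a) B \<oplus> finsum G (\<lambda>x. finsum G (f x) B) A"
    using insert by (intro finsum_insert) (auto intro!: finsum_closed)
  ultimately show ?case using insert by simp
qed

text \<open>The joint support is finite and therefore lies in the finite rectangle A \<times> B of
  its projections. Terms outside the rectangle vanish, and so do the inner sums for indices outside
  A; both sides become finite sums over it.\<close>

lemma supp_sum_Times: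
  assumes fin: "finite {(x, y). x \<in> X \<and> y \<in> Y \<and> f x y \<noteq> \<zero>}"
    and closed: "\<And>x y. \<lbrakk>x \<in> X; y \<in> Y\<rbrakk> \<Longrightarrow> f x y \<in> carrier G"
  shows "supp_sum G (\<lambda>(x, y). f x y) (X \<times> Y) = supp_sum G (\<lambda>x. supp_sum G (f x) Y) X"
proof -
  let ?P = "{(x, y). x \<in> X \<and> y \<in> Y \<and> f x y \<noteq> \<zero>}"
  define A B where "A = fst ` ?P" and "B = snd ` ?P"
  have AB: "finite A" "A \<subseteq> X" "finite B" "B \<subseteq> Y"
    unfolding A_def B_def using fin by (auto intro!: finite_imageI simp del: mem_Collect_eq)
  have zA: "f x y = \<zero>" if "x \<in> X - A" "y \<in> Y" for x y using that unfolding A_def by force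
  have zB: "f x y = \<zero>" if "x \<in> X" "y \<in> Y - B" for x y using that unfolding B_def by force
  have sA: "supp_sum G (f x) Y = \<zero>" if "x \<in> X - A" for x
    by (rule supp_sum_zero) (rule zA[OF that])
  have "supp_sum G (\<lambda>(x, y). f x y) (X \<times> Y) = finsum G (\<lambda>(x, y). f x y) (A \<times> B)"
  proof (rule supp_sum_eq_finsum)
    show "(case z of (x, y) \<Rightarrow> f x y) = \<zero>" if "z \<in> X \<times> Y - A \<times> B" for z
      using that zA zB by (cases z) auto
  qed (use AB closed in auto)
  also have "\<dots> = finsum G (\<lambda>x. finsum G (f x) B) A"
    using AB closed by (intro finsum_Times) auto
  also have "\<dots> = finsum G (\<lambda>x. supp_sum G (f x) Y) A"
  proof (rule finsum_cong'[OF refl])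
    show "(\<lambda>x. supp_sum G (f x) Y) \<in> A \<rightarrow> carrier G" using AB closed by auto
    show "finsum G (f x) B = supp_sum G (f x) Y" if "x \<in> A" for x
      using AB(3,4) subsetD[OF AB(2) that] closed zB
      by (intro supp_sum_eq_finsum[symmetric]) (simp_all add: Pi_iff)
  qed
  also have "\<dots> = supp_sum G (\<lambda>x. supp_sum G (f x) Y) X"
    using AB(1,2) closed by (intro supp_sum_eq_finsum[symmetric]) (simp_all add: Pi_iff sA)
  finally show ?thesis .
qed

text \<open>The same reduction to the rectangle spanned by the joint support, followed by the
  interchange of finite sums.\<close>

lemma supp_sum_swap:
  assumes fin: "finite {(x, y). x \<in> X \<and> y \<in> Y \<and> f x y \<noteq> \<zero>}"
    and closed: "\<And>x y. \<lbrakk>x \<in> X; y \<in> Y\<rbrakk> \<Longrightarrow> f x y \<in> carrier G"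
  shows "supp_sum G (\<lambda>x. supp_sum G (f x) Y) X = supp_sum G (\<lambda>y. supp_sum G (\<lambda>x. f x y) X) Y"
proof -
  let ?P = "{(x, y). x \<in> X \<and> y \<in> Y \<and> f x y \<noteq> \<zero>}"
  define A B where "A = fst ` ?P" and "B = snd ` ?P"
  have AB: "finite A" "A \<subseteq> X" "finite B" "B \<subseteq> Y" unfolding A_def B_def using fin by (auto intro!: finite_imageI simp del: mem_Collect_eq)
  have zA: "f x y = \<zero>" if "x \<in> X - A" "y \<in> Y" for x y using that unfolding A_def B_def by force
  have zB: "f x y = \<zero>" if "x \<in> X" "y \<in> Y - B" for x y using that unfolding A_def B_def by force
  have sA: "supp_sum G (f x) Y = \<zero>" if "x \<in> X - A" for x
    by (rule supp_sum_zero) (rule zA[OF that])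
  have sB: "supp_sum G (\<lambda>x. f x y) X = \<zero>" if "y \<in> Y - B" for y
    by (rule supp_sum_zero) (rule zB[OF _ that])
  have cl: "supp_sum G (f x) Y \<in> carrier G" if "x \<in> X" for x using closed that by auto
  have cl': "supp_sum G (\<lambda>x. f x y) X \<in> carrier G" if "y \<in> Y" for y using closed that by auto
  have "supp_sum G (\<lambda>x. supp_sum G (f x) Y) X = finsum G (\<lambda>x. supp_sum G (f x) Y) A"
    using AB(1,2) cl by (intro supp_sum_eq_finsum) (simp_all add: Pi_iff sA)
  also have "\<dots> = finsum G (\<lambda>x. finsum G (f x) B) A"
  proof (rule finsum_cong'[OF refl])
    show "(\<lambda>x. finsum G (f x) B) \<in> A \<rightarrow> carrier G"
      using subsetD[OF AB(2)] subsetD[OF AB(4)] closed by (intro Pi_I finsum_closed) blast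
    show "supp_sum G (f x) Y = finsum G (f x) B" if "x \<in> A" for x
      using AB(3,4) subsetD[OF AB(2) that] closed zB by (intro supp_sum_eq_finsum) (simp_all add: Pi_iff)
  qed
  also have "\<dots> = finsum G (\<lambda>y. finsum G (\<lambda>x. f x y) A) B"
    using AB(1,3) subsetD[OF AB(2)] subsetD[OF AB(4)] closed by (intro finsum_swap) blast+
  also have "\<dots> = finsum G (\<lambda>y. supp_sum G (\<lambda>x. f x y) X) B"
  proof (rule finsum_cong'[OF refl])
    show "(\<lambda>y. supp_sum G (\<lambda>x. f x y) X) \<in> B \<rightarrow> carrier G"
      using subsetD[OF AB(4)] cl' by blast
    show "finsum G (\<lambda>x. f x y) A = supp_sum G (\<lambda>x. f x y) X" if "y \<in> B" for y
      using AB(1,2) subsetD[OF AB(4) that] closed zA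
      by (intro supp_sum_eq_finsum[symmetric]) (simp_all add: Pi_iff)
  qed
  also have "\<dots> = supp_sum G (\<lambda>y. supp_sum G (\<lambda>x. f x y) X) Y"
    using AB(3,4) cl' by (intro supp_sum_eq_finsum[symmetric]) (simp_all add: Pi_iff sB)
  finally show ?thesis .
qed

end

lemma (in ring) supp_sum_ldistr:
  assumes "f \<in> X \<rightarrow> carrier R" "finite {x \<in> X. f x \<noteq> \<zero>}" "a \<in> carrier R"
  shows "supp_sum R f X \<otimes> a = supp_sum R (\<lambda>x. f x \<otimes> a) X"
proof -
  let ?S = "{x \<in> X. f x \<noteq> \<zero>}"
  have "supp_sum R (\<lambda>x. f x \<otimes> a) X = finsum R (\<lambda>x. f x \<otimes> a) ?S"
    using assms by (intro supp_sum_eq_finsum) auto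
  also have "\<dots> = finsum R f ?S \<otimes> a" using assms by (intro finsum_ldistr[symmetric]) auto
  finally show ?thesis by (simp add: supp_sum_def)
qed

lemma (in ring) supp_sum_rdistr:
  assumes "f \<in> X \<rightarrow> carrier R" "finite {x \<in> X. f x \<noteq> \<zero>}" "a \<in> carrier R"
  shows "a \<otimes> supp_sum R f X = supp_sum R (\<lambda>x. a \<otimes> f x) X"
proof -
  let ?S = "{x \<in> X. f x \<noteq> \<zero>}"
  have "supp_sum R (\<lambda>x. a \<otimes> f x) X = finsum R (\<lambda>x. a \<otimes> f x) ?S"
    using assms by (intro supp_sum_eq_finsum) auto
  also have "\<dots> = a \<otimes> finsum R f ?S" using assms by (intro finsum_rdistr[symmetric]) auto
  finally show ?thesis by (simp add: supp_sum_def)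
qed

section \<open>Functions of finite support\<close>

lemma fin_suppD:
  assumes "f \<in> fin_supp X R"
  shows "x \<in> X \<Longrightarrow> f x \<in> carrier R" "finite {x \<in> X. f x \<noteq> \<zero>\<^bsub>R\<^esub>}" "x \<notin> X \<Longrightarrow> f x = undefined"
  using assms unfolding fin_supp_def by auto

lemma fin_supp_eqI:
  assumes "f \<in> fin_supp X R" "g \<in> fin_supp X R" "\<And>x. x \<in> X \<Longrightarrow> f x = g x"
  shows "f = g"
  using assms unfolding fin_supp_def by (auto intro: PiE_ext)

lemma restrict_fin_supp:
  assumes "\<And>x. x \<in> X \<Longrightarrow> f x \<in> carrier R" "finite S" "\<And>x. \<lbrakk>x \<in> X; f x \<noteq> \<zero>\<^bsub>R\<^esub>\<rbrakk> \<Longrightarrow> x \<in> S"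
  shows "restrict f X \<in> fin_supp X R"
proof -
  have "{x \<in> X. restrict f X x \<noteq> \<zero>\<^bsub>R\<^esub>} \<subseteq> S" using assms(3) by auto
  then have "finite {x \<in> X. restrict f X x \<noteq> \<zero>\<^bsub>R\<^esub>}" using assms(2) finite_subset by blast
  then show ?thesis unfolding fin_supp_def using assms(1) by simp
qed

text \<open>Stated for any record \<open>M\<close> with pointwise addition, so that it serves the
  Steinberg algebra and the group algebra alike.\<close>

lemma (in abelian_group) fin_supp_abelian_group:
  assumes carr: "carrier M = fin_supp X G" and zero: "\<zero>\<^bsub>M\<^esub> = (\<lambda>x\<in>X. \<zero>)"
    and add: "\<And>f g. f \<oplus>\<^bsub>M\<^esub> g = (\<lambda>x\<in>X. f x \<oplus> g x)"
  shows "abelian_group M"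
proof (rule abelian_groupI)
  fix f g assume fg: "f \<in> carrier M" "g \<in> carrier M"
  note fgD = fin_suppD[OF fg(1)[unfolded carr]] fin_suppD[OF fg(2)[unfolded carr]]
  show sum: "f \<oplus>\<^bsub>M\<^esub> g \<in> carrier M"
    unfolding carr add
    using fgD by (intro restrict_fin_supp[where S = "{x \<in> X. f x \<noteq> \<zero>} \<union> {x \<in> X. g x \<noteq> \<zero>}"]) auto
  show "f \<oplus>\<^bsub>M\<^esub> g = g \<oplus>\<^bsub>M\<^esub> f"
    using fgD by (auto simp: add a_comm intro!: restrict_ext)
  fix h assume h: "h \<in> carrier M"
  show "f \<oplus>\<^bsub>M\<^esub> g \<oplus>\<^bsub>M\<^esub> h = f \<oplus>\<^bsub>M\<^esub> (g \<oplus>\<^bsub>M\<^esub> h)"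
    using fgD fin_suppD[OF h[unfolded carr]] by (auto simp: add a_assoc intro!: restrict_ext)
next
  show "\<zero>\<^bsub>M\<^esub> \<in> carrier M"
    unfolding carr zero by (rule restrict_fin_supp[where S = "{}"]) auto
  fix f assume f: "f \<in> carrier M"
  note fD = fin_suppD[OF f[unfolded carr]]
  have fe: "restrict f X = f" using f unfolding carr fin_supp_def by auto
  show "\<zero>\<^bsub>M\<^esub> \<oplus>\<^bsub>M\<^esub> f = f"
    using fD by (subst (2) fe[symmetric]) (auto simp: add zero intro!: restrict_ext)
  have "\<ominus> \<zero> = \<zero>" by (intro minus_equality) simp_all
  then have "(\<lambda>x\<in>X. \<ominus> f x) \<in> carrier M"
    unfolding carr using fD by (intro restrict_fin_supp[where S = "{x \<in> X. f x \<noteq> \<zero>}"]) auto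
  moreover have "(\<lambda>x\<in>X. \<ominus> f x) \<oplus>\<^bsub>M\<^esub> f = \<zero>\<^bsub>M\<^esub>"
    using fD by (auto simp: add zero l_neg intro!: restrict_ext)
  ultimately show "\<exists>g\<in>carrier M. g \<oplus>\<^bsub>M\<^esub> f = \<zero>\<^bsub>M\<^esub>" by blast
qed

section \<open>Steinberg algebras\<close>

context groupoid
begin

abbreviation gcomp (infixl "\<cdot>" 70) where "a \<cdot> b \<equiv> composite G a b"
abbreviation ginv where "ginv a \<equiv> inverse_arrow G a"
abbreviation src where "src a \<equiv> source G a"
abbreviation trg where "trg a \<equiv> target G a"

lemmas arrow_simps = source_closed target_closed compose_closed source_compose target_compose
  ident_closed source_ident target_ident compose_ident_left compose_ident_right
  inverse_closed source_inverse target_inverse compose_inverse_left compose_inverse_right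

lemma inv_comp_cancel: "\<lbrakk>a \<in> arrows G; b \<in> arrows G; src a = trg b\<rbrakk> \<Longrightarrow> ginv a \<cdot> (a \<cdot> b) = b"
  using compose_assoc[of "ginv a" a b] by (simp add: arrow_simps)

lemma comp_inv_cancel: "\<lbrakk>a \<in> arrows G; b \<in> arrows G; trg a = trg b\<rbrakk> \<Longrightarrow> a \<cdot> (ginv a \<cdot> b) = b"
  using compose_assoc[of a "ginv a" b] by (simp add: arrow_simps)

lemma inv_comp_cancel_right: "\<lbrakk>a \<in> arrows G; b \<in> arrows G; src b = src a\<rbrakk> \<Longrightarrow> (b \<cdot> ginv a) \<cdot> a = b"
  using compose_assoc[of b "ginv a" a] by (simp add: arrow_simps) (metis arrow_simps(10))

lemma comp_inv_cancel_right: "\<lbrakk>a \<in> arrows G; b \<in> arrows G; src b = trg a\<rbrakk> \<Longrightarrow> (b \<cdot> a) \<cdot> ginv a = b"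
  using compose_assoc[of b a "ginv a"] by (simp add: arrow_simps) (metis arrow_simps(10))

lemma inv_eqI:
  assumes "a \<in> arrows G" "b \<in> arrows G" "src a = trg b" "a \<cdot> b = ident G (trg a)"
  shows "b = ginv a"
  using inv_comp_cancel[OF assms(1-3)] assms(1,4) compose_ident_right[of "ginv a"]
  by (simp add: arrow_simps)

lemma inv_inv: "a \<in> arrows G \<Longrightarrow> ginv (ginv a) = a"
  by (rule inv_eqI[symmetric]) (simp_all add: arrow_simps)

lemma inv_comp:
  assumes "a \<in> arrows G" "b \<in> arrows G" "src a = trg b"
  shows "ginv (a \<cdot> b) = ginv b \<cdot> ginv a"
proof (rule inv_eqI[symmetric])
  have "(a \<cdot> b) \<cdot> (ginv b \<cdot> ginv a) = ((a \<cdot> b) \<cdot> ginv b) \<cdot> ginv a"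
    using assms compose_assoc[of "a \<cdot> b" "ginv b" "ginv a"] by (simp add: arrow_simps)
  then show "(a \<cdot> b) \<cdot> (ginv b \<cdot> ginv a) = ident G (trg (a \<cdot> b))"
    using assms by (simp add: comp_inv_cancel_right arrow_simps)
qed (use assms in \<open>simp_all add: arrow_simps\<close>)

lemma inv_ident: "v \<in> objects G \<Longrightarrow> ginv (ident G v) = ident G v"
  using inv_eqI[of "ident G v" "ident G v"] compose_ident_left[of "ident G v"] by (simp add: arrow_simps)

end

section \<open>The convolution ring of a groupoid\<close>

locale steinberg = ring K + groupoid G
  for K :: "('k, 'l) ring_scheme" (structure) and G :: "('o, 'a, 'g) groupoid_scheme"
begin

abbreviation A where "A \<equiv> steinberg_algebra K G"

lemma steinberg_simps:
  "carrier A = fin_supp (arrows G) K"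
  "\<zero>\<^bsub>A\<^esub> = (\<lambda>c\<in>arrows G. \<zero>)"
  "f \<oplus>\<^bsub>A\<^esub> g = (\<lambda>c\<in>arrows G. f c \<oplus> g c)"
  "f \<otimes>\<^bsub>A\<^esub> g = (\<lambda>c\<in>arrows G. supp_sum K (\<lambda>a. f (c \<cdot> ginv a) \<otimes> g a) {a \<in> arrows G. src a = src c})"
  "k \<odot>\<^bsub>A\<^esub> f = (\<lambda>c\<in>arrows G. k \<otimes> f c)"
  by (simp_all add: steinberg_algebra_def)

lemma steinbergD:
  assumes "f \<in> carrier A"
  shows "a \<in> arrows G \<Longrightarrow> f a \<in> carrier K" "finite {a \<in> arrows G. f a \<noteq> \<zero>}"
  using fin_suppD[OF assms[unfolded steinberg_simps(1)]] by auto

lemma steinberg_eqI: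
  assumes "f \<in> carrier A" "g \<in> carrier A" "\<And>c. c \<in> arrows G \<Longrightarrow> f c = g c"
  shows "f = g"
  using fin_supp_eqI assms unfolding steinberg_simps(1) by blast

lemma steinberg_abelian_group: "abelian_group A"
  by (rule fin_supp_abelian_group) (simp_all add: steinberg_simps)

lemma conv_term_closed:
  assumes "f \<in> carrier A" "g \<in> carrier A" "c \<in> arrows G"
  shows "(\<lambda>a. f (c \<cdot> ginv a) \<otimes> g a) \<in> {a \<in> arrows G. src a = src c} \<rightarrow> carrier K"
  using assms steinbergD(1) by (auto simp: arrow_simps)

lemma conv_term_finite:
  assumes "f \<in> carrier A" "g \<in> carrier A" "c \<in> arrows G"
  shows "finite {a \<in> {a \<in> arrows G. src a = src c}. f (c \<cdot> ginv a) \<otimes> g a \<noteq> \<zero>}"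
  by (rule finite_subset[OF _ steinbergD(2)[OF assms(2)]])
    (use assms steinbergD(1) in \<open>auto simp: arrow_simps\<close>)

lemma conv_closed:
  assumes f: "f \<in> carrier A" and g: "g \<in> carrier A"
  shows "f \<otimes>\<^bsub>A\<^esub> g \<in> carrier A"
  unfolding steinberg_simps
proof (rule restrict_fin_supp)
  \<comment> \<open>The support of a convolution consists of products of arrows from the two
    supports, because c = (c a^-1) a.\<close>
  let ?S = "(\<lambda>(b, a). b \<cdot> a) ` ({a \<in> arrows G. f a \<noteq> \<zero>} \<times> {a \<in> arrows G. g a \<noteq> \<zero>})"
  show "finite ?S" using steinbergD(2)[OF f] steinbergD(2)[OF g] by simp
  fix c assume c: "c \<in> arrows G"
  show "supp_sum K (\<lambda>a. f (c \<cdot> ginv a) \<otimes> g a) {a \<in> arrows G. src a = src c} \<in> carrier K"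
    using conv_term_closed[OF f g c] by simp
  assume "supp_sum K (\<lambda>a. f (c \<cdot> ginv a) \<otimes> g a) {a \<in> arrows G. src a = src c} \<noteq> \<zero>"
  then obtain a where a: "a \<in> arrows G" "src a = src c" "f (c \<cdot> ginv a) \<otimes> g a \<noteq> \<zero>"
    using supp_sum_nonzero by blast
  have ca: "c \<cdot> ginv a \<in> arrows G" using a c by (simp add: arrow_simps)
  have "f (c \<cdot> ginv a) \<noteq> \<zero>" "g a \<noteq> \<zero>"
    using a ca steinbergD(1)[OF f] steinbergD(1)[OF g] by auto
  moreover have "c = (c \<cdot> ginv a) \<cdot> a" using a c by (simp add: inv_comp_cancel_right)
  ultimately show "c \<in> ?S" using a(1) ca by (intro image_eqI[of _ _ "(c \<cdot> ginv a, a)"]) auto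
qed

text \<open>At \<open>c\<close>, both sides are the sum of f(c d^-1) g(d a^-1) h(a) over all arrows
  \<open>a\<close> and \<open>d\<close> with the source of \<open>c\<close>, in opposite orders of
  summation.\<close>

lemma conv_assoc:
  assumes f: "f \<in> carrier A" and g: "g \<in> carrier A" and h: "h \<in> carrier A"
  shows "(f \<otimes>\<^bsub>A\<^esub> g) \<otimes>\<^bsub>A\<^esub> h = f \<otimes>\<^bsub>A\<^esub> (g \<otimes>\<^bsub>A\<^esub> h)"
proof (rule steinberg_eqI)
  fix c assume c: "c \<in> arrows G"
  let ?S = "{a \<in> arrows G. src a = src c}"
  define t where "t a d = f (c \<cdot> ginv d) \<otimes> (g (d \<cdot> ginv a) \<otimes> h a)" for a d
  have closed: "f (c \<cdot> ginv d) \<in> carrier K" "g (d \<cdot> ginv a) \<in> carrier K" "h a \<in> carrier K"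
    if "a \<in> ?S" "d \<in> ?S" for a d
    using that c steinbergD(1)[OF f] steinbergD(1)[OF g] steinbergD(1)[OF h] by (auto simp: arrow_simps)
  have t_closed: "t a d \<in> carrier K" if "a \<in> ?S" "d \<in> ?S" for a d
    using closed[OF that] by (simp add: t_def)
  have left: "(f \<otimes>\<^bsub>A\<^esub> g) (c \<cdot> ginv a) \<otimes> h a = supp_sum K (t a) ?S" if a: "a \<in> ?S" for a
  proof -
    let ?T = "{b \<in> arrows G. src b = src (c \<cdot> ginv a)}"
    have ca: "c \<cdot> ginv a \<in> arrows G" using a c by (simp add: arrow_simps)
    \<comment> \<open>The inner convolution runs over arrows b whose source is the target of
      \<open>a\<close>. Writing b = d a^-1 moves it to the index set \<open>?S\<close>, the same for
      every \<open>a\<close>, so that the order of summation can be exchanged.\<close>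
    have T: "?T = (\<lambda>d. d \<cdot> ginv a) ` ?S"
    proof (intro equalityI subsetI)
      fix b assume b: "b \<in> ?T"
      then have "b \<cdot> a \<in> ?S" "b = (b \<cdot> a) \<cdot> ginv a"
        using a c by (simp_all add: arrow_simps comp_inv_cancel_right)
      then show "b \<in> (\<lambda>d. d \<cdot> ginv a) ` ?S" by blast
    qed (use a c in \<open>auto simp: arrow_simps\<close>)
    have inj: "inj_on (\<lambda>d. d \<cdot> ginv a) ?S"
      by (rule inj_on_inverseI[where g = "\<lambda>b. b \<cdot> a"]) (use a c in \<open>simp add: inv_comp_cancel_right\<close>)
    have tm: "f ((c \<cdot> ginv a) \<cdot> ginv (d \<cdot> ginv a)) \<otimes> g (d \<cdot> ginv a) \<otimes> h a = t a d" if d: "d \<in> ?S" for d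
    proof -
      have "(c \<cdot> ginv a) \<cdot> (a \<cdot> ginv d) = ((c \<cdot> ginv a) \<cdot> a) \<cdot> ginv d"
        using a c d compose_assoc[of "c \<cdot> ginv a" a "ginv d"] by (simp add: arrow_simps)
      then have "(c \<cdot> ginv a) \<cdot> ginv (d \<cdot> ginv a) = c \<cdot> ginv d"
        using a c d by (simp add: inv_comp inv_inv inv_comp_cancel_right arrow_simps)
      then show ?thesis using closed[OF a d] by (simp add: t_def m_assoc)
    qed
    have "(f \<otimes>\<^bsub>A\<^esub> g) (c \<cdot> ginv a) \<otimes> h a
        = supp_sum K (\<lambda>b. f ((c \<cdot> ginv a) \<cdot> ginv b) \<otimes> g b \<otimes> h a) ?T"
      using ca supp_sum_ldistr[OF conv_term_closed[OF f g ca] conv_term_finite[OF f g ca]] closed[OF a a]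
      by (simp add: steinberg_simps)
    also have "\<dots> = supp_sum K (\<lambda>d. f ((c \<cdot> ginv a) \<cdot> ginv (d \<cdot> ginv a)) \<otimes> g (d \<cdot> ginv a) \<otimes> h a) ?S"
      unfolding T by (rule supp_sum_reindex[OF inj]) (use t_closed[OF a] tm in auto)
    also have "\<dots> = supp_sum K (t a) ?S"
      by (rule supp_sum_cong[OF refl]) (use t_closed[OF a] tm in auto)
    finally show ?thesis .
  qed
  have right: "f (c \<cdot> ginv d) \<otimes> (g \<otimes>\<^bsub>A\<^esub> h) d = supp_sum K (\<lambda>a. t a d) ?S" if d: "d \<in> ?S" for d
  proof -
    have dG: "d \<in> arrows G" and S: "{a \<in> arrows G. src a = src d} = ?S" using d by auto
    show ?thesis
      using supp_sum_rdistr[OF conv_term_closed[OF g h dG] conv_term_finite[OF g h dG] closed(1)[OF d d]] dG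
      unfolding S by (simp add: steinberg_simps S t_def)
  qed
  have "((f \<otimes>\<^bsub>A\<^esub> g) \<otimes>\<^bsub>A\<^esub> h) c = supp_sum K (\<lambda>a. (f \<otimes>\<^bsub>A\<^esub> g) (c \<cdot> ginv a) \<otimes> h a) ?S"
    using c by (simp add: steinberg_simps(4)[of "f \<otimes>\<^bsub>A\<^esub> g"])
  also have "\<dots> = supp_sum K (\<lambda>a. supp_sum K (t a) ?S) ?S"
    by (rule supp_sum_cong[OF refl left]) (use t_closed in auto)
  also have "\<dots> = supp_sum K (\<lambda>d. supp_sum K (\<lambda>a. t a d) ?S) ?S"
  proof (rule supp_sum_swap[OF _ t_closed])
    \<comment> \<open>A nonzero term has \<open>a\<close> in the support of \<open>h\<close> and d
      a^-1 in the support of \<open>g\<close>, and these two arrows determine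
      \<open>d\<close>.\<close>
    let ?P = "(\<lambda>(a, b). (a, b \<cdot> a)) ` ({a \<in> arrows G. h a \<noteq> \<zero>} \<times> {a \<in> arrows G. g a \<noteq> \<zero>})"
    have "(a, d) \<in> ?P" if ad: "a \<in> ?S" "d \<in> ?S" and nz: "t a d \<noteq> \<zero>" for a d
    proof -
      have "g (d \<cdot> ginv a) \<noteq> \<zero>" "h a \<noteq> \<zero>" using nz closed[OF ad] by (auto simp: t_def)
      moreover have "d \<cdot> ginv a \<in> arrows G" "d = (d \<cdot> ginv a) \<cdot> a"
        using ad by (simp_all add: arrow_simps inv_comp_cancel_right)
      ultimately show ?thesis using ad by (intro image_eqI[of _ _ "(a, d \<cdot> ginv a)"]) auto
    qed
    then have "{(a, d). a \<in> ?S \<and> d \<in> ?S \<and> t a d \<noteq> \<zero>} \<subseteq> ?P" by blast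
    moreover have "finite ?P" using steinbergD(2)[OF g] steinbergD(2)[OF h] by simp
    ultimately show "finite {(a, d). a \<in> ?S \<and> d \<in> ?S \<and> t a d \<noteq> \<zero>}" by (rule finite_subset)
  qed
  also have "\<dots> = supp_sum K (\<lambda>d. f (c \<cdot> ginv d) \<otimes> (g \<otimes>\<^bsub>A\<^esub> h) d) ?S"
    by (rule supp_sum_cong[OF refl right[symmetric]])
      (use closed steinbergD(1)[OF conv_closed[OF g h]] in auto)
  also have "\<dots> = (f \<otimes>\<^bsub>A\<^esub> (g \<otimes>\<^bsub>A\<^esub> h)) c"
    using c by (simp add: steinberg_simps(4)[of f "g \<otimes>\<^bsub>A\<^esub> h"])
  finally show "((f \<otimes>\<^bsub>A\<^esub> g) \<otimes>\<^bsub>A\<^esub> h) c = (f \<otimes>\<^bsub>A\<^esub> (g \<otimes>\<^bsub>A\<^esub> h)) c" .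
qed (use assms conv_closed in blast)+

lemma steinberg_rng: "rng A"
proof -
  interpret A: abelian_group A by (rule steinberg_abelian_group)
  have "(f \<oplus>\<^bsub>A\<^esub> g) \<otimes>\<^bsub>A\<^esub> h = f \<otimes>\<^bsub>A\<^esub> h \<oplus>\<^bsub>A\<^esub> g \<otimes>\<^bsub>A\<^esub> h"
    "h \<otimes>\<^bsub>A\<^esub> (f \<oplus>\<^bsub>A\<^esub> g) = h \<otimes>\<^bsub>A\<^esub> f \<oplus>\<^bsub>A\<^esub> h \<otimes>\<^bsub>A\<^esub> g"
    if fgh: "f \<in> carrier A" "g \<in> carrier A" "h \<in> carrier A" for f g h
  proof -
    note D = steinbergD(1)[OF fgh(1)] steinbergD(1)[OF fgh(2)] steinbergD(1)[OF fgh(3)]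
    show "(f \<oplus>\<^bsub>A\<^esub> g) \<otimes>\<^bsub>A\<^esub> h = f \<otimes>\<^bsub>A\<^esub> h \<oplus>\<^bsub>A\<^esub> g \<otimes>\<^bsub>A\<^esub> h"
    proof (rule steinberg_eqI)
      fix c assume c: "c \<in> arrows G"
      let ?S = "{a \<in> arrows G. src a = src c}"
      have ca: "c \<cdot> ginv a \<in> arrows G" if "a \<in> ?S" for a using that c by (simp add: arrow_simps)
      have "supp_sum K (\<lambda>a. (f \<oplus>\<^bsub>A\<^esub> g) (c \<cdot> ginv a) \<otimes> h a) ?S
          = supp_sum K (\<lambda>a. f (c \<cdot> ginv a) \<otimes> h a \<oplus> g (c \<cdot> ginv a) \<otimes> h a) ?S"
        by (rule supp_sum_cong) (use ca D in \<open>auto simp: steinberg_simps l_distr\<close>)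
      also have "\<dots> = supp_sum K (\<lambda>a. f (c \<cdot> ginv a) \<otimes> h a) ?S \<oplus> supp_sum K (\<lambda>a. g (c \<cdot> ginv a) \<otimes> h a) ?S"
        using fgh c by (intro supp_sum_addf conv_term_closed conv_term_finite)
      finally show "((f \<oplus>\<^bsub>A\<^esub> g) \<otimes>\<^bsub>A\<^esub> h) c = (f \<otimes>\<^bsub>A\<^esub> h \<oplus>\<^bsub>A\<^esub> g \<otimes>\<^bsub>A\<^esub> h) c"
        using c by (simp only: steinberg_simps(4)[of "f \<oplus>\<^bsub>A\<^esub> g"] restrict_apply if_True)
          (simp add: steinberg_simps)
    qed (use fgh conv_closed in auto)
    show "h \<otimes>\<^bsub>A\<^esub> (f \<oplus>\<^bsub>A\<^esub> g) = h \<otimes>\<^bsub>A\<^esub> f \<oplus>\<^bsub>A\<^esub> h \<otimes>\<^bsub>A\<^esub> g"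
    proof (rule steinberg_eqI)
      fix c assume c: "c \<in> arrows G"
      let ?S = "{a \<in> arrows G. src a = src c}"
      have ca: "c \<cdot> ginv a \<in> arrows G" if "a \<in> ?S" for a using that c by (simp add: arrow_simps)
      have "supp_sum K (\<lambda>a. h (c \<cdot> ginv a) \<otimes> (f \<oplus>\<^bsub>A\<^esub> g) a) ?S
          = supp_sum K (\<lambda>a. h (c \<cdot> ginv a) \<otimes> f a \<oplus> h (c \<cdot> ginv a) \<otimes> g a) ?S"
        by (rule supp_sum_cong) (use ca D in \<open>auto simp: steinberg_simps r_distr\<close>)
      also have "\<dots> = supp_sum K (\<lambda>a. h (c \<cdot> ginv a) \<otimes> f a) ?S \<oplus> supp_sum K (\<lambda>a. h (c \<cdot> ginv a) \<otimes> g a) ?S"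
        using fgh c by (intro supp_sum_addf conv_term_closed conv_term_finite)
      finally show "(h \<otimes>\<^bsub>A\<^esub> (f \<oplus>\<^bsub>A\<^esub> g)) c = (h \<otimes>\<^bsub>A\<^esub> f \<oplus>\<^bsub>A\<^esub> h \<otimes>\<^bsub>A\<^esub> g) c"
        using c by (simp only: steinberg_simps(4)[of h "f \<oplus>\<^bsub>A\<^esub> g"] restrict_apply if_True)
          (simp add: steinberg_simps)
    qed (use fgh conv_closed in auto)
  qed
  then show ?thesis
    unfolding rng_def rng_axioms_def using steinberg_abelian_group conv_closed conv_assoc by blast
qed

section \<open>Point masses on arrows\<close>

definition single :: "'a \<Rightarrow> 'k \<Rightarrow> 'a \<Rightarrow> 'k" where
  "single b k = (\<lambda>c\<in>arrows G. if c = b then k else \<zero>)"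

lemma single_closed: "k \<in> carrier K \<Longrightarrow> single b k \<in> carrier A"
  unfolding single_def steinberg_simps by (rule restrict_fin_supp[where S = "{b}"]) (auto split: if_splits)

lemma conv_single:
  assumes f: "f \<in> carrier A" and k: "k \<in> carrier K" and b: "b \<in> arrows G" and c: "c \<in> arrows G"
  shows "(f \<otimes>\<^bsub>A\<^esub> single b k) c = (if src c = src b then f (c \<cdot> ginv b) \<otimes> k else \<zero>)"
proof -
  let ?t = "\<lambda>a. f (c \<cdot> ginv a) \<otimes> single b k a"
  have eq: "(f \<otimes>\<^bsub>A\<^esub> single b k) c = supp_sum K ?t {a \<in> arrows G. src a = src c}"
    using c by (simp add: steinberg_simps)
  have closed: "?t \<in> {a \<in> arrows G. src a = src c} \<rightarrow> carrier K"
    using conv_term_closed[OF f single_closed[OF k] c] .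
  have fc: "f (c \<cdot> ginv a) \<in> carrier K" if "a \<in> arrows G" "src a = src c" for a
    using that c steinbergD(1)[OF f] by (simp add: arrow_simps)
  have zero: "?t a = \<zero>" if "a \<in> {a \<in> arrows G. src a = src c}" "a \<noteq> b" for a
    using that fc by (simp add: single_def)
  show ?thesis
  proof (cases "src c = src b")
    case True
    then have "supp_sum K ?t {a \<in> arrows G. src a = src c} = ?t b"
      using b by (intro supp_sum_single[OF _ closed zero]) auto
    moreover have "single b k b = k" using b by (simp add: single_def)
    ultimately show ?thesis using True by (simp add: eq)
  next
    case False
    then have "supp_sum K ?t {a \<in> arrows G. src a = src c} = \<zero>"
      by (intro supp_sum_zero zero) auto
    then show ?thesis using False by (simp add: eq)
  qed
qed

text \<open>The convolution sum is indexed by the right factor b, so the point mass on the left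
  selects its term through the equation c b^-1 = a. The solution is b = a^-1 c, which exists exactly
  when \<open>c\<close> and \<open>a\<close> have the same target.\<close>

lemma single_conv:
  assumes g: "g \<in> carrier A" and k: "k \<in> carrier K" and a: "a \<in> arrows G" and c: "c \<in> arrows G"
  shows "(single a k \<otimes>\<^bsub>A\<^esub> g) c = (if trg c = trg a then k \<otimes> g (ginv a \<cdot> c) else \<zero>)"
proof -
  let ?t = "\<lambda>b. single a k (c \<cdot> ginv b) \<otimes> g b"
  have eq: "(single a k \<otimes>\<^bsub>A\<^esub> g) c = supp_sum K ?t {b \<in> arrows G. src b = src c}"
    using c by (simp add: steinberg_simps)
  have closed: "?t \<in> {b \<in> arrows G. src b = src c} \<rightarrow> carrier K"
    using conv_term_closed[OF single_closed[OF k] g c] .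
  have zero: "?t b = \<zero>" if b: "b \<in> {b \<in> arrows G. src b = src c}" and ne: "c \<cdot> ginv b \<noteq> a" for b
    using b c ne steinbergD(1)[OF g] by (simp add: single_def arrow_simps)
  show ?thesis
  proof (cases "trg c = trg a")
    case True
    have "supp_sum K ?t {b \<in> arrows G. src b = src c} = ?t (ginv a \<cdot> c)"
    proof (rule supp_sum_single[OF _ closed zero])
      show "ginv a \<cdot> c \<in> {b \<in> arrows G. src b = src c}" using True a c by (simp add: arrow_simps)
      fix b assume b: "b \<in> {b \<in> arrows G. src b = src c}" "b \<noteq> ginv a \<cdot> c"
      show "c \<cdot> ginv b \<noteq> a"
      proof
        assume "c \<cdot> ginv b = a"
        then have "c = a \<cdot> b" using b c by (metis (mono_tags, lifting) inv_comp_cancel_right mem_Collect_eq)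
        moreover have "src a = trg b" using \<open>c \<cdot> ginv b = a\<close> b c by (auto simp: arrow_simps)
        ultimately show False using b a by (simp add: inv_comp_cancel)
      qed
    qed
    moreover have "c \<cdot> ginv (ginv a \<cdot> c) = a"
      using True a c by (simp add: inv_comp inv_inv arrow_simps comp_inv_cancel)
    moreover have "single a k a = k" using a by (simp add: single_def)
    ultimately show ?thesis using True by (simp add: eq)
  next
    case False
    have "c \<cdot> ginv b \<noteq> a" if "b \<in> {b \<in> arrows G. src b = src c}" for b
      using that c False by (auto simp: arrow_simps)
    then have "supp_sum K ?t {b \<in> arrows G. src b = src c} = \<zero>"
      by (intro supp_sum_zero zero) auto
    then show ?thesis using False by (simp add: eq)
  qed
qed

end

section \<open>The group algebra as a corner\<close>

lemma (in steinberg) single_apply: "c \<in> arrows G \<Longrightarrow> single b k c = (if c = b then k else \<zero>)"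
  by (simp add: single_def)

locale transitive_steinberg = steinberg K G + transitive_groupoid G
  for K :: "('k, 'l) ring_scheme" (structure) and G :: "('o, 'a, 'g) groupoid_scheme" +
  fixes u :: 'o
  assumes base: "u \<in> objects G"
begin

abbreviation H where "H \<equiv> isotropy_group G u"
abbreviation B where "B \<equiv> group_algebra K H"

lemma isotropy_simps:
  "carrier (isotropy_group G v) = {a \<in> arrows G. src a = v \<and> trg a = v}"
  "x \<otimes>\<^bsub>isotropy_group G v\<^esub> y = x \<cdot> y" "\<one>\<^bsub>isotropy_group G v\<^esub> = ident G v"
  by (simp_all add: isotropy_group_def)

lemma isotropy_group: "group H"
proof (rule groupI)
  fix x assume x: "x \<in> carrier H"
  show "\<one>\<^bsub>H\<^esub> \<otimes>\<^bsub>H\<^esub> x = x" using x compose_ident_left[of x] by (simp add: isotropy_simps)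
  show "\<exists>y\<in>carrier H. y \<otimes>\<^bsub>H\<^esub> x = \<one>\<^bsub>H\<^esub>"
    using x by (intro bexI[of _ "ginv x"]) (auto simp: isotropy_simps arrow_simps)
qed (use base in \<open>auto simp: isotropy_simps arrow_simps compose_assoc\<close>)

lemma isotropy_inv: "y \<in> carrier H \<Longrightarrow> inv\<^bsub>H\<^esub> y = ginv y"
  by (rule group.inv_equality[OF isotropy_group]) (auto simp: isotropy_simps arrow_simps)

lemma group_algebra_simps:
  "carrier B = fin_supp (carrier H) K"
  "\<zero>\<^bsub>B\<^esub> = (\<lambda>x\<in>carrier H. \<zero>)"
  "f \<oplus>\<^bsub>B\<^esub> g = (\<lambda>x\<in>carrier H. f x \<oplus> g x)"
  "k \<odot>\<^bsub>B\<^esub> f = (\<lambda>x\<in>carrier H. k \<otimes> f x)"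
  by (simp_all add: group_algebra_def)

lemma group_algebraD:
  assumes "f \<in> carrier B"
  shows "x \<in> carrier H \<Longrightarrow> f x \<in> carrier K" "finite {x \<in> carrier H. f x \<noteq> \<zero>}"
  using fin_suppD[OF assms[unfolded group_algebra_simps(1)]] by auto

lemma group_algebra_eqI:
  assumes "f \<in> carrier B" "g \<in> carrier B" "\<And>x. x \<in> carrier H \<Longrightarrow> f x = g x"
  shows "f = g"
  using fin_supp_eqI assms unfolding group_algebra_simps(1) by blast

lemma group_algebra_mult:
  assumes "f \<in> carrier B" "g \<in> carrier B" "x \<in> carrier H"
  shows "(f \<otimes>\<^bsub>B\<^esub> g) x = supp_sum K (\<lambda>y. f (x \<cdot> ginv y) \<otimes> g y) (carrier H)"
proof -
  have "x \<cdot> ginv y \<in> carrier H" if "y \<in> carrier H" for y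
    using that assms(3) by (simp add: isotropy_simps arrow_simps)
  then have "supp_sum K (\<lambda>y. f (x \<otimes>\<^bsub>H\<^esub> inv\<^bsub>H\<^esub> y) \<otimes> g y) (carrier H) = supp_sum K (\<lambda>y. f (x \<cdot> ginv y) \<otimes> g y) (carrier H)"
    using assms group_algebraD(1) by (intro supp_sum_cong) (auto simp: isotropy_inv isotropy_simps(2))
  then show ?thesis using assms(3) by (simp add: group_algebra_def)
qed

lemma group_algebra_abelian_group: "abelian_group B"
  by (rule fin_supp_abelian_group) (simp_all add: group_algebra_simps)

definition emb :: "('a \<Rightarrow> 'k) \<Rightarrow> 'a \<Rightarrow> 'k" where
  "emb f = (\<lambda>c\<in>arrows G. if c \<in> carrier H then f c else \<zero>)"

lemma emb_apply: "c \<in> arrows G \<Longrightarrow> emb f c = (if src c = u \<and> trg c = u then f c else \<zero>)"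
  by (simp add: emb_def isotropy_simps)

lemma isotropy_arrows: "x \<in> carrier H \<Longrightarrow> x \<in> arrows G"
  by (simp add: isotropy_simps)

lemma emb_closed: "f \<in> carrier B \<Longrightarrow> emb f \<in> carrier A"
  unfolding emb_def steinberg_simps(1)
  by (rule restrict_fin_supp[where S = "{x \<in> carrier H. f x \<noteq> \<zero>}"])
    (auto simp: group_algebraD split: if_splits)

lemma emb_add: "emb (f \<oplus>\<^bsub>B\<^esub> g) = emb f \<oplus>\<^bsub>A\<^esub> emb g"
  by (auto simp: emb_def steinberg_simps(3) group_algebra_simps(3) intro!: restrict_ext)

lemma emb_inj: "inj_on emb (carrier B)"
proof (rule inj_onI)
  fix f g assume fg: "f \<in> carrier B" "g \<in> carrier B" and eq: "emb f = emb g"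
  have "f x = g x" if "x \<in> carrier H" for x
    using fun_cong[OF eq, of x] that isotropy_arrows by (simp add: emb_def)
  then show "f = g" using fg by (intro group_algebra_eqI)
qed

lemma restrict_isotropy_closed: "F \<in> carrier A \<Longrightarrow> restrict F (carrier H) \<in> carrier B"
  unfolding group_algebra_simps(1)
  by (rule restrict_fin_supp[where S = "{a \<in> arrows G. F a \<noteq> \<zero>}"])
    (auto simp: steinbergD isotropy_arrows)

text \<open>A nonzero term needs both \<open>a\<close> and c a^-1 to be loops at \<open>u\<close>,
  which makes \<open>c\<close> such a loop; then only loops contribute and the sum is the one in the
  group algebra. The claim is pointwise because closure of \<open>B\<close> under products is itself
  deduced from it.\<close>

lemma emb_conv:
  assumes f: "f \<in> carrier B" and g: "g \<in> carrier B" and c: "c \<in> arrows G"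
  shows "(emb f \<otimes>\<^bsub>A\<^esub> emb g) c = (if c \<in> carrier H then (f \<otimes>\<^bsub>B\<^esub> g) c else \<zero>)"
proof -
  let ?t = "\<lambda>a. emb f (c \<cdot> ginv a) \<otimes> emb g a" and ?S = "{a \<in> arrows G. src a = src c}"
  have eq: "(emb f \<otimes>\<^bsub>A\<^esub> emb g) c = supp_sum K ?t ?S" using c by (simp add: steinberg_simps)
  have ca: "c \<cdot> ginv a \<in> arrows G" if "a \<in> ?S" for a using that c by (simp add: arrow_simps)
  have zero: "?t a = \<zero>" if a: "a \<in> ?S" "a \<notin> carrier H" for a
    using a ca[OF a(1)] steinbergD(1)[OF emb_closed[OF f]] by (simp add: emb_def)
  show ?thesis
  proof (cases "c \<in> carrier H")
    case True
    then have sub: "carrier H \<subseteq> ?S" by (auto simp: isotropy_simps)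
    have "supp_sum K ?t ?S = supp_sum K ?t (carrier H)"
      by (rule supp_sum_superset[OF sub]) (use zero in auto)
    also have "\<dots> = supp_sum K (\<lambda>y. f (c \<cdot> ginv y) \<otimes> g y) (carrier H)"
    proof (rule supp_sum_cong[OF refl])
      have cy: "c \<cdot> ginv y \<in> carrier H" if "y \<in> carrier H" for y
        using that True by (simp add: isotropy_simps arrow_simps)
      then show "?t y = f (c \<cdot> ginv y) \<otimes> g y" if "y \<in> carrier H" for y
        using that isotropy_arrows by (simp add: emb_def)
      show "(\<lambda>y. f (c \<cdot> ginv y) \<otimes> g y) \<in> carrier H \<rightarrow> carrier K"
        using cy group_algebraD(1)[OF f] group_algebraD(1)[OF g] by simp
    qed
    finally show ?thesis using True f g by (simp add: eq group_algebra_mult)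
  next
    case False
    have "?t a = \<zero>" if a: "a \<in> ?S" for a
    proof (cases "a \<in> carrier H")
      case True
      then have "src c = u" using a by (simp add: isotropy_simps)
      with False c have "trg c \<noteq> u" by (simp add: isotropy_simps)
      then have "c \<cdot> ginv a \<notin> carrier H" using True a c by (simp add: isotropy_simps arrow_simps)
      then show ?thesis using ca[OF a] a steinbergD(1)[OF emb_closed[OF g]] by (simp add: emb_def)
    qed (use zero a in blast)
    then have "supp_sum K ?t ?S = \<zero>" by (rule supp_sum_zero)
    then show ?thesis using False by (simp add: eq)
  qed
qed

lemma group_algebra_mult_closed:
  assumes "f \<in> carrier B" "g \<in> carrier B"
  shows "f \<otimes>\<^bsub>B\<^esub> g \<in> carrier B"
proof -
  have "f \<otimes>\<^bsub>B\<^esub> g = restrict (emb f \<otimes>\<^bsub>A\<^esub> emb g) (carrier H)"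
  proof
    fix x show "(f \<otimes>\<^bsub>B\<^esub> g) x = restrict (emb f \<otimes>\<^bsub>A\<^esub> emb g) (carrier H) x"
      using assms by (cases "x \<in> carrier H") (simp_all add: emb_conv isotropy_arrows, simp add: group_algebra_def)
  qed
  then show ?thesis using restrict_isotropy_closed conv_closed emb_closed assms by simp
qed

lemma emb_mult:
  assumes "f \<in> carrier B" "g \<in> carrier B"
  shows "emb (f \<otimes>\<^bsub>B\<^esub> g) = emb f \<otimes>\<^bsub>A\<^esub> emb g"
proof (rule steinberg_eqI)
  fix c assume "c \<in> arrows G"
  then show "emb (f \<otimes>\<^bsub>B\<^esub> g) c = (emb f \<otimes>\<^bsub>A\<^esub> emb g) c"
    using assms by (simp add: emb_conv) (simp add: emb_def)
qed (use assms emb_closed group_algebra_mult_closed conv_closed in auto)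

text \<open>The ring laws are inherited from the Steinberg algebra along the injective map
  \<open>emb\<close>.\<close>

lemma group_algebra_rng: "rng B"
proof -
  interpret A: rng A by (rule steinberg_rng)
  interpret B: abelian_group B by (rule group_algebra_abelian_group)
  note inj = inj_onD[OF emb_inj] and cl = group_algebra_mult_closed B.a_closed
  show ?thesis
    unfolding rng_def rng_axioms_def
  proof (intro conjI allI impI B.abelian_group_axioms)
    fix x y z assume xyz: "x \<in> carrier B" "y \<in> carrier B" "z \<in> carrier B"
    show "x \<otimes>\<^bsub>B\<^esub> y \<otimes>\<^bsub>B\<^esub> z = x \<otimes>\<^bsub>B\<^esub> (y \<otimes>\<^bsub>B\<^esub> z)"
      by (rule inj) (use xyz in \<open>simp_all add: emb_mult cl emb_closed A.m_assoc\<close>)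
    show "(x \<oplus>\<^bsub>B\<^esub> y) \<otimes>\<^bsub>B\<^esub> z = x \<otimes>\<^bsub>B\<^esub> z \<oplus>\<^bsub>B\<^esub> y \<otimes>\<^bsub>B\<^esub> z"
      by (rule inj) (use xyz in \<open>simp_all add: emb_mult emb_add cl emb_closed A.l_distr\<close>)
    show "z \<otimes>\<^bsub>B\<^esub> (x \<oplus>\<^bsub>B\<^esub> y) = z \<otimes>\<^bsub>B\<^esub> x \<oplus>\<^bsub>B\<^esub> z \<otimes>\<^bsub>B\<^esub> y"
      by (rule inj) (use xyz in \<open>simp_all add: emb_mult emb_add cl emb_closed A.r_distr\<close>)
  qed (rule group_algebra_mult_closed)
qed

section \<open>The full idempotent at the base object\<close>

abbreviation e where "e \<equiv> single (ident G u) \<one>"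

lemma e_closed: "e \<in> carrier A"
  by (simp add: single_closed)

lemma e_conv:
  assumes "f \<in> carrier A" "c \<in> arrows G"
  shows "(e \<otimes>\<^bsub>A\<^esub> f) c = (if trg c = u then f c else \<zero>)"
  using assms base steinbergD(1)[OF assms] compose_ident_left[OF assms(2)]
  by (auto simp: single_conv arrow_simps inv_ident)

lemma conv_e:
  assumes "f \<in> carrier A" "c \<in> arrows G"
  shows "(f \<otimes>\<^bsub>A\<^esub> e) c = (if src c = u then f c else \<zero>)"
  using assms base steinbergD(1)[OF assms] compose_ident_right[OF assms(2)]
  by (auto simp: conv_single arrow_simps inv_ident)

text \<open>By transitivity there is an arrow p from \<open>u\<close> to the source of
  \<open>a\<close>, and \<open>a\<close> factors through \<open>u\<close> as (a p) p^-1. The point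
  mass at p^-1 is unchanged by \<open>e\<close> on the left, so it lies in \<open>I\<close>;
  multiplying it by k times the point mass at a p gives the claim.\<close>

lemma single_in_ideal:
  assumes I: "rng_ideal I A" and e: "e \<in> I" and a: "a \<in> arrows G" and k: "k \<in> carrier K"
  shows "single a k \<in> I"
proof -
  interpret I: rng_ideal I A by fact
  obtain p where p: "p \<in> arrows G" "src p = u" "trg p = src a"
    using transitive base a source_closed by metis
  let ?q = "single (ginv p) \<one>"
  have eq: "e \<otimes>\<^bsub>A\<^esub> ?q = ?q"
  proof (rule steinberg_eqI)
    fix c assume c: "c \<in> arrows G"
    show "(e \<otimes>\<^bsub>A\<^esub> ?q) c = ?q c"
      using c p by (auto simp: e_conv single_closed single_apply arrow_simps)
  qed (use conv_closed single_closed in auto)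
  have "e \<otimes>\<^bsub>A\<^esub> ?q \<in> I" using I.I_r_closed[OF e] single_closed by simp
  then have "?q \<in> I" by (simp only: eq)
  then have "single (a \<cdot> p) k \<otimes>\<^bsub>A\<^esub> ?q \<in> I" using I.I_l_closed single_closed[OF k] by simp
  moreover have "single (a \<cdot> p) k \<otimes>\<^bsub>A\<^esub> ?q = single a k"
  proof (rule steinberg_eqI)
    fix c assume c: "c \<in> arrows G"
    have "ginv (a \<cdot> p) \<cdot> c = ginv p \<longleftrightarrow> c = a" if t: "trg c = trg a"
    proof
      assume *: "ginv (a \<cdot> p) \<cdot> c = ginv p"
      have "c = (a \<cdot> p) \<cdot> (ginv (a \<cdot> p) \<cdot> c)" using t a p c by (simp add: comp_inv_cancel arrow_simps)
      then show "c = a" using a p by (simp add: * comp_inv_cancel_right)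
    next
      assume "c = a"
      then show "ginv (a \<cdot> p) \<cdot> c = ginv p"
        using a p by (simp add: inv_comp compose_assoc arrow_simps) (metis p target_inverse source_inverse compose_ident_right inverse_closed p)
    qed
    moreover have "ginv (a \<cdot> p) \<cdot> c \<in> arrows G" if "trg c = trg a" using that a p c by (simp add: arrow_simps)
    ultimately show "(single (a \<cdot> p) k \<otimes>\<^bsub>A\<^esub> ?q) c = single a k c"
      using a p c k by (auto simp: single_conv single_closed single_apply arrow_simps)
  qed (use k conv_closed single_closed in auto)
  ultimately show ?thesis by simp
qed

lemma e_full:
  assumes I: "rng_ideal I A" and e: "e \<in> I"
  shows "I = carrier A"
proof -
  interpret A: rng A by (rule steinberg_rng)
  interpret I: rng_ideal I A by fact
  \<comment> \<open>Induction on a finite set containing the support, splitting off one point mass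
    at a time; members of the set that are not arrows are discarded.\<close>
  have "f \<in> I" if "finite S" "f \<in> carrier A" "{a \<in> arrows G. f a \<noteq> \<zero>} \<subseteq> S" for S f
    using that
  proof (induction S arbitrary: f rule: finite_induct)
    case empty
    then have "f = \<zero>\<^bsub>A\<^esub>"
      using A.zero_closed by (intro steinberg_eqI) (auto simp: steinberg_simps(2))
    then show ?case by simp
  next
    case (insert a S)
    show ?case
    proof (cases "a \<in> arrows G")
      case True
      define f' where "f' = (\<lambda>c\<in>arrows G. if c = a then \<zero> else f c)"
      have f': "f' \<in> carrier A"
        unfolding f'_def steinberg_simps(1) using insert.hyps(1) insert.prems steinbergD(1)
        by (intro restrict_fin_supp[where S = "insert a S"]) auto
      have "{c \<in> arrows G. f' c \<noteq> \<zero>} \<subseteq> S"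
        using insert.prems(2) by (auto simp: f'_def split: if_splits)
      then have "f' \<in> I" using f' by (rule insert.IH[rotated])
      moreover have fa: "f a \<in> carrier K" using insert.prems True steinbergD(1) by blast
      moreover have "f = single a (f a) \<oplus>\<^bsub>A\<^esub> f'"
      proof (rule steinberg_eqI)
        fix c assume c: "c \<in> arrows G"
        then have "f' c = (if c = a then \<zero> else f c)" by (simp add: f'_def)
        then show "f c = (single a (f a) \<oplus>\<^bsub>A\<^esub> f') c"
          using c steinbergD(1)[OF insert.prems(1) c] by (auto simp: steinberg_simps(3) single_apply)
      qed (use insert.prems(1) single_closed[OF fa] f' in auto)
      ultimately show ?thesis using single_in_ideal[OF I e True fa] I.a_closed by metis
    next
      case False
      then show ?thesis using insert by blast
    qed
  qed
  then have "carrier A \<subseteq> I" using steinbergD(2) by blast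
  then show ?thesis using I.a_subset by blast
qed

text \<open>Multiplication by \<open>e\<close> on the left keeps the arrows with target
  \<open>u\<close>, on the right those with source \<open>u\<close>. So e f e is \<open>f\<close>
  cut down to the loops at \<open>u\<close>, and its preimage in the group algebra is the
  restriction of \<open>f\<close>.\<close>

lemma full_corner_group_algebra: "full_corner A B emb e"
proof (intro full_corner.intro full_corner_axioms.intro steinberg_rng group_algebra_rng e_closed emb_closed
    emb_add emb_mult emb_inj e_full)
  show "e \<otimes>\<^bsub>A\<^esub> e = e"
  proof (rule steinberg_eqI)
    fix c assume "c \<in> arrows G"
    then show "(e \<otimes>\<^bsub>A\<^esub> e) c = e c" using base by (auto simp: e_conv e_closed single_apply arrow_simps)
  qed (use conv_closed e_closed in auto)
  fix f
  show "e \<otimes>\<^bsub>A\<^esub> emb f = emb f" if f: "f \<in> carrier B"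
    by (rule steinberg_eqI)
      (use f emb_closed conv_closed e_closed in \<open>auto simp: e_conv emb_apply\<close>)
  show "emb f \<otimes>\<^bsub>A\<^esub> e = emb f" if f: "f \<in> carrier B"
    by (rule steinberg_eqI)
      (use f emb_closed conv_closed e_closed in \<open>auto simp: conv_e emb_apply\<close>)
  show "\<exists>c\<in>carrier B. emb c = e \<otimes>\<^bsub>A\<^esub> (f \<otimes>\<^bsub>A\<^esub> e)" if f: "f \<in> carrier A"
  proof (intro bexI[of _ "restrict f (carrier H)"] restrict_isotropy_closed[OF f])
    show "emb (restrict f (carrier H)) = e \<otimes>\<^bsub>A\<^esub> (f \<otimes>\<^bsub>A\<^esub> e)"
    proof (rule steinberg_eqI)
      fix c assume "c \<in> arrows G"
      then show "emb (restrict f (carrier H)) c = (e \<otimes>\<^bsub>A\<^esub> (f \<otimes>\<^bsub>A\<^esub> e)) c"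
        using f e_closed conv_closed by (auto simp: e_conv conv_e emb_apply isotropy_simps)
    qed (use f e_closed conv_closed emb_closed restrict_isotropy_closed in auto)
  qed
qed

end

text \<open>The sum in \<open>M\<close> runs over the k with F k nonzero, a set that may be larger
  than the support of the values at \<open>y\<close>; the extra terms are zero at \<open>y\<close>.
  This evaluates an entry of a matrix product at a group element.\<close>

lemma supp_sum_fin_supp_apply:
  assumes R: "abelian_group R" and M: "abelian_group M"
    and carr: "carrier M = fin_supp Y R" and zero: "\<zero>\<^bsub>M\<^esub> = (\<lambda>y\<in>Y. \<zero>\<^bsub>R\<^esub>)"
    and add: "\<And>f g. f \<oplus>\<^bsub>M\<^esub> g = (\<lambda>y\<in>Y. f y \<oplus>\<^bsub>R\<^esub> g y)"
    and F: "F \<in> X \<rightarrow> carrier M" "finite {k \<in> X. F k \<noteq> \<zero>\<^bsub>M\<^esub>}" and y: "y \<in> Y"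
  shows "supp_sum M F X y = supp_sum R (\<lambda>k. F k y) X"
proof -
  interpret R: abelian_group R by fact
  interpret M: abelian_group M by fact
  have closed: "f y \<in> carrier R" if "f \<in> carrier M" for f
    using that y fin_suppD(1) unfolding carr by metis
  have "finsum M F S y = finsum R (\<lambda>k. F k y) S" if "finite S" "S \<subseteq> X" for S
    using that
  proof (induction S rule: finite_induct)
    case empty
    then show ?case using y by (simp add: zero)
  next
    case (insert k S)
    have "finsum M F (insert k S) = F k \<oplus>\<^bsub>M\<^esub> finsum M F S"
      using insert F(1) by (intro M.finsum_insert) auto
    moreover have "finsum R (\<lambda>k. F k y) (insert k S) = F k y \<oplus>\<^bsub>R\<^esub> finsum R (\<lambda>k. F k y) S"
      using insert F(1) closed by (intro R.finsum_insert) auto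
    ultimately show ?case using insert y by (simp add: add)
  qed
  moreover have "supp_sum R (\<lambda>k. F k y) X = finsum R (\<lambda>k. F k y) {k \<in> X. F k \<noteq> \<zero>\<^bsub>M\<^esub>}"
  proof (rule R.supp_sum_eq_finsum)
    show "F k y = \<zero>\<^bsub>R\<^esub>" if "k \<in> X - {k \<in> X. F k \<noteq> \<zero>\<^bsub>M\<^esub>}" for k
      using that y by (simp add: zero)
  qed (use F closed in auto)
  ultimately show ?thesis using F(2) by (simp add: supp_sum_def)
qed

section \<open>The isomorphism with the matrix ring\<close>

context transitive_steinberg
begin

abbreviation M where "M \<equiv> matrix_algebra (objects G) B"

lemma matrix_simps:
  "carrier M = fin_supp (objects G \<times> objects G) B"
  "\<Phi> \<otimes>\<^bsub>M\<^esub> \<Psi> = (\<lambda>(v, w)\<in>objects G \<times> objects G. supp_sum B (\<lambda>k. \<Phi> (v, k) \<otimes>\<^bsub>B\<^esub> \<Psi> (k, w)) (objects G))"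
  "\<Phi> \<oplus>\<^bsub>M\<^esub> \<Psi> = (\<lambda>p\<in>objects G \<times> objects G. \<Phi> p \<oplus>\<^bsub>B\<^esub> \<Psi> p)"
  "k \<odot>\<^bsub>M\<^esub> \<Phi> = (\<lambda>p\<in>objects G \<times> objects G. k \<odot>\<^bsub>B\<^esub> \<Phi> p)"
  by (simp_all add: matrix_algebra_def)

definition path :: "'o \<Rightarrow> 'a" where
  "path v = (SOME a. a \<in> arrows G \<and> src a = u \<and> trg a = v)"

lemma path:
  assumes "v \<in> objects G"
  shows "path v \<in> arrows G" "src (path v) = u" "trg (path v) = v"
proof -
  have "\<exists>a. a \<in> arrows G \<and> src a = u \<and> trg a = v" using transitive[OF base assms] by blast
  from someI_ex[OF this] show "path v \<in> arrows G" "src (path v) = u" "trg (path v) = v"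
    unfolding path_def by auto
qed

text \<open>Conjugation with the chosen paths identifies \<open>arrows G\<close> with
  \<open>objects G \<times> objects G \<times> carrier H\<close>.\<close>

definition transport :: "'o \<Rightarrow> 'o \<Rightarrow> 'a \<Rightarrow> 'a" where
  "transport v w x = path v \<cdot> (x \<cdot> ginv (path w))"

definition loop :: "'a \<Rightarrow> 'a" where
  "loop a = ginv (path (trg a)) \<cdot> (a \<cdot> path (src a))"

lemma transport:
  assumes "v \<in> objects G" "w \<in> objects G" "x \<in> carrier H"
  shows "transport v w x \<in> arrows G" "src (transport v w x) = w" "trg (transport v w x) = v"
    "loop (transport v w x) = x"
proof -
  have x: "x \<in> arrows G" "src x = u" "trg x = u" using assms(3) by (auto simp: isotropy_simps)
  note p = path[OF assms(1)] path[OF assms(2)]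
  show t: "transport v w x \<in> arrows G" "src (transport v w x) = w" "trg (transport v w x) = v"
    using x p by (simp_all add: transport_def arrow_simps)
  have "(path v \<cdot> (x \<cdot> ginv (path w))) \<cdot> path w = path v \<cdot> ((x \<cdot> ginv (path w)) \<cdot> path w)"
    using x p by (intro compose_assoc) (simp_all add: arrow_simps)
  also have "\<dots> = path v \<cdot> x" using x p by (simp add: inv_comp_cancel_right)
  finally show "loop (transport v w x) = x"
    using x p t by (simp add: loop_def) (simp add: transport_def inv_comp_cancel)
qed

lemma loop:
  assumes "a \<in> arrows G"
  shows "loop a \<in> carrier H" "transport (trg a) (src a) (loop a) = a"
proof -
  note p = path[OF target_closed[OF assms]] path[OF source_closed[OF assms]]
  show "loop a \<in> carrier H" using assms p by (simp add: loop_def isotropy_simps arrow_simps)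
  have "(ginv (path (trg a)) \<cdot> (a \<cdot> path (src a))) \<cdot> ginv (path (src a))
      = ginv (path (trg a)) \<cdot> ((a \<cdot> path (src a)) \<cdot> ginv (path (src a)))"
    using assms p by (intro compose_assoc) (simp_all add: arrow_simps)
  also have "\<dots> = ginv (path (trg a)) \<cdot> a" using assms p by (simp add: comp_inv_cancel_right)
  finally show "transport (trg a) (src a) (loop a) = a"
    using assms p by (simp add: transport_def loop_def comp_inv_cancel)
qed

text \<open>The path to \<open>w\<close> cancels, which takes the entry (v, w) to (v, k): the left
  partner of (k, w) in a matrix product. The proof multiplies the right-hand side by
  \<open>transport k w y\<close> and then cancels, so that no inverse of a threefold product has to
  be expanded.\<close>

lemma transport_comp_inv:
  assumes "v \<in> objects G" "w \<in> objects G" "k \<in> objects G" "x \<in> carrier H" "y \<in> carrier H"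
  shows "transport v w x \<cdot> ginv (transport k w y) = transport v k (x \<cdot> ginv y)"
proof -
  have xy: "x \<in> arrows G" "src x = u" "trg x = u" "y \<in> arrows G" "src y = u" "trg y = u"
    using assms(4,5) by (auto simp: isotropy_simps)
  note p = path[OF assms(1)] path[OF assms(2)] path[OF assms(3)]
  have xyH: "x \<cdot> ginv y \<in> carrier H" using xy by (simp add: isotropy_simps arrow_simps)
  have "transport v k (x \<cdot> ginv y) \<cdot> transport k w y
      = path v \<cdot> ((x \<cdot> ginv y) \<cdot> (ginv (path k) \<cdot> (path k \<cdot> (y \<cdot> ginv (path w)))))"
    using xy p by (simp add: transport_def compose_assoc arrow_simps)
  also have "\<dots> = path v \<cdot> ((x \<cdot> ginv y) \<cdot> (y \<cdot> ginv (path w)))"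
    using xy p by (simp add: inv_comp_cancel arrow_simps)
  also have "(x \<cdot> ginv y) \<cdot> (y \<cdot> ginv (path w)) = ((x \<cdot> ginv y) \<cdot> y) \<cdot> ginv (path w)"
    using xy p by (intro compose_assoc[symmetric]) (simp_all add: arrow_simps)
  also have "(x \<cdot> ginv y) \<cdot> y = x" using xy by (simp add: inv_comp_cancel_right)
  finally have "transport v k (x \<cdot> ginv y) \<cdot> transport k w y = transport v w x"
    by (simp add: transport_def)
  then show ?thesis
    using comp_inv_cancel_right[of "transport k w y" "transport v k (x \<cdot> ginv y)"]
      transport[OF assms(3,2,5)] transport[OF assms(1,3) xyH] by simp
qed

text \<open>Rows are indexed by targets and columns by sources: a product of arrows is defined when
  the source of the left one is the target of the right one, which is the matching of inner indices
  in a matrix product.\<close>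

definition to_matrix :: "('a \<Rightarrow> 'k) \<Rightarrow> 'o \<times> 'o \<Rightarrow> 'a \<Rightarrow> 'k" where
  "to_matrix f = (\<lambda>(v, w)\<in>objects G \<times> objects G. \<lambda>x\<in>carrier H. f (transport v w x))"

definition of_matrix :: "('o \<times> 'o \<Rightarrow> 'a \<Rightarrow> 'k) \<Rightarrow> 'a \<Rightarrow> 'k" where
  "of_matrix \<Phi> = (\<lambda>a\<in>arrows G. \<Phi> (trg a, src a) (loop a))"

lemma to_matrix_entry_closed:
  assumes f: "f \<in> carrier A" and vw: "v \<in> objects G" "w \<in> objects G"
  shows "to_matrix f (v, w) \<in> carrier B"
proof -
  have "(\<lambda>x\<in>carrier H. f (transport v w x)) \<in> carrier B"
    unfolding group_algebra_simps(1)
  proof (rule restrict_fin_supp[where S = "loop ` {a \<in> arrows G. f a \<noteq> \<zero>}"])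
    fix x assume x: "x \<in> carrier H"
    show "f (transport v w x) \<in> carrier K" using transport[OF vw x] steinbergD(1)[OF f] by simp
    assume "f (transport v w x) \<noteq> \<zero>"
    then show "x \<in> loop ` {a \<in> arrows G. f a \<noteq> \<zero>}"
      using transport[OF vw x] by (intro image_eqI[of _ _ "transport v w x"]) auto
  qed (use steinbergD(2)[OF f] in simp)
  then show ?thesis using vw by (simp add: to_matrix_def)
qed

lemma to_matrix_closed:
  assumes f: "f \<in> carrier A"
  shows "to_matrix f \<in> carrier M"
proof -
  have "to_matrix f = restrict (to_matrix f) (objects G \<times> objects G)"
    by (simp add: to_matrix_def)
  also have "\<dots> \<in> fin_supp (objects G \<times> objects G) B"
  proof (rule restrict_fin_supp[where S = "(\<lambda>a. (trg a, src a)) ` {a \<in> arrows G. f a \<noteq> \<zero>}"])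
    fix p assume p: "p \<in> objects G \<times> objects G"
    then obtain v w where vw: "v \<in> objects G" "w \<in> objects G" "p = (v, w)" by auto
    show "to_matrix f p \<in> carrier B" using to_matrix_entry_closed[OF f] vw by simp
    assume nz: "to_matrix f p \<noteq> \<zero>\<^bsub>B\<^esub>"
    have "\<exists>x\<in>carrier H. f (transport v w x) \<noteq> \<zero>"
    proof (rule ccontr)
      assume "\<not> (\<exists>x\<in>carrier H. f (transport v w x) \<noteq> \<zero>)"
      then have "to_matrix f p = \<zero>\<^bsub>B\<^esub>"
        using vw by (auto simp: to_matrix_def group_algebra_simps(2) intro!: restrict_ext)
      then show False using nz by blast
    qed
    then obtain x where x: "x \<in> carrier H" "f (transport v w x) \<noteq> \<zero>" by blast
    then show "p \<in> (\<lambda>a. (trg a, src a)) ` {a \<in> arrows G. f a \<noteq> \<zero>}"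
      using transport[OF vw(1,2) x(1)] vw(3) by (intro image_eqI[of _ _ "transport v w x"]) auto
  qed (use steinbergD(2)[OF f] in simp)
  finally show ?thesis by (simp add: matrix_simps(1))
qed

lemma of_matrix_closed:
  assumes "\<Phi> \<in> carrier M"
  shows "of_matrix \<Phi> \<in> carrier A"
proof -
  note \<Phi> = fin_suppD[OF assms[unfolded matrix_simps(1)]]
  let ?P = "{p \<in> objects G \<times> objects G. \<Phi> p \<noteq> \<zero>\<^bsub>B\<^esub>}"
  let ?S = "\<Union>p\<in>?P. transport (fst p) (snd p) ` {x \<in> carrier H. \<Phi> p x \<noteq> \<zero>}"
  show ?thesis
    unfolding of_matrix_def steinberg_simps(1)
  proof (rule restrict_fin_supp[where S = ?S])
    show "finite ?S" using \<Phi> group_algebraD(2) by (intro finite_UN_I finite_imageI) auto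
    fix a assume a: "a \<in> arrows G"
    have p: "(trg a, src a) \<in> objects G \<times> objects G" using a by (simp add: arrow_simps)
    show "\<Phi> (trg a, src a) (loop a) \<in> carrier K" using group_algebraD(1)[OF \<Phi>(1)[OF p]] loop[OF a] by simp
    assume nz: "\<Phi> (trg a, src a) (loop a) \<noteq> \<zero>"
    then have "\<Phi> (trg a, src a) \<noteq> \<zero>\<^bsub>B\<^esub>" using loop[OF a] by (auto simp: group_algebra_simps(2))
    then show "a \<in> ?S"
      using p nz loop[OF a] by (intro UN_I[of "(trg a, src a)"] image_eqI[of _ _ "loop a"]) auto
  qed
qed

lemma bij_to_matrix: "bij_betw to_matrix (carrier A) (carrier M)"
proof (rule bij_betw_byWitness[where f' = of_matrix])
  show "\<forall>f\<in>carrier A. of_matrix (to_matrix f) = f"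
  proof
    fix f assume f: "f \<in> carrier A"
    show "of_matrix (to_matrix f) = f"
    proof (rule steinberg_eqI)
      fix a assume "a \<in> arrows G"
      then show "of_matrix (to_matrix f) a = f a"
        using loop[of a] by (simp add: of_matrix_def to_matrix_def source_closed target_closed)
    qed (use f to_matrix_closed of_matrix_closed in auto)
  qed
  show "\<forall>\<Phi>\<in>carrier M. to_matrix (of_matrix \<Phi>) = \<Phi>"
  proof
    fix \<Phi> assume \<Phi>: "\<Phi> \<in> carrier M"
    show "to_matrix (of_matrix \<Phi>) = \<Phi>"
    proof (rule fin_supp_eqI)
      show "to_matrix (of_matrix \<Phi>) \<in> fin_supp (objects G \<times> objects G) B" "\<Phi> \<in> fin_supp (objects G \<times> objects G) B"
        using \<Phi> to_matrix_closed of_matrix_closed matrix_simps(1) by blast+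
      fix p assume "p \<in> objects G \<times> objects G"
      then obtain v w where vw: "v \<in> objects G" "w \<in> objects G" "p = (v, w)" by auto
      have "\<Phi> p \<in> carrier B"
        using fin_suppD(1)[OF \<Phi>[unfolded matrix_simps(1)], of p] vw by simp
      then show "to_matrix (of_matrix \<Phi>) p = \<Phi> p"
        unfolding vw(3)
      proof (intro group_algebra_eqI to_matrix_entry_closed of_matrix_closed \<Phi> vw)
        fix x assume "x \<in> carrier H"
        then show "to_matrix (of_matrix \<Phi>) (v, w) x = \<Phi> (v, w) x"
          using transport[OF vw(1,2)] vw(1,2) by (simp add: to_matrix_def of_matrix_def)
      qed
    qed
  qed
qed (use to_matrix_closed of_matrix_closed in auto)

text \<open>The arrows with source \<open>w\<close> are parametrised by an object \<open>k\<close>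
  and a loop \<open>y\<close>. In these coordinates the convolution sum splits into an outer sum
  over \<open>k\<close>, the matrix product, and an inner sum over \<open>y\<close>, the product in
  the group algebra.\<close>

lemma to_matrix_mult:
  assumes f: "f \<in> carrier A" and g: "g \<in> carrier A"
  shows "to_matrix (f \<otimes>\<^bsub>A\<^esub> g) = to_matrix f \<otimes>\<^bsub>M\<^esub> to_matrix g"
proof
  interpret B: rng B by (rule group_algebra_rng)
  fix p
  show "to_matrix (f \<otimes>\<^bsub>A\<^esub> g) p = (to_matrix f \<otimes>\<^bsub>M\<^esub> to_matrix g) p"
  proof (cases "p \<in> objects G \<times> objects G")
    case True
    then obtain v w where vw: "v \<in> objects G" "w \<in> objects G" "p = (v, w)" by auto
    let ?F = "\<lambda>k. to_matrix f (v, k) \<otimes>\<^bsub>B\<^esub> to_matrix g (k, w)"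
    have fg_closed: "to_matrix f (v, k) \<in> carrier B" "to_matrix g (k, w) \<in> carrier B" if "k \<in> objects G" for k
      using to_matrix_entry_closed f g vw that by blast+
    then have F_closed: "?F \<in> objects G \<rightarrow> carrier B" by (auto intro: B.m_closed)
    have F_fin: "finite {k \<in> objects G. ?F k \<noteq> \<zero>\<^bsub>B\<^esub>}"
    proof (rule finite_subset)
      show "{k \<in> objects G. ?F k \<noteq> \<zero>\<^bsub>B\<^esub>} \<subseteq> fst ` {q \<in> objects G \<times> objects G. to_matrix g q \<noteq> \<zero>\<^bsub>B\<^esub>}"
      proof
        fix k assume "k \<in> {k \<in> objects G. ?F k \<noteq> \<zero>\<^bsub>B\<^esub>}"
        then have k: "k \<in> objects G" "?F k \<noteq> \<zero>\<^bsub>B\<^esub>" by simp_all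
        then have "to_matrix g (k, w) \<noteq> \<zero>\<^bsub>B\<^esub>" using fg_closed(1)[OF k(1)] B.r_null by metis
        then show "k \<in> fst ` {q \<in> objects G \<times> objects G. to_matrix g q \<noteq> \<zero>\<^bsub>B\<^esub>}"
          using k(1) vw(2) by (intro image_eqI[of _ _ "(k, w)"]) simp_all
      qed
      show "finite (fst ` {q \<in> objects G \<times> objects G. to_matrix g q \<noteq> \<zero>\<^bsub>B\<^esub>})"
        by (intro finite_imageI fin_suppD(2)[OF to_matrix_closed[OF g, unfolded matrix_simps(1)]])
    qed
    have rhs: "(to_matrix f \<otimes>\<^bsub>M\<^esub> to_matrix g) p = supp_sum B ?F (objects G)"
      using vw by (simp add: matrix_simps)
    have "to_matrix (f \<otimes>\<^bsub>A\<^esub> g) (v, w) = supp_sum B ?F (objects G)"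
    proof (rule group_algebra_eqI)
      show "to_matrix (f \<otimes>\<^bsub>A\<^esub> g) (v, w) \<in> carrier B"
        using to_matrix_entry_closed conv_closed f g vw by blast
      show "supp_sum B ?F (objects G) \<in> carrier B" by (rule B.supp_sum_closed[OF F_closed])
      fix x assume x: "x \<in> carrier H"
      let ?c = "transport v w x"
      let ?t = "\<lambda>a. f (?c \<cdot> ginv a) \<otimes> g a"
      let ?h = "\<lambda>(k, y). transport k w y"
      note c = transport[OF vw(1,2) x]
      have img: "{a \<in> arrows G. src a = src ?c} = ?h ` (objects G \<times> carrier H)"
      proof (intro equalityI subsetI)
        fix a assume "a \<in> {a \<in> arrows G. src a = src ?c}"
        then have a: "a \<in> arrows G" "src a = w" using c by auto
        then have "a = ?h (trg a, loop a)" using loop[OF a(1)] by simp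
        then show "a \<in> ?h ` (objects G \<times> carrier H)" using a loop(1) target_closed by blast
      qed (use vw c transport in auto)
      have inj: "inj_on ?h (objects G \<times> carrier H)"
        by (rule inj_on_inverseI[where g = "\<lambda>a. (trg a, loop a)"]) (use vw transport in auto)
      have tm: "?t (transport k w y) = f (transport v k (x \<cdot> ginv y)) \<otimes> g (transport k w y)"
        if "k \<in> objects G" "y \<in> carrier H" for k y
        using transport_comp_inv[OF vw(1,2) that(1) x that(2)] by simp
      have t_closed: "?t a \<in> carrier K" if "a \<in> arrows G" "src a = w" for a
        using that c steinbergD(1)[OF f] steinbergD(1)[OF g] by (simp add: arrow_simps)
      have th_closed: "?t (transport k w y) \<in> carrier K" if "k \<in> objects G" "y \<in> carrier H" for k y
        using transport[OF that(1) vw(2) that(2)] by (intro t_closed)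
      have "to_matrix (f \<otimes>\<^bsub>A\<^esub> g) (v, w) x = supp_sum K ?t {a \<in> arrows G. src a = src ?c}"
        using vw x c by (simp add: to_matrix_def steinberg_simps)
      also have "\<dots> = supp_sum K (\<lambda>z. ?t (?h z)) (objects G \<times> carrier H)"
        unfolding img by (rule supp_sum_reindex[OF inj]) (use th_closed in auto)
      also have "(\<lambda>z. ?t (?h z)) = (\<lambda>(k, y). ?t (transport k w y))" by auto
      also have "supp_sum K (\<lambda>(k, y). ?t (transport k w y)) (objects G \<times> carrier H)
          = supp_sum K (\<lambda>k. supp_sum K (\<lambda>y. ?t (transport k w y)) (carrier H)) (objects G)"
      proof (rule supp_sum_Times[OF _ th_closed])
        \<comment> \<open>Splitting the sum requires joint finiteness in \<open>k\<close> and
          \<open>y\<close>. A nonzero term comes from an arrow in the support of \<open>g\<close>,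
          and that arrow determines both coordinates.\<close>
        let ?P = "(\<lambda>a. (trg a, loop a)) ` {a \<in> arrows G. g a \<noteq> \<zero>}"
        have "(k, y) \<in> ?P" if ky: "k \<in> objects G" "y \<in> carrier H" and nz: "?t (transport k w y) \<noteq> \<zero>" for k y
        proof -
          note t = transport[OF ky(1) vw(2) ky(2)]
          have "f (?c \<cdot> ginv (transport k w y)) \<in> carrier K"
            using t c steinbergD(1)[OF f] by (simp add: arrow_simps)
          then have "g (transport k w y) \<noteq> \<zero>" using nz by auto
          then show ?thesis using t by (intro image_eqI[of _ _ "transport k w y"]) auto
        qed
        then have "{(k, y). k \<in> objects G \<and> y \<in> carrier H \<and> ?t (transport k w y) \<noteq> \<zero>} \<subseteq> ?P" by blast
        moreover have "finite ?P" using steinbergD(2)[OF g] by simp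
        ultimately show "finite {(k, y). k \<in> objects G \<and> y \<in> carrier H \<and> ?t (transport k w y) \<noteq> \<zero>}"
          by (rule finite_subset)
      qed
      also have "\<dots> = supp_sum K (\<lambda>k. ?F k x) (objects G)"
      proof (rule supp_sum_cong[OF refl])
        show "(\<lambda>k. ?F k x) \<in> objects G \<rightarrow> carrier K"
          using F_closed group_algebraD(1) x by (auto simp: Pi_iff)
        fix k assume k: "k \<in> objects G"
        have "?F k x = supp_sum K (\<lambda>y. to_matrix f (v, k) (x \<cdot> ginv y) \<otimes> to_matrix g (k, w) y) (carrier H)"
          using group_algebra_mult fg_closed[OF k] x by blast
        also have "\<dots> = supp_sum K (\<lambda>y. ?t (transport k w y)) (carrier H)"
        proof (rule supp_sum_cong[OF refl])
          fix y assume y: "y \<in> carrier H"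
          have "x \<cdot> ginv y \<in> carrier H" using x y by (simp add: isotropy_simps arrow_simps)
          then show "to_matrix f (v, k) (x \<cdot> ginv y) \<otimes> to_matrix g (k, w) y = ?t (transport k w y)"
            using vw k y by (simp add: tm to_matrix_def)
        qed (use th_closed[OF k] in auto)
        finally show "supp_sum K (\<lambda>y. ?t (transport k w y)) (carrier H) = ?F k x" by simp
      qed
      \<comment> \<open>So far the values at \<open>x\<close> were summed in \<open>K\<close>; now
        the entries are summed in \<open>B\<close> and the result is evaluated at
        \<open>x\<close>.\<close>
      also have "\<dots> = supp_sum B ?F (objects G) x"
        by (rule supp_sum_fin_supp_apply[symmetric, OF abelian_group_axioms group_algebra_abelian_group
              group_algebra_simps(1-3) F_closed F_fin x])
      finally show "to_matrix (f \<otimes>\<^bsub>A\<^esub> g) (v, w) x = supp_sum B ?F (objects G) x" .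
    qed
    then show ?thesis using rhs unfolding vw(3) by simp
  next
    case False
    then show ?thesis by (simp add: to_matrix_def matrix_simps)
  qed
qed

lemma steinberg_iso_matrix: "to_matrix \<in> algebra_iso K A M"
proof -
  have "to_matrix (f \<oplus>\<^bsub>A\<^esub> g) = to_matrix f \<oplus>\<^bsub>M\<^esub> to_matrix g" for f g
    by (auto simp: to_matrix_def steinberg_simps(3) matrix_simps(3) group_algebra_simps(3) transport
        intro!: restrict_ext)
  moreover have "to_matrix (k \<odot>\<^bsub>A\<^esub> f) = k \<odot>\<^bsub>M\<^esub> to_matrix f" for k f
    by (auto simp: to_matrix_def steinberg_simps(5) matrix_simps(4) group_algebra_simps(4) transport
        intro!: restrict_ext)
  ultimately show ?thesis
    unfolding algebra_iso_def using bij_to_matrix to_matrix_mult by simp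
qed

end

theorem proposition5p3:
  fixes K :: "('k, 'l) ring_scheme"
    and G :: "('o, 'a, 'g) groupoid_scheme"
    and u :: 'o
  assumes "field K"
    and "transitive_groupoid G"
    and "u \<in> objects G"
  shows "algebra_isomorphic K (steinberg_algebra K G)
           (matrix_algebra (objects G) (group_algebra K (isotropy_group G u)))
       \<and> (CCR_rng (steinberg_algebra K G) \<longleftrightarrow> CCR_rng (group_algebra K (isotropy_group G u)))
       \<and> (GCR_rng (steinberg_algebra K G) \<longleftrightarrow> GCR_rng (group_algebra K (isotropy_group G u)))"
proof -
  interpret field K by fact
  interpret transitive_groupoid G by fact
  interpret transitive_steinberg K G u
    by unfold_locales fact
  interpret corner: full_corner A B emb e by (rule full_corner_group_algebra)
  show ?thesis
    using steinberg_iso_matrix corner.CCR_corner_iff corner.GCR_corner_iff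
    unfolding algebra_isomorphic_def by blast
qed

end
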